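(* Let $\bm y\in\mathbb R^{n\times d}$ be a realized response and $\bm k$ a missing structure with at least one missing entry. Suppose that $\pi_{\bm k}(\cdot\mid\bm y_{(\bm k)})$ is proper, and that the conditional distributions in the DA and DAI algorithms are well-defined. Then the $L^2$ convergence rate of the DA chain targeting $\pi_{\bm k}(\cdot\mid\bm y_{(\bm k)})$ is at least as small as (i.e. less than or equal to) that of any DAI chain targeting $\pi_{\bm k}(\cdot\mid\bm y_{(\bm k)})$.
   Context: Setting. Fix positive integers $n,p,d$; a design matrix $\bm x\in\mathbb R^{n\times p}$ with $i$th row $\bm x_i^\top$; $m\in\mathbb R$; a symmetric positive semi-definite $\bm a\in\mathbb R^{d\times d}$; and a probability measure $P_{\rm mix}$ on $(0,\infty)$. Let $S$ be the set of symmetric positive definite real $d\times d$ matrices. Integrals $d\bm\beta$ and $d\bm\varsigma$ are with respect to Lebesgue measure on $\mathbb R^{p\times d}$ and on (the free entries of) $S$. Model. The (improper) prior density is $p_{\rm prior}(\bm\beta,\bm\varsigma)\propto|\bm\varsigma|^{-(m+1)/2}\exp\{-\frac12\operatorname{tr}(\bm\varsigma^{-1}\bm a)\}$ on $\mathbb R^{p\times d}\times S$. The joint measure of $(\bm Y,\bm W,\bm B,\bm\Sigma)$ on $\mathbb R^{n\times d}\times(0,\infty)^n\times\mathbb R^{p\times d}\times S$ is $p_{\rm joint}(\bm y,\bm w,\bm\beta,\bm\varsigma)\,d\bm y\,\prod_iP_{\rm mix}(dw_i)\,d\bm\beta\,d\bm\varsigma$, where, with $\bm y_i^\top$ the $i$th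 row of $\bm y$, $$p_{\rm joint}\propto p_{\rm prior}(\bm\beta,\bm\varsigma)\prod_{i=1}^n\frac{w_i^{d/2}}{|\bm\varsigma|^{1/2}}\exp\Big\{-\frac{w_i}{2}(\bm y_i-\bm\beta^\top\bm x_i)^\top\bm\varsigma^{-1}(\bm y_i-\bm\beta^\top\bm x_i)\Big\}.$$ All conditional distributions are defined through $p_{\rm joint}$; a conditional distribution is well-defined (proper) if its unnormalized density obtained from $p_{\rm joint}$ has finite integral. Missing data. A missing structure is $\bm k=(k_{i,j})\in\{0,1\}^{n\times d}$ each of whose rows has at least one $1$; $k_{i,j}=1$ means $Y_{i,j}$ is observed and $k_{i,j}=0$ that it is missing. For any $\bm k\in\{0,1\}^{n\times d}$, $\bm y_{(\bm k)}=(y_{i,j})_{k_{i,j}=1}$, and likewise $\bm Y_{(\bm k)}$. Write $\bm k\prec\bm k'$ if $\bm k\ne\bm k'$ and $k'_{i,j}=1$ whenever $k_{i,j}=1$; then $\bm k'-\bm k$ indicates the entries observed under $\bm k'$ but not under $\bm k$. $\bm k$ is monotone if (i) $k_{i,j}=1$ implies $k_{i',j'}=1$ for all $i'\le i$, $j'\ge j$, and (ii) $k_{i,d}=1$ for all $i$. If the $1$'s in row $i$ of $\bm k$ are at positions $j_1<\dots<j_{d_i}$, $\bm c_{i,(\bm k)}$ is the $d_i\times d$ matrix whose $\ell$th row has a $1$ in position $j_\ell$ and $0$ elsewhere; $\bm y_{i,(\bm k)}=\bm c_{i,(\bm k)}\bm y_i$. Put $$r_{i,(\bm k)}=(\bm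 y_{i,(\bm k)}-\bm c_{i,(\bm k)}\bm\beta^\top\bm x_i)^\top(\bm c_{i,(\bm k)}\bm\varsigma\bm c_{i,(\bm k)}^\top)^{-1}(\bm y_{i,(\bm k)}-\bm c_{i,(\bm k)}\bm\beta^\top\bm x_i).$$ Posterior. The posterior density of $(\bm B,\bm\Sigma)$ given $\bm Y_{(\bm k)}=\bm y_{(\bm k)}$ is $$\pi_{\bm k}(\bm\beta,\bm\varsigma\mid\bm y_{(\bm k)})\propto p_{\rm prior}(\bm\beta,\bm\varsigma)\prod_{i=1}^n\int_0^\infty\frac{w^{d_i/2}}{|\bm c_{i,(\bm k)}\bm\varsigma\bm c_{i,(\bm k)}^\top|^{1/2}}\exp\Big(-\frac{r_{i,(\bm k)}w}{2}\Big)P_{\rm mix}(dw);$$ it is proper if the right-hand side has finite integral over $\mathbb R^{p\times d}\times S$. DA chain. The Markov chain $(\bm B(t),\bm\Sigma(t))_{t\ge0}$ on $\mathbb R^{p\times d}\times S$ which, from $(\bm\beta,\bm\varsigma)$: (I) draws $\bm w$ from the conditional distribution of $\bm W$ given $(\bm B,\bm\Sigma,\bm Y_{(\bm k)})=(\bm\beta,\bm\varsigma,\bm y_{(\bm k)})$, which is $\propto\prod_iw_i^{d_i/2}\exp(-r_{i,(\bm k)}w_i/2)P_{\rm mix}(dw_i)$; (P) draws the next state from the conditional distribution of $(\bm B,\bm\Sigma)$ given $(\bm W,\bm Y_{(\bm k)})=(\bm w,\bm y_{(\bm k)})$. DAI chain. It is determined by a monotone missing structure $\bm k'$ with $\bm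 k\prec\bm k'$. From $(\bm\beta,\bm\varsigma)$: (I1) draw $\bm w$ exactly as in step (I) of the DA chain; (I2) draw $\bm z$ from the conditional distribution of $\bm Y_{(\bm k'-\bm k)}$ given $(\bm Y_{(\bm k)},\bm W,\bm B,\bm\Sigma)=(\bm y_{(\bm k)},\bm w,\bm\beta,\bm\varsigma)$; (P) draw the next state from the conditional distribution of $(\bm B,\bm\Sigma)$ given $(\bm W,\bm Y_{(\bm k)},\bm Y_{(\bm k'-\bm k)})=(\bm w,\bm y_{(\bm k)},\bm z)$. $L^2$ convergence rate. For a Markov kernel $K$ on $(\mathcal X,\mathcal F)$ with stationary probability $\pi$, let $L^2(\pi)$ be the measurable $f:\mathcal X\to\mathbb R$ with $\pi f^2=\int f^2\,d\pi<\infty$, let $\|\mu_1-\mu_2\|_2=\sup\{|\mu_1f-\mu_2f|:f\in L^2(\pi),\ \pi f^2\le1\}$, and let $L^2_*(\pi)$ be the set of probability measures $\mu\ll\pi$ with $d\mu/d\pi\in L^2(\pi)$. The $L^2$ convergence rate is the infimum of $\rho\in[0,1]$ for which there is $C:L^2_*(\pi)\to[0,\infty)$ with $\|\mu K^t-\pi\|_2\le C(\mu)\rho^t$ for all $\mu\in L^2_*(\pi)$ and $t\in\{1,2,\dots\}$. For the DA and DAI chains, $\pi$ is the posterior with density $\pi_{\bm k}(\cdot\mid\bm y_{(\bm k)})$. *)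

theory Defs
  imports
    "HOL-Probability.Probability"
    "Jordan_Normal_Form.Gauss_Jordan_Elimination"
    "Jordan_Normal_Form.Determinant"
begin

section \<open>Matrices and Lebesgue measure on matrix spaces\<close>

text \<open>Only used for invertible arguments.\<close>

definition inv_mat :: "real mat \<Rightarrow> real mat" where
  "inv_mat A = the (mat_inverse A)"

definition pd_mats :: "nat \<Rightarrow> real mat set" where
  "pd_mats d = {A \<in> carrier_mat d d. A\<^sup>T = A \<and>
     (\<forall>v \<in> carrier_vec d. v \<noteq> 0\<^sub>v d \<longrightarrow> 0 < scalar_prod v (A *\<^sub>v v))}"

definition psd_mats :: "nat \<Rightarrow> real mat set" where
  "psd_mats d = {A \<in> carrier_mat d d. A\<^sup>T = A \<and>
     (\<forall>v \<in> carrier_vec d. 0 \<le> scalar_prod v (A *\<^sub>v v))}"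

definition lborel_mat :: "nat \<Rightarrow> nat \<Rightarrow> real mat measure" where
  "lborel_mat p d =
     embed_measure (Pi\<^sub>M ({..<p} \<times> {..<d}) (\<lambda>_. lborel)) (Matrix.mat p d)"

text \<open>Lebesgue measure on symmetric matrices is taken with respect to the free entries,
  namely those on and above the diagonal.\<close>

definition lborel_sym :: "nat \<Rightarrow> real mat measure" where
  "lborel_sym d =
     embed_measure (Pi\<^sub>M {(i, j). i \<le> j \<and> j < d} (\<lambda>_. lborel))
       (\<lambda>f. Matrix.mat d d (\<lambda>(i, j). f (min i j, max i j)))"

definition lborel_pd :: "nat \<Rightarrow> real mat measure" where
  "lborel_pd d = restrict_space (lborel_sym d) (pd_mats d)"


section \<open>Conditional distributions from unnormalized measures\<close>

definition proper :: "'a measure \<Rightarrow> bool" where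
  "proper M \<longleftrightarrow> emeasure M (space M) < \<infinity>"

text \<open>An unnormalized measure without a normalization is replaced by an arbitrary point mass, so
  that kernels built with \<^term>\<open>normalize_measure\<close> are probability kernels everywhere.\<close>

definition normalize_measure :: "'a measure \<Rightarrow> 'a measure" where
  "normalize_measure M =
     (if proper M \<and> emeasure M (space M) \<noteq> 0
      then scale_measure (1 / emeasure M (space M)) M
      else return M (SOME x. x \<in> space M))"


section \<open>Convergence rate in \<open>L\<^sup>2\<close>\<close>

definition L2_dist :: "'a measure \<Rightarrow> 'a measure \<Rightarrow> 'a measure \<Rightarrow> ennreal" where
  "L2_dist \<pi> \<mu>1 \<mu>2 =
     (SUP f \<in> {f \<in> borel_measurable \<pi>. integrable \<pi> (\<lambda>x. (f x)\<^sup>2) \<and> (\<integral>x. (f x)\<^sup>2 \<partial>\<pi>) \<le> 1}.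
        ennreal \<bar>(\<integral>x. f x \<partial>\<mu>1) - (\<integral>x. f x \<partial>\<mu>2)\<bar>)"

definition L2_star :: "'a measure \<Rightarrow> 'a measure set" where
  "L2_star \<pi> = {\<mu>. prob_space \<mu> \<and> sets \<mu> = sets \<pi> \<and> absolutely_continuous \<pi> \<mu> \<and>
     (\<integral>\<^sup>+x. (RN_deriv \<pi> \<mu> x)\<^sup>2 \<partial>\<pi>) < \<infinity>}"

definition iterate_kernel :: "('a \<Rightarrow> 'a measure) \<Rightarrow> nat \<Rightarrow> 'a measure \<Rightarrow> 'a measure" where
  "iterate_kernel K t \<mu> = ((\<lambda>\<nu>. \<nu> \<bind> K) ^^ t) \<mu>"

definition L2_rate :: "'a measure \<Rightarrow> ('a \<Rightarrow> 'a measure) \<Rightarrow> real" where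
  "L2_rate \<pi> K = Inf {\<rho>. 0 \<le> \<rho> \<and> \<rho> \<le> 1 \<and>
     (\<exists>C :: 'a measure \<Rightarrow> real. \<forall>\<mu> \<in> L2_star \<pi>. 0 \<le> C \<mu> \<and>
        (\<forall>t \<ge> 1. L2_dist \<pi> (iterate_kernel K t \<mu>) \<pi> \<le> ennreal (C \<mu> * \<rho> ^ t)))}"


section \<open>Missing structures\<close>

text \<open>A 0-1 matrix is represented by the set of positions of its ones, with rows and columns
  counted from 0. Then \<open>k \<prec> k'\<close> is \<open>k \<subset> k'\<close>, and \<open>k' - k\<close> is the set difference.\<close>

definition missing_structure :: "nat \<Rightarrow> nat \<Rightarrow> (nat \<times> nat) set \<Rightarrow> bool" where
  "missing_structure n d k \<longleftrightarrow>
     k \<subseteq> {..<n} \<times> {..<d} \<and> (\<forall>i < n. \<exists>j < d. (i, j) \<in> k)"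

definition monotone_structure :: "nat \<Rightarrow> nat \<Rightarrow> (nat \<times> nat) set \<Rightarrow> bool" where
  "monotone_structure n d k \<longleftrightarrow> missing_structure n d k \<and>
     (\<forall>i j i' j'. (i, j) \<in> k \<and> i' \<le> i \<and> j \<le> j' \<and> j' < d \<longrightarrow> (i', j') \<in> k) \<and>
     (\<forall>i < n. (i, d - 1) \<in> k)"

definition observed_cols :: "(nat \<times> nat) set \<Rightarrow> nat \<Rightarrow> nat set" where
  "observed_cols k i = {j. (i, j) \<in> k}"

definition sel_mat :: "nat \<Rightarrow> (nat \<times> nat) set \<Rightarrow> nat \<Rightarrow> real mat" where
  "sel_mat d k i = Matrix.mat (card (observed_cols k i)) d
     (\<lambda>(l, j). if j = sorted_list_of_set (observed_cols k i) ! l then 1 else 0)"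

text \<open>\<open>fill y s u\<close> is \<open>y\<close> with the entries at the positions in \<open>s\<close> replaced by those of \<open>u\<close>.\<close>

definition fill :: "real mat \<Rightarrow> (nat \<times> nat) set \<Rightarrow> (nat \<times> nat \<Rightarrow> real) \<Rightarrow> real mat" where
  "fill y s u = Matrix.mat (dim_row y) (dim_col y)
     (\<lambda>ij. if ij \<in> s then u ij else y $$ ij)"

definition lborel_entries :: "(nat \<times> nat) set \<Rightarrow> (nat \<times> nat \<Rightarrow> real) measure" where
  "lborel_entries s = Pi\<^sub>M s (\<lambda>_. lborel)"


section \<open>The model, the posterior and the two chains\<close>

locale robust_regression =
  fixes n p d :: nat
    and x :: "real mat"
    and m :: real
    and a :: "real mat"
    and P_mix :: "real measure"
  assumes n_pos: "0 < n" and p_pos: "0 < p" and d_pos: "0 < d"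
    and x_carrier: "x \<in> carrier_mat n p"
    and a_psd: "a \<in> psd_mats d"
    and P_mix_prob: "prob_space P_mix"
    and P_mix_sets: "sets P_mix = sets (restrict_space borel {0<..})"
begin

definition param_space :: "(real mat \<times> real mat) measure" where
  "param_space = lborel_mat p d \<Otimes>\<^sub>M lborel_pd d"

definition weight_space :: "(nat \<Rightarrow> real) measure" where
  "weight_space = Pi\<^sub>M {..<n} (\<lambda>_. P_mix)"

definition prior_density :: "real mat \<times> real mat \<Rightarrow> real" where
  "prior_density = (\<lambda>(\<beta>, \<sigma>). Determinant.det \<sigma> powr (- (m + 1) / 2) *
     exp (- (1 / 2) * sum_list (diag_mat (inv_mat \<sigma> * a))))"

definition joint_density ::
    "real mat \<Rightarrow> (nat \<Rightarrow> real) \<Rightarrow> real mat \<times> real mat \<Rightarrow> real" where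
  "joint_density y w = (\<lambda>(\<beta>, \<sigma>). prior_density (\<beta>, \<sigma>) *
     (\<Prod>i<n. let e = Matrix.row y i - \<beta>\<^sup>T *\<^sub>v Matrix.row x i in
        w i powr (real d / 2) / sqrt (Determinant.det \<sigma>) *
        exp (- (w i / 2) * scalar_prod e (inv_mat \<sigma> *\<^sub>v e))))"

text \<open>The density of \<open>(Y\<^bsub>(k)\<^esub>, W, B, \<Sigma>)\<close>: the joint density with the entries of \<open>y\<close> outside \<open>k\<close>
  integrated out. It does not depend on the values that the argument \<open>y\<close> has there.\<close>

definition obs_density ::
    "(nat \<times> nat) set \<Rightarrow> real mat \<Rightarrow> (nat \<Rightarrow> real) \<Rightarrow> real mat \<times> real mat \<Rightarrow> ennreal" where
  "obs_density k y w \<theta> =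
     (\<integral>\<^sup>+u. ennreal (joint_density (fill y ({..<n} \<times> {..<d} - k) u) w \<theta>)
        \<partial>lborel_entries ({..<n} \<times> {..<d} - k))"

definition resid :: "(nat \<times> nat) set \<Rightarrow> real mat \<Rightarrow> nat \<Rightarrow> real mat \<times> real mat \<Rightarrow> real" where
  "resid k y i = (\<lambda>(\<beta>, \<sigma>). let c = sel_mat d k i;
       e = c *\<^sub>v Matrix.row y i - c *\<^sub>v (\<beta>\<^sup>T *\<^sub>v Matrix.row x i) in
     scalar_prod e (inv_mat (c * \<sigma> * c\<^sup>T) *\<^sub>v e))"

definition post_unnorm :: "(nat \<times> nat) set \<Rightarrow> real mat \<Rightarrow> (real mat \<times> real mat) measure" where
  "post_unnorm k y = density param_space (\<lambda>\<theta>. ennreal (prior_density \<theta>) *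
     (\<Prod>i<n. \<integral>\<^sup>+w. ennreal
        (w powr (real (card (observed_cols k i)) / 2) /
           sqrt (Determinant.det (sel_mat d k i * snd \<theta> * (sel_mat d k i)\<^sup>T)) *
         exp (- (resid k y i \<theta> * w / 2))) \<partial>P_mix))"

definition posterior :: "(nat \<times> nat) set \<Rightarrow> real mat \<Rightarrow> (real mat \<times> real mat) measure" where
  "posterior k y = normalize_measure (post_unnorm k y)"

text \<open>The unnormalized conditional distributions of the weights given the parameters and
  \<open>Y\<^bsub>(k)\<^esub>\<close>, of the parameters given the weights and \<open>Y\<^bsub>(k)\<^esub>\<close>, and of \<open>Y\<^bsub>(k' - k)\<^esub>\<close> given the weights,
  the parameters and \<open>Y\<^bsub>(k)\<^esub>\<close>.\<close>

definition cond_W ::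
    "(nat \<times> nat) set \<Rightarrow> real mat \<Rightarrow> real mat \<times> real mat \<Rightarrow> (nat \<Rightarrow> real) measure" where
  "cond_W k y \<theta> = density weight_space (\<lambda>w. obs_density k y w \<theta>)"

definition cond_param ::
    "(nat \<times> nat) set \<Rightarrow> real mat \<Rightarrow> (nat \<Rightarrow> real) \<Rightarrow> (real mat \<times> real mat) measure" where
  "cond_param k y w = density param_space (\<lambda>\<theta>. obs_density k y w \<theta>)"

definition cond_Z ::
    "(nat \<times> nat) set \<Rightarrow> (nat \<times> nat) set \<Rightarrow> real mat \<Rightarrow> (nat \<Rightarrow> real) \<Rightarrow> real mat \<times> real mat \<Rightarrow>
     (nat \<times> nat \<Rightarrow> real) measure" where
  "cond_Z k k' y w \<theta> =
     density (lborel_entries (k' - k)) (\<lambda>z. obs_density k' (fill y (k' - k) z) w \<theta>)"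

text \<open>Conditional distributions are required to be proper for almost every conditioning value
  (which is implied by propriety for every value).\<close>

definition DA_well_defined :: "(nat \<times> nat) set \<Rightarrow> real mat \<Rightarrow> bool" where
  "DA_well_defined k y \<longleftrightarrow>
     (AE \<theta> in param_space. proper (cond_W k y \<theta>)) \<and>
     (AE w in weight_space. proper (cond_param k y w))"

definition DAI_well_defined ::
    "(nat \<times> nat) set \<Rightarrow> (nat \<times> nat) set \<Rightarrow> real mat \<Rightarrow> bool" where
  "DAI_well_defined k k' y \<longleftrightarrow>
     (AE \<theta> in param_space. proper (cond_W k y \<theta>)) \<and>
     (AE (w, \<theta>) in weight_space \<Otimes>\<^sub>M param_space. proper (cond_Z k k' y w \<theta>)) \<and>
     (AE (w, z) in weight_space \<Otimes>\<^sub>M lborel_entries (k' - k).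
        proper (cond_param k' (fill y (k' - k) z) w))"

definition DA_kernel ::
    "(nat \<times> nat) set \<Rightarrow> real mat \<Rightarrow> real mat \<times> real mat \<Rightarrow> (real mat \<times> real mat) measure" where
  "DA_kernel k y \<theta> =
     normalize_measure (cond_W k y \<theta>) \<bind> (\<lambda>w. normalize_measure (cond_param k y w))"

definition DAI_kernel ::
    "(nat \<times> nat) set \<Rightarrow> (nat \<times> nat) set \<Rightarrow> real mat \<Rightarrow> real mat \<times> real mat \<Rightarrow>
     (real mat \<times> real mat) measure" where
  "DAI_kernel k k' y \<theta> =
     normalize_measure (cond_W k y \<theta>) \<bind> (\<lambda>w.
       normalize_measure (cond_Z k k' y w \<theta>) \<bind> (\<lambda>z.
         normalize_measure (cond_param k' (fill y (k' - k) z) w)))"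

end

end

theory Submission
  imports Defs
begin

text \<open>
  Both chains alternate between a kernel \<open>A\<close> from parameters to latent variables and a kernel \<open>B\<close>
  back, where \<open>\<pi> A\<close> and \<open>\<nu> B\<close> are the same joint law. As operators on densities
  \<open>\<langle>f, K g\<rangle> = \<langle>B f, B g\<rangle>\<close>, so \<open>K\<close> is self-adjoint and nonnegative and its
  convergence rate is its norm on centered functions. The latent variable \<open>w\<close> of the DA chain is a
  function of the latent variable \<open>(w, z)\<close> of the DAI chain and the two joint laws are compatible,
  so \<open>B f\<close> for DA is a conditional expectation of \<open>B' f\<close> for DAI, whence
  \<open>\<langle>f, K f\<rangle> \<le> \<langle>f, K' f\<rangle>\<close> and the norms compare. That the posterior is
  stationary for both chains is the Gaussian marginalization formula, obtained by integrating out the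
  missing entries one at a time with a Schur complement.
\<close>

section \<open>Rates of two-step kernels\<close>

text \<open>The rate is defined through trajectories from single starting measures, each with its
  own constant, so no operator norm or spectral measure is formed: all estimates run on probability
  densities g relative to the stationary law, and the centered function is f = g - 1. These g
  represent exactly the admissible starts, and the norm of g - 1 is the L2 distance to stationarity.
  Values stay in \<open>ennreal\<close>, so kernels act by \<open>nn_integral\<close> without
  integrability conditions. The obstacle is that a start-dependent constant says nothing about a
  single step; log-convexity of the squared norms along a trajectory removes it. A bound rho for the
  DAI chain then becomes <f, K' f> <= rho |f|^2, the form comparison hands this to K, and
  Cauchy-Schwarz for the nonnegative form <f, K h> recovers |K f| <= rho |f|. So every rho
  admissible for DAI is admissible for DA. Normalization is total, with a point mass as fallback;
  the measure-theoretic part ensures that the fallback is met only where the joint law has no mass,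
  or by both chains alike.\<close>

definition prob_densities :: "'a measure \<Rightarrow> ('a \<Rightarrow> ennreal) set" where
  "prob_densities M = {g \<in> borel_measurable M. (\<integral>\<^sup>+x. g x \<partial>M) = 1 \<and> (\<integral>\<^sup>+x. (g x)\<^sup>2 \<partial>M) < \<infinity>}"

text \<open>For probability densities this is the L2 inner product of g - 1 and h - 1; for g = h it
  is the chi-square divergence of \<open>density M g\<close> from \<open>M\<close>. Subtracting 1
  after the integral avoids truncated subtraction in \<open>ennreal\<close>.\<close>

definition dcov :: "'a measure \<Rightarrow> ('a \<Rightarrow> ennreal) \<Rightarrow> ('a \<Rightarrow> ennreal) \<Rightarrow> real" where
  "dcov M g h = enn2real (\<integral>\<^sup>+x. g x * h x \<partial>M) - 1"

lemma prob_densities_measurable: "g \<in> prob_densities M \<Longrightarrow> g \<in> borel_measurable M"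
  by (simp add: prob_densities_def)

lemma (in prob_space) enn2real_density:
  assumes g: "g \<in> prob_densities M"
  shows "(\<lambda>x. enn2real (g x)) \<in> borel_measurable M"
    and "AE x in M. g x = ennreal (enn2real (g x))"
    and "integrable M (\<lambda>x. enn2real (g x))" and "(\<integral>x. enn2real (g x) \<partial>M) = 1"
    and "integrable M (\<lambda>x. (enn2real (g x))\<^sup>2)"
proof -
  have [measurable]: "g \<in> borel_measurable M" using g by (rule prob_densities_measurable)
  show [measurable]: "(\<lambda>x. enn2real (g x)) \<in> borel_measurable M" by measurable
  have "AE x in M. g x \<noteq> \<infinity>"
    using g by (intro nn_integral_PInf_AE) (auto simp: prob_densities_def)
  then show ae: "AE x in M. g x = ennreal (enn2real (g x))"
    by eventually_elim (auto simp: top.not_eq_extremum)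
  have 1: "(\<integral>\<^sup>+x. ennreal (enn2real (g x)) \<partial>M) = 1"
    using g nn_integral_cong_AE[OF ae] by (simp add: prob_densities_def)
  show i1: "integrable M (\<lambda>x. enn2real (g x))"
    by (rule integrableI_nn_integral_finite[of _ _ 1]) (auto simp: 1)
  show "(\<integral>x. enn2real (g x) \<partial>M) = 1"
    using 1 nn_integral_eq_integral[OF i1] by (simp add: ennreal_eq_1)
  have "(\<integral>\<^sup>+x. ennreal ((enn2real (g x))\<^sup>2) \<partial>M) = (\<integral>\<^sup>+x. (g x)\<^sup>2 \<partial>M)"
    using ae by (intro nn_integral_cong_AE, eventually_elim)
      (metis ennreal_power enn2real_nonneg)
  also have "\<dots> < \<infinity>" using g by (simp add: prob_densities_def)
  finally show "integrable M (\<lambda>x. (enn2real (g x))\<^sup>2)"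
    by (intro integrableI_bounded) auto
qed

lemma integrable_product_of_squares:
  fixes f h :: "'a \<Rightarrow> real"
  assumes [measurable]: "f \<in> borel_measurable M" "h \<in> borel_measurable M"
    and "integrable M (\<lambda>x. (f x)\<^sup>2)" "integrable M (\<lambda>x. (h x)\<^sup>2)"
  shows "integrable M (\<lambda>x. f x * h x)"
proof (rule Bochner_Integration.integrable_bound)
  show "integrable M (\<lambda>x. (f x)\<^sup>2 + (h x)\<^sup>2)" using assms by auto
  have "\<bar>f x * h x\<bar> \<le> (f x)\<^sup>2 + (h x)\<^sup>2" for x
  proof -
    have "0 \<le> (\<bar>f x\<bar> - \<bar>h x\<bar>)\<^sup>2" by simp
    then have "2 * (\<bar>f x\<bar> * \<bar>h x\<bar>) \<le> (f x)\<^sup>2 + (h x)\<^sup>2" by (simp add: power2_diff mult_ac)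
    moreover have "0 \<le> \<bar>f x\<bar> * \<bar>h x\<bar>" by simp
    ultimately show ?thesis unfolding abs_mult by linarith
  qed
  then show "AE x in M. norm (f x * h x) \<le> norm ((f x)\<^sup>2 + (h x)\<^sup>2)" by simp
qed measurable

text \<open>Reduces to the inequality for nonnegative integrals applied to the absolute values of f
  and h.\<close>

lemma integral_Cauchy_Schwarz:
  fixes f h :: "'a \<Rightarrow> real"
  assumes [measurable]: "f \<in> borel_measurable M" "h \<in> borel_measurable M"
    and f: "integrable M (\<lambda>x. (f x)\<^sup>2)" and h: "integrable M (\<lambda>x. (h x)\<^sup>2)"
  shows "(\<integral>x. f x * h x \<partial>M)\<^sup>2 \<le> (\<integral>x. (f x)\<^sup>2 \<partial>M) * (\<integral>x. (h x)\<^sup>2 \<partial>M)"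
proof -
  have i: "integrable M (\<lambda>x. f x * h x)" by (rule integrable_product_of_squares) (use assms in auto)
  have "ennreal ((\<integral>x. f x * h x \<partial>M)\<^sup>2) = (ennreal \<bar>\<integral>x. f x * h x \<partial>M\<bar>)\<^sup>2"
    by (simp add: ennreal_power)
  also have "\<dots> \<le> (\<integral>\<^sup>+x. ennreal \<bar>f x * h x\<bar> \<partial>M)\<^sup>2"
    using integral_norm_bound_ennreal[OF i] by (intro power_mono) auto
  also have "\<dots> = (\<integral>\<^sup>+x. ennreal \<bar>f x\<bar> * ennreal \<bar>h x\<bar> \<partial>M)\<^sup>2"
    by (simp add: ennreal_mult' abs_mult)
  also have "\<dots> \<le> (\<integral>\<^sup>+x. (ennreal \<bar>f x\<bar>)\<^sup>2 \<partial>M) * (\<integral>\<^sup>+x. (ennreal \<bar>h x\<bar>)\<^sup>2 \<partial>M)"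
    by (rule Cauchy_Schwarz_nn_integral) measurable
  also have "\<dots> = ennreal ((\<integral>x. (f x)\<^sup>2 \<partial>M) * (\<integral>x. (h x)\<^sup>2 \<partial>M))"
    by (simp add: ennreal_power nn_integral_eq_integral[OF f] nn_integral_eq_integral[OF h] ennreal_mult')
  finally show ?thesis by (subst (asm) ennreal_le_iff) auto
qed

text \<open>Both densities have mean 1, so expanding (g - 1)(h - 1) leaves the integral of g h minus
  1. A density is finite almost everywhere, which lets \<open>enn2real\<close> be used without
  loss.\<close>

lemma (in prob_space) dcov_eq_integral:
  assumes g: "g \<in> prob_densities M" and h: "h \<in> prob_densities M"
  shows "dcov M g h = (\<integral>x. (enn2real (g x) - 1) * (enn2real (h x) - 1) \<partial>M)"
proof -
  note G = enn2real_density[OF g] and H = enn2real_density[OF h]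
  have i: "integrable M (\<lambda>x. enn2real (g x) * enn2real (h x))"
    using G H by (intro integrable_product_of_squares)
  have "(\<integral>\<^sup>+x. g x * h x \<partial>M) = (\<integral>\<^sup>+x. ennreal (enn2real (g x) * enn2real (h x)) \<partial>M)"
    using G(2) H(2) by (intro nn_integral_cong_AE, eventually_elim)
      (metis ennreal_mult'' enn2real_nonneg)
  also have "\<dots> = ennreal (\<integral>x. enn2real (g x) * enn2real (h x) \<partial>M)"
    by (rule nn_integral_eq_integral[OF i]) simp
  finally have "(\<integral>\<^sup>+x. g x * h x \<partial>M) = ennreal (\<integral>x. enn2real (g x) * enn2real (h x) \<partial>M)" .
  then have "dcov M g h = (\<integral>x. enn2real (g x) * enn2real (h x) \<partial>M) - 1"
    by (simp add: dcov_def)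
  moreover have "(\<integral>x. (enn2real (g x) - 1) * (enn2real (h x) - 1) \<partial>M) =
      (\<integral>x. enn2real (g x) * enn2real (h x) \<partial>M) - 1"
    using i G H by (simp add: algebra_simps prob_space)
  ultimately show ?thesis by simp
qed

lemma (in prob_space) square_integrable_density_minus_1:
  assumes g: "g \<in> prob_densities M"
  shows "integrable M (\<lambda>x. (enn2real (g x) - 1)\<^sup>2)"
  using enn2real_density[OF g] by (simp add: power2_diff)

lemma (in prob_space) dcov_Cauchy_Schwarz:
  assumes g: "g \<in> prob_densities M" and h: "h \<in> prob_densities M"
  shows "(dcov M g h)\<^sup>2 \<le> dcov M g g * dcov M h h"
  unfolding dcov_eq_integral[OF g h] dcov_eq_integral[OF g g] dcov_eq_integral[OF h h]
  using integral_Cauchy_Schwarz[of "\<lambda>x. enn2real (g x) - 1" M "\<lambda>x. enn2real (h x) - 1"]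
    enn2real_density[OF g] enn2real_density[OF h]
    square_integrable_density_minus_1[OF g] square_integrable_density_minus_1[OF h]
  by (simp add: power2_eq_square)

lemma (in prob_space) dcov_self_nonneg:
  assumes g: "g \<in> prob_densities M"
  shows "0 \<le> dcov M g g"
  unfolding dcov_eq_integral[OF g g] by simp

text \<open>Turns the quantity inside \<open>L2_dist\<close> into a pairing with g - 1, the form
  needed for the duality below. Square integrability on a probability space gives integrability of f
  and of g f.\<close>

lemma (in prob_space) integral_density_minus_integral:
  fixes f :: "'a \<Rightarrow> real"
  assumes g: "g \<in> prob_densities M" and f[measurable]: "f \<in> borel_measurable M"
    and f2: "integrable M (\<lambda>x. (f x)\<^sup>2)"
  shows "(\<integral>x. f x \<partial>density M g) - (\<integral>x. f x \<partial>M) = (\<integral>x. (enn2real (g x) - 1) * f x \<partial>M)"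
proof -
  note G = enn2real_density[OF g]
  have [measurable]: "g \<in> borel_measurable M" using g by (rule prob_densities_measurable)
  have "density M g = density M (\<lambda>x. ennreal (enn2real (g x)))"
    using G(2) by (intro density_cong) auto
  then have "(\<integral>x. f x \<partial>density M g) = (\<integral>x. enn2real (g x) * f x \<partial>M)"
    by (simp add: integral_density)
  moreover have "integrable M (\<lambda>x. enn2real (g x) * f x)"
    using G f2 by (intro integrable_product_of_squares) auto
  moreover have "integrable M f"
    using integrable_product_of_squares[of "\<lambda>_. 1" M f] f2 by simp
  ultimately show ?thesis by (simp add: left_diff_distrib)
qed

text \<open>Self-duality of L2: the supremum of the pairing with g - 1 over the unit ball is the
  norm of g - 1. Cauchy-Schwarz gives the upper bound.\<close>

lemma (in prob_space) L2_dist_density: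
  assumes g: "g \<in> prob_densities M"
  shows "L2_dist M (density M g) M = ennreal (sqrt (dcov M g g))"
proof (rule antisym)
  note G = enn2real_density[OF g]
  let ?u = "\<lambda>x. enn2real (g x) - 1"
  have [measurable]: "?u \<in> borel_measurable M" using G by auto
  note u2 = square_integrable_density_minus_1[OF g]
  have V: "dcov M g g = (\<integral>x. (?u x)\<^sup>2 \<partial>M)"
    unfolding dcov_eq_integral[OF g g] by (simp add: power2_eq_square)
  show "L2_dist M (density M g) M \<le> ennreal (sqrt (dcov M g g))"
    unfolding L2_dist_def
  proof (rule SUP_least, safe)
    fix f :: "'a \<Rightarrow> real" assume f[measurable]: "f \<in> borel_measurable M" and f2: "integrable M (\<lambda>x. (f x)\<^sup>2)"
      and le: "(\<integral>x. (f x)\<^sup>2 \<partial>M) \<le> 1"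
    have "(\<integral>x. ?u x * f x \<partial>M)\<^sup>2 \<le> (\<integral>x. (?u x)\<^sup>2 \<partial>M) * (\<integral>x. (f x)\<^sup>2 \<partial>M)"
      using u2 f2 by (intro integral_Cauchy_Schwarz) auto
    also have "\<dots> \<le> dcov M g g * 1"
      unfolding V using le by (intro mult_left_mono) auto
    finally have "\<bar>\<integral>x. ?u x * f x \<partial>M\<bar> \<le> sqrt (dcov M g g)"
      using real_le_rsqrt by force
    then show "ennreal \<bar>(\<integral>x. f x \<partial>density M g) - (\<integral>x. f x \<partial>M)\<bar> \<le> ennreal (sqrt (dcov M g g))"
      unfolding integral_density_minus_integral[OF g f f2] by (rule ennreal_leI)
  qed
  show "ennreal (sqrt (dcov M g g)) \<le> L2_dist M (density M g) M"
  proof (cases "dcov M g g = 0")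
    case False
    define s where "s = sqrt (dcov M g g)"
    have s: "s > 0" "s\<^sup>2 = dcov M g g"
      using False dcov_self_nonneg[OF g] by (auto simp: s_def)
    \<comment> \<open>The normalized g - 1 is the extremal test function; its pairing with
      \<open>?u\<close> is exactly \<open>s\<close>.\<close>
    define f where "f x = ?u x / s" for x
    have f[measurable]: "f \<in> borel_measurable M" unfolding f_def by measurable
    have f2: "integrable M (\<lambda>x. (f x)\<^sup>2)" "(\<integral>x. (f x)\<^sup>2 \<partial>M) = 1"
      using u2 s False by (auto simp: f_def power_divide V[symmetric])
    have "(\<integral>x. ?u x * f x \<partial>M) = s"
      using s by (simp add: f_def power2_eq_square[symmetric] V[symmetric] field_simps)
    then have "ennreal s = ennreal \<bar>(\<integral>x. f x \<partial>density M g) - (\<integral>x. f x \<partial>M)\<bar>"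
      using s by (simp add: integral_density_minus_integral[OF g f f2(1)])
    also have "\<dots> \<le> L2_dist M (density M g) M"
      unfolding L2_dist_def using f f2 by (intro SUP_upper) auto
    finally show ?thesis by (simp add: s_def)
  qed simp
qed

lemma (in prob_space) density_in_L2_star:
  assumes g: "g \<in> prob_densities M"
  shows "density M g \<in> L2_star M"
proof -
  have [measurable]: "g \<in> borel_measurable M" using g by (rule prob_densities_measurable)
  have "AE x in M. g x = RN_deriv M (density M g) x"
    by (rule RN_deriv_unique) auto
  then have "(\<integral>\<^sup>+x. (RN_deriv M (density M g) x)\<^sup>2 \<partial>M) = (\<integral>\<^sup>+x. (g x)\<^sup>2 \<partial>M)"
    by (intro nn_integral_cong_AE) auto
  moreover have "prob_space (density M g)"
    using g by (intro prob_spaceI) (simp add: emeasure_density prob_densities_def)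
  ultimately show ?thesis using g
    by (auto simp: L2_star_def prob_densities_def absolutely_continuousI_density)
qed

text \<open>The Radon-Nikodym derivative is the witness. With \<open>density_in_L2_star\<close> this
  identifies starting measures with \<open>prob_densities\<close>.\<close>

lemma (in prob_space) L2_star_E:
  assumes "\<mu> \<in> L2_star M"
  obtains g where "g \<in> prob_densities M" "\<mu> = density M g"
proof
  interpret mu: prob_space \<mu> using assms by (simp add: L2_star_def)
  have mu: "density M (RN_deriv M \<mu>) = \<mu>"
    using assms by (intro density_RN_deriv) (auto simp: L2_star_def)
  then show "\<mu> = density M (RN_deriv M \<mu>)" by simp
  have "(\<integral>\<^sup>+x. RN_deriv M \<mu> x \<partial>M) = emeasure \<mu> (space \<mu>)"
    by (subst (1 3) mu[symmetric]) (simp add: emeasure_density)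
  then show "RN_deriv M \<mu> \<in> prob_densities M"
    using assms by (auto simp: prob_densities_def L2_star_def mu.emeasure_space_1)
qed

section \<open>Adjoint pairs of Markov kernels and their action on densities\<close>

lemma nn_integral_square_le:
  assumes "prob_space M" and [measurable]: "g \<in> borel_measurable M"
  shows "(\<integral>\<^sup>+x. g x \<partial>M)\<^sup>2 \<le> (\<integral>\<^sup>+x. (g x)\<^sup>2 \<partial>M)"
  using Cauchy_Schwarz_nn_integral[of g M "\<lambda>_. 1"] prob_space.emeasure_space_1[OF assms(1)]
  by simp

text \<open>\<open>exchange\<close> states equality of the two joint laws, tested on nonnegative
  functions. Test functions of one variable show that A carries pi to nu and B carries nu to pi, so
  pi is stationary for K. In data augmentation, A draws the latent variable and B redraws the
  parameter.\<close>

locale exchange_pair =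
  fixes \<pi> :: "'a measure" and \<nu> :: "'b measure" and A :: "'a \<Rightarrow> 'b measure"
    and B :: "'b \<Rightarrow> 'a measure" and K :: "'a \<Rightarrow> 'a measure"
  assumes prob_\<pi>: "prob_space \<pi>" and prob_\<nu>: "prob_space \<nu>"
    and A_kernel: "A \<in> \<pi> \<rightarrow>\<^sub>M prob_algebra \<nu>"
    and B_kernel: "B \<in> \<nu> \<rightarrow>\<^sub>M prob_algebra \<pi>"
    and exchange: "\<And>h. h \<in> borel_measurable (\<pi> \<Otimes>\<^sub>M \<nu>) \<Longrightarrow>
      (\<integral>\<^sup>+x. (\<integral>\<^sup>+v. h (x, v) \<partial>A x) \<partial>\<pi>) = (\<integral>\<^sup>+v. (\<integral>\<^sup>+x. h (x, v) \<partial>B v) \<partial>\<nu>)"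
    and K_eq: "\<And>x. x \<in> space \<pi> \<Longrightarrow> K x = A x \<bind> B"
begin

sublocale pi: prob_space \<pi> by (rule prob_\<pi>)
sublocale nu: prob_space \<nu> by (rule prob_\<nu>)

lemma kernels_measurable [measurable]:
  "A \<in> \<pi> \<rightarrow>\<^sub>M subprob_algebra \<nu>" "B \<in> \<nu> \<rightarrow>\<^sub>M subprob_algebra \<pi>"
  using A_kernel B_kernel by (auto intro: measurable_prob_algebraD)

lemma kernel_A: "x \<in> space \<pi> \<Longrightarrow> prob_space (A x)" "x \<in> space \<pi> \<Longrightarrow> sets (A x) = sets \<nu>"
  using measurable_space[OF A_kernel] by (auto simp: space_prob_algebra)

lemma kernel_B: "v \<in> space \<nu> \<Longrightarrow> prob_space (B v)" "v \<in> space \<nu> \<Longrightarrow> sets (B v) = sets \<pi>"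
  using measurable_space[OF B_kernel] by (auto simp: space_prob_algebra)

lemma measurable_kernel_A: "x \<in> space \<pi> \<Longrightarrow> measurable (A x) N = measurable \<nu> N"
  by (rule measurable_cong_sets[OF kernel_A(2) refl])

lemma measurable_kernel_B: "v \<in> space \<nu> \<Longrightarrow> measurable (B v) N = measurable \<pi> N"
  by (rule measurable_cong_sets[OF kernel_B(2) refl])

definition opB :: "('a \<Rightarrow> ennreal) \<Rightarrow> 'b \<Rightarrow> ennreal" where
  "opB g v = (\<integral>\<^sup>+x. g x \<partial>B v)"

definition opA :: "('b \<Rightarrow> ennreal) \<Rightarrow> 'a \<Rightarrow> ennreal" where
  "opA g x = (\<integral>\<^sup>+v. g v \<partial>A x)"

lemma opB_measurable [measurable]: "g \<in> borel_measurable \<pi> \<Longrightarrow> opB g \<in> borel_measurable \<nu>"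
  unfolding opB_def
  by (rule measurable_compose[OF kernels_measurable(2) nn_integral_measurable_subprob_algebra])

lemma opA_measurable [measurable]: "g \<in> borel_measurable \<nu> \<Longrightarrow> opA g \<in> borel_measurable \<pi>"
  unfolding opA_def
  by (rule measurable_compose[OF kernels_measurable(1) nn_integral_measurable_subprob_algebra])

text \<open>\<open>exchange\<close> for the product f x * g v, with the factor that is constant in
  the inner variable pulled out on each side.\<close>

lemma adjoint:
  assumes [measurable]: "f \<in> borel_measurable \<pi>" "g \<in> borel_measurable \<nu>"
  shows "(\<integral>\<^sup>+x. f x * opA g x \<partial>\<pi>) = (\<integral>\<^sup>+v. opB f v * g v \<partial>\<nu>)"
proof -
  have "(\<integral>\<^sup>+x. f x * opA g x \<partial>\<pi>) = (\<integral>\<^sup>+x. (\<integral>\<^sup>+v. f x * g v \<partial>A x) \<partial>\<pi>)"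
    unfolding opA_def
    by (intro nn_integral_cong nn_integral_cmult[symmetric])
       (auto simp: measurable_kernel_A)
  also have "\<dots> = (\<integral>\<^sup>+v. (\<integral>\<^sup>+x. f x * g v \<partial>B v) \<partial>\<nu>)"
    using exchange[of "\<lambda>(x, v). f x * g v"] by simp
  also have "\<dots> = (\<integral>\<^sup>+v. opB f v * g v \<partial>\<nu>)"
    unfolding opB_def
    by (intro nn_integral_cong nn_integral_multc)
       (auto simp: measurable_kernel_B)
  finally show ?thesis .
qed

lemma opA_1: "x \<in> space \<pi> \<Longrightarrow> opA (\<lambda>_. 1) x = 1"
  using kernel_A(1)[of x] by (simp add: opA_def prob_space.emeasure_space_1)

lemma opB_1: "v \<in> space \<nu> \<Longrightarrow> opB (\<lambda>_. 1) v = 1"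
  using kernel_B(1)[of v] by (simp add: opB_def prob_space.emeasure_space_1)

lemma nn_integral_opA:
  assumes [measurable]: "g \<in> borel_measurable \<nu>"
  shows "(\<integral>\<^sup>+x. opA g x \<partial>\<pi>) = (\<integral>\<^sup>+v. g v \<partial>\<nu>)"
  using adjoint[of "\<lambda>_. 1" g] by (simp add: opB_1 cong: nn_integral_cong_simp)

lemma nn_integral_opB:
  assumes [measurable]: "g \<in> borel_measurable \<pi>"
  shows "(\<integral>\<^sup>+x. opB g x \<partial>\<nu>) = (\<integral>\<^sup>+v. g v \<partial>\<pi>)"
  using adjoint[of g "\<lambda>_. 1"] by (simp add: opA_1 cong: nn_integral_cong_simp)

text \<open>Jensen's inequality under each probability measure \<open>A x\<close>, followed by
  preservation of the mean.\<close>

lemma nn_integral_opA_square_le: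
  assumes [measurable]: "g \<in> borel_measurable \<nu>"
  shows "(\<integral>\<^sup>+x. (opA g x)\<^sup>2 \<partial>\<pi>) \<le> (\<integral>\<^sup>+v. (g v)\<^sup>2 \<partial>\<nu>)"
proof -
  have "(\<integral>\<^sup>+x. (opA g x)\<^sup>2 \<partial>\<pi>) \<le> (\<integral>\<^sup>+x. opA (\<lambda>v. (g v)\<^sup>2) x \<partial>\<pi>)"
    unfolding opA_def
    by (intro nn_integral_mono nn_integral_square_le kernel_A)
       (auto simp: measurable_kernel_A)
  then show ?thesis by (simp add: nn_integral_opA)
qed

lemma nn_integral_opB_square_le:
  assumes [measurable]: "g \<in> borel_measurable \<pi>"
  shows "(\<integral>\<^sup>+v. (opB g v)\<^sup>2 \<partial>\<nu>) \<le> (\<integral>\<^sup>+x. (g x)\<^sup>2 \<partial>\<pi>)"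
proof -
  have "(\<integral>\<^sup>+v. (opB g v)\<^sup>2 \<partial>\<nu>) \<le> (\<integral>\<^sup>+v. opB (\<lambda>x. (g x)\<^sup>2) v \<partial>\<nu>)"
    unfolding opB_def
    by (intro nn_integral_mono nn_integral_square_le kernel_B)
       (auto simp: measurable_kernel_B)
  then show ?thesis by (simp add: nn_integral_opB)
qed

lemma opA_density:
  assumes "g \<in> prob_densities \<nu>"
  shows "opA g \<in> prob_densities \<pi>"
  using assms nn_integral_opA_square_le[of g]
  by (auto simp: prob_densities_def nn_integral_opA)

lemma opB_density:
  assumes "g \<in> prob_densities \<pi>"
  shows "opB g \<in> prob_densities \<nu>"
  using assms nn_integral_opB_square_le[of g]
  by (auto simp: prob_densities_def nn_integral_opB)

text \<open>On functions this is integration against \<open>K x\<close>. By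
  \<open>bind_density\<close> the same operator transports densities, which is where reversibility
  enters.\<close>

definition opK :: "('a \<Rightarrow> ennreal) \<Rightarrow> 'a \<Rightarrow> ennreal" where
  "opK g = opA (opB g)"

lemma opK_density: "g \<in> prob_densities \<pi> \<Longrightarrow> opK g \<in> prob_densities \<pi>"
  by (simp add: opK_def opA_density opB_density)

lemma opK_power_density: "g \<in> prob_densities \<pi> \<Longrightarrow> (opK ^^ t) g \<in> prob_densities \<pi>"
  by (induction t) (auto intro: opK_density)

lemma dcov_opK_self_le:
  assumes g: "g \<in> prob_densities \<pi>"
  shows "dcov \<pi> (opK g) (opK g) \<le> dcov \<pi> g g"
proof -
  note [measurable] = prob_densities_measurable[OF g]
  have "(\<integral>\<^sup>+x. (opK g x)\<^sup>2 \<partial>\<pi>) \<le> (\<integral>\<^sup>+x. (g x)\<^sup>2 \<partial>\<pi>)"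
    unfolding opK_def
    by (rule order_trans[OF nn_integral_opA_square_le nn_integral_opB_square_le]) measurable
  moreover have "(\<integral>\<^sup>+x. (g x)\<^sup>2 \<partial>\<pi>) < \<infinity>" using g by (simp add: prob_densities_def)
  ultimately show ?thesis
    unfolding dcov_def by (simp add: power2_eq_square[symmetric] enn2real_mono)
qed

text \<open>The factorization of K through the latent space: its quadratic form is a squared norm of
  \<open>opB g\<close>, hence nonnegative. The subtracted 1 is the same on both sides because
  \<open>opB\<close> preserves the mean.\<close>

lemma dcov_opK:
  assumes "g \<in> prob_densities \<pi>" "h \<in> prob_densities \<pi>"
  shows "dcov \<pi> g (opK h) = dcov \<nu> (opB g) (opB h)"
  using adjoint[of g "opB h"] assms[THEN prob_densities_measurable]
  by (simp add: dcov_def opK_def)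

lemma dcov_opK_symmetric:
  assumes "g \<in> prob_densities \<pi>" "h \<in> prob_densities \<pi>"
  shows "dcov \<pi> g (opK h) = dcov \<pi> (opK g) h"
proof -
  have "dcov \<pi> (opK g) h = dcov \<pi> h (opK g)" by (simp add: dcov_def mult.commute)
  then show ?thesis using assms by (simp add: dcov_opK) (simp add: dcov_def mult.commute)
qed

lemma bind_density:
  assumes g: "g \<in> prob_densities \<pi>"
  shows "density \<pi> g \<bind> K = density \<pi> (opK g)"
proof (rule measure_eqI)
  have [measurable]: "g \<in> borel_measurable \<pi>" using g by (rule prob_densities_measurable)
  have eq: "density \<pi> g \<bind> K = density \<pi> g \<bind> (\<lambda>x. A x \<bind> B)"
    by (rule bind_cong) (auto simp: K_eq)
  have K[measurable]: "(\<lambda>x. A x \<bind> B) \<in> \<pi> \<rightarrow>\<^sub>M subprob_algebra \<pi>"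
    by (intro measurable_bind2) measurable
  show "sets (density \<pi> g \<bind> K) = sets (density \<pi> (opK g))"
    unfolding eq by (subst sets_bind[where N=\<pi>]) (auto simp: pi.not_empty sets_kernel[OF K])
  fix E assume "E \<in> sets (density \<pi> g \<bind> K)"
  then have E[measurable]: "E \<in> sets \<pi>"
    unfolding eq by (subst (asm) sets_bind[where N=\<pi>]) (auto simp: pi.not_empty sets_kernel[OF K])
  have opB: "opB (indicator E) v = emeasure (B v) E" if "v \<in> space \<nu>" for v
    using E kernel_B(2)[OF that] by (simp add: opB_def)
  have "emeasure (density \<pi> g \<bind> K) E = (\<integral>\<^sup>+x. emeasure (A x \<bind> B) E \<partial>density \<pi> g)"
    unfolding eq by (rule emeasure_bind[where N=\<pi>]) (auto simp: pi.not_empty)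
  also have "\<dots> = (\<integral>\<^sup>+x. g x * emeasure (A x \<bind> B) E \<partial>\<pi>)"
    by (rule nn_integral_density) measurable
  also have "\<dots> = (\<integral>\<^sup>+x. g x * opK (indicator E) x \<partial>\<pi>)"
  proof (intro nn_integral_cong arg_cong2[where f="(*)"] refl)
    fix x assume x: "x \<in> space \<pi>"
    have "emeasure (A x \<bind> B) E = (\<integral>\<^sup>+v. emeasure (B v) E \<partial>A x)"
      using x by (intro emeasure_bind[where N=\<pi>])
        (auto simp: prob_space.not_empty kernel_A measurable_kernel_A)
    also have "\<dots> = opK (indicator E) x"
      unfolding opK_def opA_def
      using sets_eq_imp_space_eq[OF kernel_A(2)[OF x]]
      by (intro nn_integral_cong) (auto simp: opB)
    finally show "emeasure (A x \<bind> B) E = opK (indicator E) x" .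
  qed
  \<comment> \<open>The adjoint relation is applied twice, moving the operators off the indicator of
    E and onto g.\<close>
  also have "\<dots> = (\<integral>\<^sup>+v. opB g v * opB (indicator E) v \<partial>\<nu>)"
    unfolding opK_def by (rule adjoint) measurable
  also have "\<dots> = (\<integral>\<^sup>+v. indicator E v * opK g v \<partial>\<pi>)"
    unfolding opK_def by (subst adjoint) (auto simp: mult.commute)
  also have "\<dots> = emeasure (density \<pi> (opK g)) E"
    unfolding opK_def by (subst emeasure_density) (auto simp: mult.commute)
  finally show "emeasure (density \<pi> g \<bind> K) E = emeasure (density \<pi> (opK g)) E" .
qed

lemma iterate_kernel_density:
  assumes g: "g \<in> prob_densities \<pi>"
  shows "iterate_kernel K t (density \<pi> g) = density \<pi> ((opK ^^ t) g)"
  using g by (induction t) (auto simp: iterate_kernel_def bind_density opK_power_density)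

text \<open>Log-convexity of the squared norms of the iterates turns the geometric decay along one
  trajectory into a bound for its first step.\<close>

lemma dcov_opK_le_of_rate:
  assumes g: "g \<in> prob_densities \<pi>" and "0 \<le> \<rho>"
    and C: "\<And>t. t \<ge> 1 \<Longrightarrow> L2_dist \<pi> (iterate_kernel K t (density \<pi> g)) \<pi> \<le> ennreal (C * \<rho> ^ t)"
    and "0 \<le> C"
  shows "dcov \<pi> (opK g) (opK g) \<le> \<rho>\<^sup>2 * dcov \<pi> g g"
proof -
  define b where "b t = dcov \<pi> ((opK ^^ t) g) ((opK ^^ t) g)" for t
  note D = opK_power_density[OF g]
  have b0: "b t \<ge> 0" for t unfolding b_def by (rule pi.dcov_self_nonneg[OF D])
  have le: "b t \<le> C\<^sup>2 * (\<rho>\<^sup>2) ^ t" if "t \<ge> 1" for t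
  proof -
    have "sqrt (b t) \<le> C * \<rho> ^ t"
      using C[OF that] \<open>0 \<le> C\<close> \<open>0 \<le> \<rho>\<close>
      unfolding iterate_kernel_density[OF g] pi.L2_dist_density[OF D] b_def[symmetric]
      by (subst (asm) ennreal_le_iff) auto
    then have "(sqrt (b t))\<^sup>2 \<le> (C * \<rho> ^ t)\<^sup>2"
      using b0[of t] by (intro power_mono) auto
    then show ?thesis using b0[of t]
      by (simp add: power_mult_distrib power_mult[symmetric] mult.commute)
  qed
  \<comment> \<open>Self-adjointness turns the squared norm of iterate t + 1 into the pairing of
    iterates t and t + 2, to which Cauchy-Schwarz applies.\<close>
  have conv: "(b (Suc t))\<^sup>2 \<le> b t * b (Suc (Suc t))" for t
  proof -
    have "b (Suc t) = dcov \<pi> ((opK ^^ t) g) ((opK ^^ Suc (Suc t)) g)"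
      using dcov_opK_symmetric[OF D D, of t "Suc t"] by (simp add: b_def)
    then show ?thesis
      using pi.dcov_Cauchy_Schwarz[OF D D, of t "Suc (Suc t)"] by (simp add: b_def)
  qed
  show ?thesis
  proof (rule ccontr)
    assume "\<not> ?thesis"
    then have gt: "b 1 > \<rho>\<^sup>2 * b 0" by (simp add: b_def)
    then have b1: "b 1 > 0" using b0[of 0] by (smt (verit) mult_nonneg_nonneg zero_le_power2)
    have "(b 1)\<^sup>2 \<le> b 0 * b 2" using conv[of 0] by (simp add: numeral_2_eq_2)
    then have b0p: "b 0 > 0" using b1 b0[of 0] b0[of 2]
      by (metis less_eq_real_def mult_zero_left not_le zero_less_power)
    \<comment> \<open>The first ratio of consecutive squared norms. Log-convexity keeps all later
      ratios at least \<open>r\<close>, so \<open>b t\<close> is at least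
      \<open>r ^ t * b 0\<close>.\<close>
    define r where "r = b 1 / b 0"
    have r: "r > \<rho>\<^sup>2" using gt b0p by (simp add: r_def field_simps)
    then have rp: "r > 0" using zero_le_power2[of \<rho>] by linarith
    have step: "b t > 0 \<and> b (Suc t) \<ge> r * b t" for t
    proof (induction t)
      case 0 then show ?case using b0p by (simp add: r_def)
    next
      case (Suc t)
      have p: "b (Suc t) > 0" using Suc rp by (smt (verit) mult_pos_pos)
      have "r * b t * b (Suc t) \<le> b (Suc t) * b (Suc t)"
        using Suc p by (intro mult_right_mono) auto
      also have "\<dots> \<le> b t * b (Suc (Suc t))" using conv[of t] by (simp add: power2_eq_square)
      finally have "b t * (r * b (Suc t)) \<le> b t * b (Suc (Suc t))" by (simp add: mult_ac)
      then show ?case using p Suc by simp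
    qed
    have geo: "b t \<ge> r ^ t * b 0" for t
    proof (induction t)
      case (Suc t)
      have "r ^ Suc t * b 0 = r * (r ^ t * b 0)" by simp
      also have "\<dots> \<le> r * b t" using Suc rp by (intro mult_left_mono) auto
      also have "\<dots> \<le> b (Suc t)" using step[of t] by simp
      finally show ?case .
    qed simp
    \<comment> \<open>Combining r^t * b 0 <= b t <= C^2 * rho^(2t) bounds the positive number
      \<open>b 0\<close> by C^2 * s^t for every t >= 1, and this tends to 0 because s < 1.\<close>
    define s where "s = \<rho>\<^sup>2 / r"
    have "0 \<le> s" "s < 1" using r rp by (auto simp: s_def)
    then have "(\<lambda>t. C\<^sup>2 * s ^ t) \<longlonglongrightarrow> C\<^sup>2 * 0"
      by (intro tendsto_mult tendsto_const LIMSEQ_power_zero) auto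
    then have "eventually (\<lambda>t. C\<^sup>2 * s ^ t < b 0) sequentially"
      using b0p by (intro order_tendstoD) auto
    then obtain t where t: "t \<ge> 1" "C\<^sup>2 * s ^ t < b 0"
      using eventually_ge_at_top[of 1]
      by (metis (mono_tags, lifting) eventually_conj eventually_happens trivial_limit_sequentially)
    have "r ^ t * b 0 \<le> C\<^sup>2 * (\<rho>\<^sup>2) ^ t" using geo[of t] le[OF t(1)] by linarith
    then have "b 0 \<le> C\<^sup>2 * s ^ t"
      using rp by (simp add: s_def power_divide field_simps)
    with t show False by simp
  qed
qed

end

text \<open>The map \<open>q\<close> forgets the extra latent variable. With F = B g, the identities
  |F|^2 = <g, A F> = <g, A' (F o q)> = <B' g, F o q> give |F| <= |B' g| by Cauchy-Schwarz, so the
  contraction property of conditional expectation is obtained without constructing one.\<close>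

lemma L2_rate_le_of_mixing_refinement:
  assumes 1: "exchange_pair \<pi> \<nu> A B K" and 2: "exchange_pair \<pi> \<nu>' A' B' K'"
    and q: "q \<in> \<nu>' \<rightarrow>\<^sub>M \<nu>" and marg: "\<And>x. x \<in> space \<pi> \<Longrightarrow> A x = distr (A' x) \<nu> q"
  shows "L2_rate \<pi> K \<le> L2_rate \<pi> K'"
proof -
  interpret P: exchange_pair \<pi> \<nu> A B K by fact
  interpret R: exchange_pair \<pi> \<nu>' A' B' K' by fact
  note [measurable] = q
  have opA: "P.opA F x = R.opA (\<lambda>v. F (q v)) x"
    if x: "x \<in> space \<pi>" and [measurable]: "F \<in> borel_measurable \<nu>" for F x
    unfolding P.opA_def R.opA_def marg[OF x]
    by (rule nn_integral_distr) (auto simp: R.measurable_kernel_A[OF x])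
  \<comment> \<open>Integrating \<open>marg\<close> over pi shows that nu is the image of nu' under
    \<open>q\<close>.\<close>
  have push: "(\<integral>\<^sup>+v. F v \<partial>\<nu>) = (\<integral>\<^sup>+v. F (q v) \<partial>\<nu>')" if [measurable]: "F \<in> borel_measurable \<nu>" for F
    by (subst P.nn_integral_opA[symmetric], simp, subst R.nn_integral_opA[symmetric], simp)
      (intro nn_integral_cong opA, auto)
  have compare: "dcov \<nu> (P.opB g) (P.opB g) \<le> dcov \<nu>' (R.opB g) (R.opB g)"
    if g: "g \<in> prob_densities \<pi>" for g
  proof -
    have [measurable]: "g \<in> borel_measurable \<pi>" using g by (rule prob_densities_measurable)
    define F where "F = P.opB g"
    have F: "F \<in> prob_densities \<nu>" unfolding F_def by (rule P.opB_density[OF g])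
    then have [measurable]: "F \<in> borel_measurable \<nu>" by (rule prob_densities_measurable)
    have Fq: "(\<lambda>v. F (q v)) \<in> prob_densities \<nu>'"
      using F push[of F] push[of "\<lambda>v. (F v)\<^sup>2"] by (auto simp: prob_densities_def)
    have "(\<integral>\<^sup>+v. F v * F v \<partial>\<nu>) = (\<integral>\<^sup>+x. g x * P.opA F x \<partial>\<pi>)"
      unfolding P.adjoint[OF \<open>g \<in> borel_measurable \<pi>\<close> \<open>F \<in> borel_measurable \<nu>\<close>] by (simp add: F_def)
    also have "\<dots> = (\<integral>\<^sup>+x. g x * R.opA (\<lambda>v. F (q v)) x \<partial>\<pi>)"
      by (intro nn_integral_cong) (simp add: opA)
    also have "\<dots> = (\<integral>\<^sup>+v. F (q v) * R.opB g v \<partial>\<nu>')"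
      by (subst R.adjoint) (auto simp: mult.commute)
    finally have cross: "dcov \<nu> F F = dcov \<nu>' (\<lambda>v. F (q v)) (R.opB g)"
      by (simp add: dcov_def)
    have self: "dcov \<nu> F F = dcov \<nu>' (\<lambda>v. F (q v)) (\<lambda>v. F (q v))"
      using push[of "\<lambda>v. F v * F v"] by (simp add: dcov_def)
    \<comment> \<open>Cauchy-Schwarz bounds the square of \<open>dcov \<nu> F F\<close>; one factor
      cancels, and when that factor is 0 the claim is the nonnegativity of the right-hand
      side.\<close>
    have "dcov \<nu> F F * dcov \<nu> F F \<le> dcov \<nu> F F * dcov \<nu>' (R.opB g) (R.opB g)"
      using R.nu.dcov_Cauchy_Schwarz[OF Fq R.opB_density[OF g]]
      by (simp add: cross[symmetric] self[symmetric] power2_eq_square)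
    then show ?thesis
      using P.nu.dcov_self_nonneg[OF F] R.nu.dcov_self_nonneg[OF R.opB_density[OF g]]
      unfolding F_def[symmetric] by (smt (verit) mult_le_cancel_left)
  qed
  \<comment> \<open>The rates are infima, so it suffices that each bound valid for K' is valid for
    K, with a constant of its own.\<close>
  have transfer: "\<exists>C. \<forall>\<mu>\<in>L2_star \<pi>. 0 \<le> C \<mu> \<and>
      (\<forall>t\<ge>1. L2_dist \<pi> (iterate_kernel K t \<mu>) \<pi> \<le> ennreal (C \<mu> * \<rho> ^ t))"
    if rho: "0 \<le> \<rho>" and C: "\<forall>\<mu>\<in>L2_star \<pi>. 0 \<le> C \<mu> \<and>
      (\<forall>t\<ge>1. L2_dist \<pi> (iterate_kernel K' t \<mu>) \<pi> \<le> ennreal (C \<mu> * \<rho> ^ t))" for \<rho> C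
  proof -
    have form: "dcov \<nu> (P.opB g) (P.opB g) \<le> \<rho> * dcov \<pi> g g" if g: "g \<in> prob_densities \<pi>" for g
    proof -
      have step: "dcov \<pi> (R.opK g) (R.opK g) \<le> \<rho>\<^sup>2 * dcov \<pi> g g"
        using C P.pi.density_in_L2_star[OF g] rho
        by (intro R.dcov_opK_le_of_rate[OF g, where C="C (density \<pi> g)"]) auto
      have "(dcov \<nu>' (R.opB g) (R.opB g))\<^sup>2 \<le> dcov \<pi> g g * dcov \<pi> (R.opK g) (R.opK g)"
        using P.pi.dcov_Cauchy_Schwarz[OF g R.opK_density[OF g]] by (simp add: R.dcov_opK g)
      moreover have "dcov \<pi> g g * dcov \<pi> (R.opK g) (R.opK g) \<le> dcov \<pi> g g * (\<rho>\<^sup>2 * dcov \<pi> g g)"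
        using P.pi.dcov_self_nonneg[OF g] step by (intro mult_left_mono)
      moreover have "dcov \<pi> g g * (\<rho>\<^sup>2 * dcov \<pi> g g) = (\<rho> * dcov \<pi> g g)\<^sup>2"
        unfolding power2_eq_square by (simp only: mult_ac)
      ultimately have "(dcov \<nu>' (R.opB g) (R.opB g))\<^sup>2 \<le> (\<rho> * dcov \<pi> g g)\<^sup>2" by linarith
      then have "dcov \<nu>' (R.opB g) (R.opB g) \<le> \<rho> * dcov \<pi> g g"
        using mult_nonneg_nonneg[OF rho P.pi.dcov_self_nonneg[OF g]] by (rule power2_le_imp_le)
      with compare[OF g] show ?thesis by simp
    qed
    \<comment> \<open>Cauchy-Schwarz for the nonnegative form <., K .> at the pair K g, g: |Kg|^4 <=
      <Kg, K Kg> <g, Kg> <= rho |Kg|^2 * rho |g|^2. This upgrades the bound on the form to a bound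
      on the norm, with g standing for its centered version.\<close>
    have contr: "dcov \<pi> (P.opK g) (P.opK g) \<le> \<rho>\<^sup>2 * dcov \<pi> g g" if g: "g \<in> prob_densities \<pi>" for g
    proof -
      let ?V = "\<lambda>g. dcov \<pi> g g"
      note Kg = P.opK_density[OF g]
      have "(?V (P.opK g))\<^sup>2 \<le> dcov \<nu> (P.opB (P.opK g)) (P.opB (P.opK g)) * dcov \<nu> (P.opB g) (P.opB g)"
        using P.nu.dcov_Cauchy_Schwarz[OF P.opB_density[OF Kg] P.opB_density[OF g]]
        by (simp add: P.dcov_opK[OF Kg g])
      also have "\<dots> \<le> (\<rho> * ?V (P.opK g)) * (\<rho> * ?V g)"
        using form[OF g] form[OF Kg] P.pi.dcov_self_nonneg[OF Kg] rho
          P.nu.dcov_self_nonneg[OF P.opB_density[OF g]]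
        by (intro mult_mono) auto
      finally have "?V (P.opK g) * ?V (P.opK g) \<le> ?V (P.opK g) * (\<rho>\<^sup>2 * ?V g)"
        by (simp add: power2_eq_square mult_ac)
      then show ?thesis
        using P.pi.dcov_self_nonneg[OF Kg] P.pi.dcov_self_nonneg[OF g]
        by (smt (verit) mult_le_cancel_left mult_nonneg_nonneg zero_le_power2)
    qed
    have iter: "dcov \<pi> ((P.opK ^^ t) g) ((P.opK ^^ t) g) \<le> (\<rho> ^ t)\<^sup>2 * dcov \<pi> g g"
      if g: "g \<in> prob_densities \<pi>" for g t
    proof (induction t)
      case (Suc t)
      have "dcov \<pi> ((P.opK ^^ Suc t) g) ((P.opK ^^ Suc t) g) \<le>
          \<rho>\<^sup>2 * dcov \<pi> ((P.opK ^^ t) g) ((P.opK ^^ t) g)"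
        using contr[OF P.opK_power_density[OF g, of t]] by simp
      also have "\<dots> \<le> \<rho>\<^sup>2 * ((\<rho> ^ t)\<^sup>2 * dcov \<pi> g g)"
        using Suc by (intro mult_left_mono) auto
      finally show ?case by (simp add: power_mult_distrib mult_ac)
    qed simp
    \<comment> \<open>The constant must be a function of the measure alone, so a density of it is
      selected by choice. Its value is the initial L2 distance to stationarity.\<close>
    define C' where "C' \<mu> = sqrt (let g = (SOME g. g \<in> prob_densities \<pi> \<and> \<mu> = density \<pi> g) in dcov \<pi> g g)"
      for \<mu>
    have "0 \<le> C' \<mu> \<and> (\<forall>t\<ge>1. L2_dist \<pi> (iterate_kernel K t \<mu>) \<pi> \<le> ennreal (C' \<mu> * \<rho> ^ t))"
      if mu: "\<mu> \<in> L2_star \<pi>" for \<mu>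
    proof -
      define g where "g = (SOME g. g \<in> prob_densities \<pi> \<and> \<mu> = density \<pi> g)"
      have "\<exists>g. g \<in> prob_densities \<pi> \<and> \<mu> = density \<pi> g" using P.pi.L2_star_E[OF mu] by blast
      from someI_ex[OF this] have g: "g \<in> prob_densities \<pi>" "\<mu> = density \<pi> g"
        by (auto simp: g_def)
      have C': "C' \<mu> = sqrt (dcov \<pi> g g)" by (simp add: C'_def g_def Let_def)
      have "sqrt (dcov \<pi> ((P.opK ^^ t) g) ((P.opK ^^ t) g)) \<le> C' \<mu> * \<rho> ^ t" for t
        using iter[OF g(1), of t] rho unfolding C'
        by (intro real_le_lsqrt) (auto simp: power_mult_distrib mult.commute P.pi.dcov_self_nonneg[OF g(1)])
      moreover have "L2_dist \<pi> (iterate_kernel K t \<mu>) \<pi> =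
          ennreal (sqrt (dcov \<pi> ((P.opK ^^ t) g) ((P.opK ^^ t) g)))" for t
        unfolding g(2) P.iterate_kernel_density[OF g(1)]
        by (rule P.pi.L2_dist_density[OF P.opK_power_density[OF g(1)]])
      moreover have "0 \<le> C' \<mu>" unfolding C' using P.pi.dcov_self_nonneg[OF g(1)] by simp
      ultimately show ?thesis by (auto intro!: ennreal_leI)
    qed
    then show ?thesis by blast
  qed
  show ?thesis unfolding L2_rate_def
  proof (rule cInf_superset_mono)
    \<comment> \<open>Distances to stationarity never exceed the initial one, so rho = 1 is
      admissible for K' with the supremum of the distances as constant. A nonempty set of bounds is
      what makes its real infimum comparable.\<close>
    have "L2_dist \<pi> (iterate_kernel K' t \<mu>) \<pi> \<le> ennreal (enn2real (SUP t. L2_dist \<pi> (iterate_kernel K' t \<mu>) \<pi>) * 1 ^ t)"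
      if mu: "\<mu> \<in> L2_star \<pi>" for t \<mu>
    proof -
      obtain g where g: "g \<in> prob_densities \<pi>" "\<mu> = density \<pi> g" using P.pi.L2_star_E[OF mu] by blast
      have "L2_dist \<pi> (iterate_kernel K' t \<mu>) \<pi> \<le> ennreal (sqrt (dcov \<pi> g g))" for t
      proof -
        have "dcov \<pi> ((R.opK ^^ t) g) ((R.opK ^^ t) g) \<le> dcov \<pi> g g"
        proof (induction t)
          case (Suc t)
          then show ?case
            using R.dcov_opK_self_le[OF R.opK_power_density[OF g(1), of t]] by simp
        qed simp
        then show ?thesis
          unfolding g(2) R.iterate_kernel_density[OF g(1)]
            P.pi.L2_dist_density[OF R.opK_power_density[OF g(1)]]
          by (intro ennreal_leI real_sqrt_le_mono)
      qed
      then have "(SUP t. L2_dist \<pi> (iterate_kernel K' t \<mu>) \<pi>) < \<infinity>"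
        by (intro le_less_trans[OF SUP_least[of _ _ "ennreal (sqrt (dcov \<pi> g g))"]]) auto
      then show ?thesis by (auto intro: SUP_upper)
    qed
    then have "1 \<in> {\<rho>. 0 \<le> \<rho> \<and> \<rho> \<le> 1 \<and> (\<exists>C. \<forall>\<mu>\<in>L2_star \<pi>. 0 \<le> C \<mu> \<and>
        (\<forall>t\<ge>1. L2_dist \<pi> (iterate_kernel K' t \<mu>) \<pi> \<le> ennreal (C \<mu> * \<rho> ^ t)))}"
      by (auto intro!: exI[of _ "\<lambda>\<mu>. enn2real (SUP t. L2_dist \<pi> (iterate_kernel K' t \<mu>) \<pi>)"])
    then show "{\<rho>. 0 \<le> \<rho> \<and> \<rho> \<le> 1 \<and> (\<exists>C. \<forall>\<mu>\<in>L2_star \<pi>. 0 \<le> C \<mu> \<and>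
        (\<forall>t\<ge>1. L2_dist \<pi> (iterate_kernel K' t \<mu>) \<pi> \<le> ennreal (C \<mu> * \<rho> ^ t)))} \<noteq> {}" by blast
    show "bdd_below {\<rho>. 0 \<le> \<rho> \<and> \<rho> \<le> 1 \<and> (\<exists>C. \<forall>\<mu>\<in>L2_star \<pi>. 0 \<le> C \<mu> \<and>
        (\<forall>t\<ge>1. L2_dist \<pi> (iterate_kernel K t \<mu>) \<pi> \<le> ennreal (C \<mu> * \<rho> ^ t)))}"
      by (rule bdd_belowI[of _ 0]) auto
    show "{\<rho>. 0 \<le> \<rho> \<and> \<rho> \<le> 1 \<and> (\<exists>C. \<forall>\<mu>\<in>L2_star \<pi>. 0 \<le> C \<mu> \<and>
        (\<forall>t\<ge>1. L2_dist \<pi> (iterate_kernel K' t \<mu>) \<pi> \<le> ennreal (C \<mu> * \<rho> ^ t)))} \<subseteq>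
      {\<rho>. 0 \<le> \<rho> \<and> \<rho> \<le> 1 \<and> (\<exists>C. \<forall>\<mu>\<in>L2_star \<pi>. 0 \<le> C \<mu> \<and>
        (\<forall>t\<ge>1. L2_dist \<pi> (iterate_kernel K t \<mu>) \<pi> \<le> ennreal (C \<mu> * \<rho> ^ t)))}"
      using transfer by blast
  qed
qed

section \<open>Kernels from a joint density\<close>

lemma normalize_measure_simps:
  shows space_normalize_measure: "space (normalize_measure M) = space M"
    and sets_normalize_measure: "sets (normalize_measure M) = sets M"
  by (auto simp: normalize_measure_def space_scale_measure)

lemma prob_space_normalize_measure:
  assumes "space M \<noteq> {}"
  shows "prob_space (normalize_measure M)"
proof (cases "proper M \<and> emeasure M (space M) \<noteq> 0")
  case True
  then have "1 / emeasure M (space M) * emeasure M (space M) = 1"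
    by (simp add: proper_def ennreal_divide_times divide_mult_eq)
  then show ?thesis using True
    by (intro prob_spaceI) (simp add: normalize_measure_def space_scale_measure)
next
  case False
  then show ?thesis using assms
    unfolding normalize_measure_def if_not_P[OF False]
    by (intro prob_space_return) (simp add: some_in_eq)
qed

text \<open>The fallback point is chosen from the space alone, so all unnormalizable measures on one
  space become the same point mass.\<close>

lemma normalize_measure_degenerate:
  assumes "\<not> (proper M \<and> emeasure M (space M) \<noteq> 0)" "sets M = sets N"
  shows "normalize_measure M = return N (SOME x. x \<in> space N)"
  unfolding normalize_measure_def if_not_P[OF assms(1)]
  using sets_eq_imp_space_eq[OF assms(2)] return_cong[OF assms(2)] by simp

lemma normalize_measure_density:
  assumes [measurable]: "f \<in> borel_measurable M"
    and T: "(\<integral>\<^sup>+x. f x \<partial>M) \<noteq> 0" "(\<integral>\<^sup>+x. f x \<partial>M) < \<infinity>"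
  shows "normalize_measure (density M f) = scale_measure (1 / (\<integral>\<^sup>+x. f x \<partial>M)) (density M f)"
proof -
  have "emeasure (density M f) (space M) = (\<integral>\<^sup>+x. f x \<partial>M)"
    by (auto simp: emeasure_density intro!: nn_integral_cong)
  then show ?thesis using T by (simp add: normalize_measure_def proper_def)
qed

lemma nn_integral_normalize_density:
  assumes f[measurable]: "f \<in> borel_measurable M" and h[measurable]: "h \<in> borel_measurable M"
    and T: "(\<integral>\<^sup>+x. f x \<partial>M) \<noteq> 0" "(\<integral>\<^sup>+x. f x \<partial>M) < \<infinity>"
  shows "(\<integral>\<^sup>+x. h x \<partial>normalize_measure (density M f)) =
    1 / (\<integral>\<^sup>+x. f x \<partial>M) * (\<integral>\<^sup>+x. f x * h x \<partial>M)"
  unfolding normalize_measure_density[OF f T]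
  by (simp add: nn_integral_scale_measure nn_integral_density)

text \<open>Constant factors cancel in the normalization. The case in mind is the power of
  \<open>sqrt (2 * pi)\<close> left by integrating out missing entries.\<close>

lemma normalize_measure_density_cmult:
  fixes c :: ennreal
  assumes [measurable]: "f \<in> borel_measurable M" and c: "0 < c" "c < \<infinity>"
  shows "normalize_measure (density M (\<lambda>x. c * f x)) = normalize_measure (density M f)"
proof -
  let ?T = "\<integral>\<^sup>+x. f x \<partial>M"
  have cT: "(\<integral>\<^sup>+x. c * f x \<partial>M) = c * ?T" by (rule nn_integral_cmult) measurable
  have e: "emeasure (density M f) (space M) = ?T"
    "emeasure (density M (\<lambda>x. c * f x)) (space M) = c * ?T"
    by (auto simp: emeasure_density cT[symmetric] intro!: nn_integral_cong)
  show ?thesis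
  proof (cases "?T \<noteq> 0 \<and> ?T < \<infinity>")
    case True
    then have T: "c * ?T \<noteq> 0" "c * ?T < \<infinity>"
      using c by (auto simp: ennreal_mult_less_top)
    show ?thesis
    proof (rule measure_eqI)
      fix A assume "A \<in> sets (normalize_measure (density M (\<lambda>x. c * f x)))"
      then have [measurable]: "A \<in> sets M" by (simp add: normalize_measure_simps)
      have "emeasure (normalize_measure (density M (\<lambda>x. c * f x))) A =
          (\<integral>\<^sup>+x. indicator A x \<partial>normalize_measure (density M (\<lambda>x. c * f x)))"
        by (simp add: normalize_measure_simps)
      also have "\<dots> = 1 / (c * ?T) * (c * (\<integral>\<^sup>+x. f x * indicator A x \<partial>M))"
        using T cT by (subst nn_integral_normalize_density)
          (auto simp: mult.assoc nn_integral_cmult)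
      also have "\<dots> = 1 / ?T * (\<integral>\<^sup>+x. f x * indicator A x \<partial>M)"
      proof -
        have "1 / (c * ?T) * (c * r) = 1 / ?T * r" for r
        proof -
          have "1 / (c * ?T) * c = 1 / ?T"
          proof -
            obtain c' t where "c = ennreal c'" "c' > 0" "?T = ennreal t" "t > 0"
              using c True by (cases c rule: ennreal_cases; cases ?T rule: ennreal_cases)
                (auto simp: ennreal_zero_less_mult_iff)
            then show ?thesis
              by (simp add: divide_ennreal ennreal_mult[symmetric] ennreal_1[symmetric] del: ennreal_1)
          qed
          then show ?thesis by (metis mult.assoc)
        qed
        then show ?thesis .
      qed
      also have "\<dots> = (\<integral>\<^sup>+x. indicator A x \<partial>normalize_measure (density M f))"
        using True by (subst nn_integral_normalize_density) auto
      also have "\<dots> = emeasure (normalize_measure (density M f)) A"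
        by (simp add: normalize_measure_simps)
      finally show "emeasure (normalize_measure (density M (\<lambda>x. c * f x))) A =
          emeasure (normalize_measure (density M f)) A" .
    qed (simp add: normalize_measure_simps)
  next
    case False
    \<comment> \<open>A factor strictly between 0 and infinity preserves the total masses 0 and
      infinity, so both sides fall back to the same point mass.\<close>
    have "c * ?T = 0 \<or> c * ?T = \<infinity>"
      using False c by (auto simp: ennreal_mult_eq_top_iff top.not_eq_extremum)
    then show ?thesis
      using False normalize_measure_degenerate[of "density M f" M]
        normalize_measure_degenerate[of "density M (\<lambda>x. c * f x)" M]
      by (auto simp: proper_def e)
  qed
qed

lemma prob_kernel_simps:
  assumes "f \<in> X \<rightarrow>\<^sub>M prob_algebra Y" "x \<in> space X"
  shows "space (f x) = space Y" "sets (f x) = sets Y" "prob_space (f x)"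
    "measurable (f x) N = measurable Y N"
proof -
  show s: "sets (f x) = sets Y" and "prob_space (f x)"
    using measurable_space[OF assms] by (auto simp: space_prob_algebra)
  show "space (f x) = space Y" "measurable (f x) N = measurable Y N"
    using sets_eq_imp_space_eq[OF s] measurable_cong_sets[OF s refl] by auto
qed

text \<open>The mass of a fixed set is a quotient of two measurable integrals where the normalizer
  is positive and finite. Elsewhere it is a constant, because the fallback point does not vary with
  x.\<close>

lemma (in sigma_finite_measure) normalize_density_kernel:
  assumes g[measurable]: "(\<lambda>(x, v). g x v) \<in> borel_measurable (X \<Otimes>\<^sub>M M)" and ne: "space M \<noteq> {}"
  shows "(\<lambda>x. normalize_measure (density M (g x))) \<in> X \<rightarrow>\<^sub>M prob_algebra M"
proof (rule measurable_prob_algebraI)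
  show "prob_space (normalize_measure (density M (g x)))" if "x \<in> space X" for x
    using ne by (intro prob_space_normalize_measure) simp
  show "(\<lambda>x. normalize_measure (density M (g x))) \<in> X \<rightarrow>\<^sub>M subprob_algebra M"
  proof (rule measurable_subprob_algebra)
    fix A assume A[measurable]: "A \<in> sets M"
    have gx[measurable]: "g x \<in> borel_measurable M" if "x \<in> space X" for x
      using measurable_Pair2[OF g that] by simp
    let ?Z = "\<lambda>x. \<integral>\<^sup>+v. g x v \<partial>M"
    have [measurable]: "?Z \<in> borel_measurable X"
      by (rule borel_measurable_nn_integral) measurable
    have [measurable]: "(\<lambda>x. \<integral>\<^sup>+v. g x v * indicator A v \<partial>M) \<in> borel_measurable X"
      by (rule borel_measurable_nn_integral) measurable
    have "emeasure (normalize_measure (density M (g x))) A =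
        (if ?Z x \<noteq> 0 \<and> ?Z x < \<infinity> then 1 / ?Z x * (\<integral>\<^sup>+v. g x v * indicator A v \<partial>M)
         else indicator A (SOME v. v \<in> space M))" if x: "x \<in> space X" for x
    proof (cases "?Z x \<noteq> 0 \<and> ?Z x < \<infinity>")
      case True
      then show ?thesis using gx[OF x] A
        by (simp add: normalize_measure_density emeasure_density)
    next
      case False
      have "emeasure (density M (g x)) (space M) = ?Z x"
        using gx[OF x] by (auto simp: emeasure_density intro!: nn_integral_cong)
      then have "normalize_measure (density M (g x)) = return M (SOME v. v \<in> space M)"
        using False by (intro normalize_measure_degenerate) (auto simp: proper_def)
      then show ?thesis unfolding if_not_P[OF False] using A by simp
    qed
    then show "(\<lambda>x. emeasure (normalize_measure (density M (g x))) A) \<in> borel_measurable X"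
      by (subst measurable_cong) (assumption, measurable)
  qed (use ne in \<open>auto simp: normalize_measure_simps intro!: prob_space_imp_subprob_space prob_space_normalize_measure\<close>)
qed

text \<open>Multiplying by the normalizer undoes the normalization. Where the normalizer is 0 the
  density vanishes almost everywhere and both sides are 0, whatever the fallback; \<open>fin\<close>
  excludes an infinite normalizer almost everywhere.\<close>

lemma nn_integral_disintegrate:
  assumes g: "\<And>x. x \<in> space X \<Longrightarrow> g x \<in> borel_measurable V"
    and h: "\<And>x. x \<in> space X \<Longrightarrow> h x \<in> borel_measurable V"
    and fin: "AE x in X. (\<integral>\<^sup>+v. g x v \<partial>V) < \<infinity>"
  shows "(\<integral>\<^sup>+x. (\<integral>\<^sup>+v. g x v \<partial>V) * (\<integral>\<^sup>+v. h x v \<partial>normalize_measure (density V (g x))) \<partial>X) =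
    (\<integral>\<^sup>+x. (\<integral>\<^sup>+v. g x v * h x v \<partial>V) \<partial>X)"
proof (rule nn_integral_cong_AE, use fin AE_space in eventually_elim)
  fix x assume fin: "(\<integral>\<^sup>+v. g x v \<partial>V) < \<infinity>" and x: "x \<in> space X"
  note [measurable] = g[OF x] h[OF x]
  show "(\<integral>\<^sup>+v. g x v \<partial>V) * (\<integral>\<^sup>+v. h x v \<partial>normalize_measure (density V (g x))) =
      (\<integral>\<^sup>+v. g x v * h x v \<partial>V)"
  proof (cases "(\<integral>\<^sup>+v. g x v \<partial>V) = 0")
    case True
    then have "AE v in V. g x v = 0" by (simp add: nn_integral_0_iff_AE)
    then have "(\<integral>\<^sup>+v. g x v * h x v \<partial>V) = (\<integral>\<^sup>+v. 0 \<partial>V)"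
      by (intro nn_integral_cong_AE) auto
    then show ?thesis using True by simp
  next
    case False
    then have "(\<integral>\<^sup>+v. g x v \<partial>V) * (1 / (\<integral>\<^sup>+v. g x v \<partial>V)) = 1"
      using fin by (simp add: ennreal_times_divide divide_eq_1_ennreal top.not_eq_extremum)
    then show ?thesis
      using False fin by (simp add: nn_integral_normalize_density mult.assoc[symmetric])
  qed
qed

text \<open>Both sides of \<open>exchange\<close> equal the double integral of g h divided by the
  total mass. B is the normalized conditional law, whereas A is left abstract and constrained only
  by \<open>A_eq\<close>, so that it can also be a draw in two stages.\<close>

lemma exchange_pair_of_density:
  assumes X: "sigma_finite_measure X" and V: "sigma_finite_measure V"
    and neX: "space X \<noteq> {}" and neV: "space V \<noteq> {}"
    and g[measurable]: "(\<lambda>(x, v). g x v) \<in> borel_measurable (X \<Otimes>\<^sub>M V)"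
    and T0: "(\<integral>\<^sup>+x. (\<integral>\<^sup>+v. g x v \<partial>V) \<partial>X) \<noteq> 0" and T: "(\<integral>\<^sup>+x. (\<integral>\<^sup>+v. g x v \<partial>V) \<partial>X) < \<infinity>"
    and A: "A \<in> X \<rightarrow>\<^sub>M prob_algebra V"
    and A_eq: "\<And>h. (\<lambda>(x, v). h x v) \<in> borel_measurable (X \<Otimes>\<^sub>M V) \<Longrightarrow>
      (\<integral>\<^sup>+x. (\<integral>\<^sup>+v. g x v \<partial>V) * (\<integral>\<^sup>+v. h x v \<partial>A x) \<partial>X) = (\<integral>\<^sup>+x. (\<integral>\<^sup>+v. g x v * h x v \<partial>V) \<partial>X)"
    and K: "\<And>x. x \<in> space X \<Longrightarrow> K x = A x \<bind> (\<lambda>v. normalize_measure (density X (\<lambda>x. g x v)))"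
  shows "exchange_pair (normalize_measure (density X (\<lambda>x. \<integral>\<^sup>+v. g x v \<partial>V)))
    (normalize_measure (density V (\<lambda>v. \<integral>\<^sup>+x. g x v \<partial>X)))
    A (\<lambda>v. normalize_measure (density X (\<lambda>x. g x v))) K"
proof -
  interpret X: sigma_finite_measure X by fact
  interpret V: sigma_finite_measure V by fact
  interpret P: pair_sigma_finite X V ..
  let ?p = "\<lambda>x. \<integral>\<^sup>+v. g x v \<partial>V" and ?q = "\<lambda>v. \<integral>\<^sup>+x. g x v \<partial>X"
  have gs[measurable]: "(\<lambda>(v, x). g x v) \<in> borel_measurable (V \<Otimes>\<^sub>M X)"
    using measurable_pair_swap[OF g] by (simp add: split_beta')
  have [measurable]: "?p \<in> borel_measurable X" by (rule V.borel_measurable_nn_integral) measurable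
  have [measurable]: "?q \<in> borel_measurable V" by (rule X.borel_measurable_nn_integral) measurable
  let ?T = "\<integral>\<^sup>+x. ?p x \<partial>X"
  \<comment> \<open>By Fubini the two marginals have the same total mass, so the normalizing
    constants agree on both sides.\<close>
  have Tq: "(\<integral>\<^sup>+v. ?q v \<partial>V) = ?T" by (rule P.Fubini') measurable
  let ?B = "\<lambda>v. normalize_measure (density X (\<lambda>x. g x v))"
  have B: "?B \<in> V \<rightarrow>\<^sub>M prob_algebra X"
    by (rule X.normalize_density_kernel[OF gs neX])
  have pa: "prob_algebra (normalize_measure (density M f)) = prob_algebra M" for M :: "'c measure" and f
    unfolding prob_algebra_def
    by (simp add: normalize_measure_simps cong: subprob_algebra_cong)
  have mc: "measurable (normalize_measure (density M f)) N = measurable M N" for M :: "'c measure" and N :: "'d measure" and f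
    by (rule measurable_cong_sets) (simp_all add: normalize_measure_simps)
  have main: "(\<integral>\<^sup>+x. (\<integral>\<^sup>+v. h (x, v) \<partial>A x) \<partial>normalize_measure (density X ?p)) =
      (\<integral>\<^sup>+v. (\<integral>\<^sup>+x. h (x, v) \<partial>?B v) \<partial>normalize_measure (density V ?q))"
    if "h \<in> borel_measurable (normalize_measure (density X ?p) \<Otimes>\<^sub>M normalize_measure (density V ?q))" for h
  proof -
    have "sets (normalize_measure (density X ?p) \<Otimes>\<^sub>M normalize_measure (density V ?q)) = sets (X \<Otimes>\<^sub>M V)"
      by (intro sets_pair_measure_cong) (simp_all add: normalize_measure_simps)
    with that have h[measurable]: "h \<in> borel_measurable (X \<Otimes>\<^sub>M V)"
      by (metis measurable_cong_sets)
    have Ah[measurable]: "(\<lambda>x. \<integral>\<^sup>+v. h (x, v) \<partial>A x) \<in> borel_measurable X"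
      using A by (intro nn_integral_measurable_subprob_algebra2) (auto intro: measurable_prob_algebraD)
    have Bh[measurable]: "(\<lambda>v. \<integral>\<^sup>+x. h (x, v) \<partial>?B v) \<in> borel_measurable V"
      using B by (intro nn_integral_measurable_subprob_algebra2) (auto intro: measurable_prob_algebraD)
    have "AE v in V. ?q v \<noteq> \<infinity>" using T Tq by (intro nn_integral_PInf_AE) auto
    then have finV: "AE v in V. ?q v < \<infinity>" by (simp add: top.not_eq_extremum)
    have "(\<integral>\<^sup>+x. (\<integral>\<^sup>+v. h (x, v) \<partial>A x) \<partial>normalize_measure (density X ?p)) =
        1 / ?T * (\<integral>\<^sup>+x. ?p x * (\<integral>\<^sup>+v. h (x, v) \<partial>A x) \<partial>X)"
      using T0 T by (intro nn_integral_normalize_density) auto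
    also have "\<dots> = 1 / ?T * (\<integral>\<^sup>+x. (\<integral>\<^sup>+v. g x v * h (x, v) \<partial>V) \<partial>X)"
      using A_eq[of "\<lambda>x v. h (x, v)"] by simp
    also have "(\<integral>\<^sup>+x. (\<integral>\<^sup>+v. g x v * h (x, v) \<partial>V) \<partial>X) = (\<integral>\<^sup>+v. (\<integral>\<^sup>+x. g x v * h (x, v) \<partial>X) \<partial>V)"
      by (rule P.Fubini'[symmetric]) measurable
    also have "\<dots> = (\<integral>\<^sup>+v. ?q v * (\<integral>\<^sup>+x. h (x, v) \<partial>?B v) \<partial>V)"
      using finV measurable_Pair1[OF g] measurable_Pair1[OF h]
      by (subst nn_integral_disintegrate) auto
    also have "1 / ?T * \<dots> = (\<integral>\<^sup>+v. (\<integral>\<^sup>+x. h (x, v) \<partial>?B v) \<partial>normalize_measure (density V ?q))"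
      using T0 T by (subst nn_integral_normalize_density) (auto simp: Tq)
    finally show ?thesis .
  qed
  show ?thesis
  proof (rule exchange_pair.intro)
    show "prob_space (normalize_measure (density X ?p))" "prob_space (normalize_measure (density V ?q))"
      using neX neV by (auto intro!: prob_space_normalize_measure)
    show "A \<in> normalize_measure (density X ?p) \<rightarrow>\<^sub>M prob_algebra (normalize_measure (density V ?q))"
      using A by (simp add: pa mc)
    show "?B \<in> normalize_measure (density V ?q) \<rightarrow>\<^sub>M prob_algebra (normalize_measure (density X ?p))"
      using B by (simp add: pa mc)
    show "K x = A x \<bind> ?B" if "x \<in> space (normalize_measure (density X ?p))" for x
      using that by (intro K) (simp add: normalize_measure_simps)
  qed (rule main)
qed

text \<open>X holds the parameters, W the weights and Z the imputed entries. The link between the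
  chains is that g is the z-marginal of f: it gives both the same stationary law and makes the first
  projection on W x Z the map required by the refinement lemma.\<close>

lemma L2_rate_data_augmentation_le:
  fixes X :: "'a measure" and W :: "'b measure" and Z :: "'c measure"
  assumes X: "sigma_finite_measure X" and W: "sigma_finite_measure W" and Z: "sigma_finite_measure Z"
    and ne: "space X \<noteq> {}" "space W \<noteq> {}" "space Z \<noteq> {}"
    and f[measurable]: "(\<lambda>(x, w, z). f x w z) \<in> borel_measurable (X \<Otimes>\<^sub>M (W \<Otimes>\<^sub>M Z))"
    and g: "\<And>x w. x \<in> space X \<Longrightarrow> w \<in> space W \<Longrightarrow> g x w = (\<integral>\<^sup>+z. f x w z \<partial>Z)"
    and T0: "(\<integral>\<^sup>+x. (\<integral>\<^sup>+w. g x w \<partial>W) \<partial>X) \<noteq> 0" and T: "(\<integral>\<^sup>+x. (\<integral>\<^sup>+w. g x w \<partial>W) \<partial>X) < \<infinity>"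
  defines "\<pi> \<equiv> normalize_measure (density X (\<lambda>x. \<integral>\<^sup>+w. g x w \<partial>W))"
    and "N \<equiv> \<lambda>x. normalize_measure (density W (g x))"
  shows "L2_rate \<pi> (\<lambda>x. N x \<bind> (\<lambda>w. normalize_measure (density X (\<lambda>x. g x w)))) \<le>
    L2_rate \<pi> (\<lambda>x. N x \<bind> (\<lambda>w. normalize_measure (density Z (f x w)) \<bind>
      (\<lambda>z. normalize_measure (density X (\<lambda>x. f x w z)))))"
proof -
  interpret X: sigma_finite_measure X by fact
  interpret W: sigma_finite_measure W by fact
  interpret Z: sigma_finite_measure Z by fact
  interpret WZ: pair_sigma_finite W Z ..
  interpret XW: pair_sigma_finite X W ..
  have f'[measurable]: "(\<lambda>((x, w), z). f x w z) \<in> borel_measurable ((X \<Otimes>\<^sub>M W) \<Otimes>\<^sub>M Z)"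
  proof -
    have "(\<lambda>v. (fst (fst v), snd (fst v), snd v)) \<in> (X \<Otimes>\<^sub>M W) \<Otimes>\<^sub>M Z \<rightarrow>\<^sub>M X \<Otimes>\<^sub>M (W \<Otimes>\<^sub>M Z)" by measurable
    from measurable_compose[OF this f] show ?thesis by (simp add: split_beta')
  qed
  have g_meas[measurable]: "(\<lambda>(x, w). g x w) \<in> borel_measurable (X \<Otimes>\<^sub>M W)"
  proof -
    have "(\<lambda>xw. \<integral>\<^sup>+z. f (fst xw) (snd xw) z \<partial>Z) \<in> borel_measurable (X \<Otimes>\<^sub>M W)"
      using f' by (intro Z.borel_measurable_nn_integral) (simp add: split_beta')
    then show ?thesis
      by (subst measurable_cong[where g="\<lambda>xw. \<integral>\<^sup>+z. f (fst xw) (snd xw) z \<partial>Z"])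
         (auto simp: space_pair_measure g)
  qed
  have Nk[measurable]: "N \<in> X \<rightarrow>\<^sub>M prob_algebra W"
    unfolding N_def by (rule W.normalize_density_kernel[OF g_meas ne(2)])
  define C where "C x w = normalize_measure (density Z (f x w))" for x w
  have Ck[measurable]: "(\<lambda>(x, w). C x w) \<in> X \<Otimes>\<^sub>M W \<rightarrow>\<^sub>M prob_algebra Z"
    using Z.normalize_density_kernel[of "\<lambda>(x, w). f x w" "X \<Otimes>\<^sub>M W", OF _ ne(3)] f'
    by (simp add: C_def split_beta')
  \<comment> \<open>Drawing z and keeping w beside it makes the second stage a kernel into W x Z;
    otherwise w would be lost after z is drawn.\<close>
  define R where "R x w = C x w \<bind> (\<lambda>z. return (W \<Otimes>\<^sub>M Z) (w, z))" for x w
  have Rk[measurable]: "(\<lambda>(x, w). R x w) \<in> X \<Otimes>\<^sub>M W \<rightarrow>\<^sub>M prob_algebra (W \<Otimes>\<^sub>M Z)"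
  proof -
    have "(\<lambda>xw. C (fst xw) (snd xw) \<bind> (\<lambda>z. return (W \<Otimes>\<^sub>M Z) (snd xw, z))) \<in> X \<Otimes>\<^sub>M W \<rightarrow>\<^sub>M prob_algebra (W \<Otimes>\<^sub>M Z)"
      using Ck by (intro measurable_bind_prob_space2[where N=Z]) (auto simp: split_beta')
    then show ?thesis by (simp add: R_def split_beta')
  qed
  define A where "A x = N x \<bind> (\<lambda>w. R x w)" for x
  have Ak: "A \<in> X \<rightarrow>\<^sub>M prob_algebra (W \<Otimes>\<^sub>M Z)"
    unfolding A_def using Rk by (intro measurable_bind_prob_space2[where N=W]) auto
  note subprob = Nk[THEN measurable_prob_algebraD] Ck[THEN measurable_prob_algebraD]
    Rk[THEN measurable_prob_algebraD]
  have sect: "(\<lambda>w. R x w) \<in> W \<rightarrow>\<^sub>M subprob_algebra (W \<Otimes>\<^sub>M Z)" if "x \<in> space X" for x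
    using measurable_Pair2[OF subprob(3) that] by simp
  have Nx: "space (N x) = space W" "sets (N x) = sets W" "prob_space (N x)"
    "measurable (N x) S = measurable W S" if "x \<in> space X" for x and S :: "'d measure"
    using prob_kernel_simps[OF Nk that] by auto
  have Cx: "space (C x w) = space Z" "sets (C x w) = sets Z" "prob_space (C x w)"
    "measurable (C x w) S = measurable Z S" if "x \<in> space X" "w \<in> space W" for x w and S :: "'d measure"
    using prob_kernel_simps[OF Ck, of "(x, w)"] that by (auto simp: space_pair_measure)
  have ret: "(\<lambda>z. return (W \<Otimes>\<^sub>M Z) (w, z)) \<in> Z \<rightarrow>\<^sub>M subprob_algebra (W \<Otimes>\<^sub>M Z)" if "w \<in> space W" for w
    using that by measurable
  have int_R: "(\<integral>\<^sup>+v. h v \<partial>R x w) = (\<integral>\<^sup>+z. h (w, z) \<partial>C x w)"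
    if x: "x \<in> space X" and w: "w \<in> space W" and h[measurable]: "h \<in> borel_measurable (W \<Otimes>\<^sub>M Z)" for x w h
  proof -
    have "(\<integral>\<^sup>+v. h v \<partial>R x w) = (\<integral>\<^sup>+z. (\<integral>\<^sup>+v. h v \<partial>return (W \<Otimes>\<^sub>M Z) (w, z)) \<partial>C x w)"
      unfolding R_def using ret[OF w] Cx[OF x w] by (intro nn_integral_bind[where B="W \<Otimes>\<^sub>M Z"]) auto
    also have "\<dots> = (\<integral>\<^sup>+z. h (w, z) \<partial>C x w)"
      using Cx(1)[OF x w] w by (intro nn_integral_cong nn_integral_return) (auto simp: space_pair_measure)
    finally show ?thesis .
  qed
  have int_A: "(\<integral>\<^sup>+v. h v \<partial>A x) = (\<integral>\<^sup>+w. (\<integral>\<^sup>+z. h (w, z) \<partial>C x w) \<partial>N x)"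
    if x: "x \<in> space X" and h[measurable]: "h \<in> borel_measurable (W \<Otimes>\<^sub>M Z)" for x h
  proof -
    have "(\<integral>\<^sup>+v. h v \<partial>A x) = (\<integral>\<^sup>+w. (\<integral>\<^sup>+v. h v \<partial>R x w) \<partial>N x)"
      unfolding A_def using sect[OF x] Nx[OF x] by (intro nn_integral_bind[where B="W \<Otimes>\<^sub>M Z"]) auto
    also have "\<dots> = (\<integral>\<^sup>+w. (\<integral>\<^sup>+z. h (w, z) \<partial>C x w) \<partial>N x)"
      using Nx(1)[OF x] by (intro nn_integral_cong int_R[OF x]) auto
    finally show ?thesis .
  qed
  have fs: "f x w \<in> borel_measurable Z" if "x \<in> space X" "w \<in> space W" for x w
    using measurable_Pair2[OF f', of "(x, w)"] that by (simp add: space_pair_measure)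
  have fxm: "(\<lambda>(w, z). f x w z) \<in> borel_measurable (W \<Otimes>\<^sub>M Z)" if "x \<in> space X" for x
    using measurable_Pair2[OF f that] by (simp add: split_beta')
  have p_eq: "(\<integral>\<^sup>+v. (case v of (w, z) \<Rightarrow> f x w z) \<partial>(W \<Otimes>\<^sub>M Z)) = (\<integral>\<^sup>+w. g x w \<partial>W)" if x: "x \<in> space X" for x
    using Z.nn_integral_fst[OF fxm[OF x]]
    by (simp add: g[OF x] cong: nn_integral_cong_simp)
  have p_int: "(\<integral>\<^sup>+x. (\<integral>\<^sup>+v. (case v of (w, z) \<Rightarrow> f x w z) \<partial>(W \<Otimes>\<^sub>M Z)) \<partial>X) = (\<integral>\<^sup>+x. (\<integral>\<^sup>+w. g x w \<partial>W) \<partial>X)"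
    by (intro nn_integral_cong p_eq)
  \<comment> \<open>Finite total mass makes the inner normalizers finite almost everywhere, which is
    the properness that disintegration requires.\<close>
  have finX: "AE x in X. (\<integral>\<^sup>+w. g x w \<partial>W) < \<infinity>"
  proof -
    have "(\<lambda>x. \<integral>\<^sup>+w. g x w \<partial>W) \<in> borel_measurable X" by (rule W.borel_measurable_nn_integral) measurable
    then have "AE x in X. (\<integral>\<^sup>+w. g x w \<partial>W) \<noteq> \<infinity>" using T by (intro nn_integral_PInf_AE) auto
    then show ?thesis by (simp add: top.not_eq_extremum)
  qed
  have finXW: "AE xw in X \<Otimes>\<^sub>M W. (\<integral>\<^sup>+z. f (fst xw) (snd xw) z \<partial>Z) < \<infinity>"
  proof -
    have "(\<integral>\<^sup>+xw. g (fst xw) (snd xw) \<partial>(X \<Otimes>\<^sub>M W)) < \<infinity>"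
      using T W.nn_integral_fst[OF g_meas] by (simp add: split_beta')
    then have "AE xw in X \<Otimes>\<^sub>M W. g (fst xw) (snd xw) \<noteq> \<infinity>"
      using g_meas by (intro nn_integral_PInf_AE) (auto simp: split_beta')
    then show ?thesis
      using AE_space by eventually_elim (auto simp: g space_pair_measure top.not_eq_extremum)
  qed
  have gs: "g x \<in> borel_measurable W" if "x \<in> space X" for x
    using measurable_Pair2[OF g_meas that] by simp
  have 1: "exchange_pair \<pi> (normalize_measure (density W (\<lambda>w. \<integral>\<^sup>+x. g x w \<partial>X)))
      N (\<lambda>w. normalize_measure (density X (\<lambda>x. g x w)))
      (\<lambda>x. N x \<bind> (\<lambda>w. normalize_measure (density X (\<lambda>x. g x w))))"
    unfolding \<pi>_def
  proof (rule exchange_pair_of_density[OF X W ne(1,2) g_meas T0 T Nk _ refl])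
    fix h :: "'a \<Rightarrow> 'b \<Rightarrow> ennreal" assume h: "(\<lambda>(x, v). h x v) \<in> borel_measurable (X \<Otimes>\<^sub>M W)"
    show "(\<integral>\<^sup>+x. (\<integral>\<^sup>+w. g x w \<partial>W) * (\<integral>\<^sup>+w. h x w \<partial>N x) \<partial>X) = (\<integral>\<^sup>+x. (\<integral>\<^sup>+w. g x w * h x w \<partial>W) \<partial>X)"
      unfolding N_def using finX gs measurable_Pair2[OF h]
      by (intro nn_integral_disintegrate) auto
  qed
  let ?f = "\<lambda>x v. case v of (w, z) \<Rightarrow> f x w z"
  let ?B = "\<lambda>v. normalize_measure (density X (\<lambda>x. ?f x v))"
  let ?K = "\<lambda>x. N x \<bind> (\<lambda>w. normalize_measure (density Z (f x w)) \<bind>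
      (\<lambda>z. normalize_measure (density X (\<lambda>x. f x w z))))"
  have f2: "(\<lambda>(x, v). ?f x v) \<in> borel_measurable (X \<Otimes>\<^sub>M (W \<Otimes>\<^sub>M Z))"
    using f by simp
  have Bk: "?B \<in> W \<Otimes>\<^sub>M Z \<rightarrow>\<^sub>M prob_algebra X"
  proof (rule X.normalize_density_kernel[OF _ ne(1)])
    show "(\<lambda>(v, x). ?f x v) \<in> borel_measurable ((W \<Otimes>\<^sub>M Z) \<Otimes>\<^sub>M X)"
      using measurable_pair_swap[OF f2] by (simp add: split_beta')
  qed
  have \<pi>2: "\<pi> = normalize_measure (density X (\<lambda>x. \<integral>\<^sup>+v. ?f x v \<partial>(W \<Otimes>\<^sub>M Z)))"
  proof -
    have "density X (\<lambda>x. \<integral>\<^sup>+w. g x w \<partial>W) = density X (\<lambda>x. \<integral>\<^sup>+v. ?f x v \<partial>(W \<Otimes>\<^sub>M Z))"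
    proof (rule density_cong)
      show "(\<lambda>x. \<integral>\<^sup>+w. g x w \<partial>W) \<in> borel_measurable X" by (rule W.borel_measurable_nn_integral) measurable
      show "(\<lambda>x. \<integral>\<^sup>+v. ?f x v \<partial>(W \<Otimes>\<^sub>M Z)) \<in> borel_measurable X"
        using f2 by (rule WZ.borel_measurable_nn_integral)
    qed (simp add: p_eq)
    then show ?thesis unfolding \<pi>_def by simp
  qed
  have 2: "exchange_pair \<pi> (normalize_measure (density (W \<Otimes>\<^sub>M Z) (\<lambda>v. \<integral>\<^sup>+x. ?f x v \<partial>X))) A ?B ?K"
    unfolding \<pi>2
  proof (rule exchange_pair_of_density[OF X WZ.sigma_finite_measure_axioms ne(1) _ f2 _ _ Ak])
    show "space (W \<Otimes>\<^sub>M Z) \<noteq> {}" using ne by (simp add: space_pair_measure)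
    show "(\<integral>\<^sup>+x. (\<integral>\<^sup>+v. ?f x v \<partial>(W \<Otimes>\<^sub>M Z)) \<partial>X) \<noteq> 0" "(\<integral>\<^sup>+x. (\<integral>\<^sup>+v. ?f x v \<partial>(W \<Otimes>\<^sub>M Z)) \<partial>X) < \<infinity>"
      using T0 T unfolding p_int by auto
  next
    fix h :: "'a \<Rightarrow> 'b \<times> 'c \<Rightarrow> ennreal"
    assume h: "(\<lambda>(x, v). h x v) \<in> borel_measurable (X \<Otimes>\<^sub>M (W \<Otimes>\<^sub>M Z))"
    have hx: "h x \<in> borel_measurable (W \<Otimes>\<^sub>M Z)" if "x \<in> space X" for x
      using measurable_Pair2[OF h that] by simp
    have h'[measurable]: "(\<lambda>((x, w), z). h x (w, z)) \<in> borel_measurable ((X \<Otimes>\<^sub>M W) \<Otimes>\<^sub>M Z)"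
    proof -
      have "(\<lambda>v. (fst (fst v), snd (fst v), snd v)) \<in> (X \<Otimes>\<^sub>M W) \<Otimes>\<^sub>M Z \<rightarrow>\<^sub>M X \<Otimes>\<^sub>M (W \<Otimes>\<^sub>M Z)" by measurable
      from measurable_compose[OF this h] show ?thesis by (simp add: split_beta')
    qed
    have hs: "(\<lambda>z. h x (w, z)) \<in> borel_measurable Z" if "x \<in> space X" "w \<in> space W" for x w
      using measurable_Pair2[OF h', of "(x, w)"] that by (simp add: space_pair_measure)
    have H[measurable]: "(\<lambda>(x, w). \<integral>\<^sup>+z. h x (w, z) \<partial>C x w) \<in> borel_measurable (X \<Otimes>\<^sub>M W)"
    proof -
      have "(\<lambda>xw. \<integral>\<^sup>+z. h (fst xw) (snd xw, z) \<partial>(case xw of (x, w) \<Rightarrow> C x w)) \<in> borel_measurable (X \<Otimes>\<^sub>M W)"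
        using h' by (intro nn_integral_measurable_subprob_algebra2[OF _ subprob(2)]) (simp add: split_beta')
      then show ?thesis by (simp add: split_beta')
    qed
    have "(\<integral>\<^sup>+x. (\<integral>\<^sup>+v. ?f x v \<partial>(W \<Otimes>\<^sub>M Z)) * (\<integral>\<^sup>+v. h x v \<partial>A x) \<partial>X) =
        (\<integral>\<^sup>+x. (\<integral>\<^sup>+w. g x w \<partial>W) * (\<integral>\<^sup>+w. (\<integral>\<^sup>+z. h x (w, z) \<partial>C x w) \<partial>N x) \<partial>X)"
      by (intro nn_integral_cong arg_cong2[where f="(*)"] p_eq int_A hx)
    \<comment> \<open>The disintegration is used twice: here for w given x, below over X x W for z
      given (x, w). In between, g is replaced by the integral of f, which is the normalizer of the
      second stage.\<close>
    also have "\<dots> = (\<integral>\<^sup>+x. (\<integral>\<^sup>+w. g x w * (\<integral>\<^sup>+z. h x (w, z) \<partial>C x w) \<partial>W) \<partial>X)"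
      unfolding N_def using finX gs measurable_Pair2[OF H]
      by (intro nn_integral_disintegrate) auto
    also have "\<dots> = (\<integral>\<^sup>+x. (\<integral>\<^sup>+w. (\<integral>\<^sup>+z. f x w z \<partial>Z) * (\<integral>\<^sup>+z. h x (w, z) \<partial>C x w) \<partial>W) \<partial>X)"
      by (intro nn_integral_cong) (simp add: g)
    also have "\<dots> = (\<integral>\<^sup>+xw. (\<integral>\<^sup>+z. f (fst xw) (snd xw) z \<partial>Z) *
        (\<integral>\<^sup>+z. h (fst xw) (snd xw, z) \<partial>normalize_measure (density Z (f (fst xw) (snd xw)))) \<partial>(X \<Otimes>\<^sub>M W))"
    proof -
      have "(\<lambda>xw. (\<integral>\<^sup>+z. f (fst xw) (snd xw) z \<partial>Z) * (\<integral>\<^sup>+z. h (fst xw) (snd xw, z) \<partial>C (fst xw) (snd xw)))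
          \<in> borel_measurable (X \<Otimes>\<^sub>M W)"
        using H f' by (intro borel_measurable_times_ennreal Z.borel_measurable_nn_integral)
          (simp_all add: split_beta')
      from W.nn_integral_fst[OF this] show ?thesis by (simp add: C_def)
    qed
    also have "\<dots> = (\<integral>\<^sup>+xw. (\<integral>\<^sup>+z. f (fst xw) (snd xw) z * h (fst xw) (snd xw, z) \<partial>Z) \<partial>(X \<Otimes>\<^sub>M W))"
      using finXW hs fs
      by (intro nn_integral_disintegrate) (auto simp: space_pair_measure)
    also have "\<dots> = (\<integral>\<^sup>+x. (\<integral>\<^sup>+w. (\<integral>\<^sup>+z. f x w z * h x (w, z) \<partial>Z) \<partial>W) \<partial>X)"
    proof -
      have "(\<lambda>xw. \<integral>\<^sup>+z. f (fst xw) (snd xw) z * h (fst xw) (snd xw, z) \<partial>Z) \<in> borel_measurable (X \<Otimes>\<^sub>M W)"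
        using h' f' by (intro Z.borel_measurable_nn_integral)
          (simp add: split_beta' borel_measurable_times_ennreal)
      from W.nn_integral_fst[OF this] show ?thesis by simp
    qed
    also have "\<dots> = (\<integral>\<^sup>+x. (\<integral>\<^sup>+v. ?f x v * h x v \<partial>(W \<Otimes>\<^sub>M Z)) \<partial>X)"
    proof (rule nn_integral_cong)
      fix x assume x: "x \<in> space X"
      have "(\<lambda>v. ?f x v * h x v) \<in> borel_measurable (W \<Otimes>\<^sub>M Z)"
        using fxm[OF x] hx[OF x] by measurable
      from Z.nn_integral_fst[OF this]
      show "(\<integral>\<^sup>+w. (\<integral>\<^sup>+z. f x w z * h x (w, z) \<partial>Z) \<partial>W) = (\<integral>\<^sup>+v. ?f x v * h x v \<partial>(W \<Otimes>\<^sub>M Z))" by simp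
    qed
    finally show "(\<integral>\<^sup>+x. (\<integral>\<^sup>+v. ?f x v \<partial>(W \<Otimes>\<^sub>M Z)) * (\<integral>\<^sup>+v. h x v \<partial>A x) \<partial>X) =
        (\<integral>\<^sup>+x. (\<integral>\<^sup>+v. ?f x v * h x v \<partial>(W \<Otimes>\<^sub>M Z)) \<partial>X)" .
  next
    fix x assume x: "x \<in> space X"
    have Bs: "?B \<in> W \<Otimes>\<^sub>M Z \<rightarrow>\<^sub>M subprob_algebra X" by (rule measurable_prob_algebraD[OF Bk])
    \<comment> \<open>Associativity of \<open>bind\<close> dissolves the pairs again and exhibits
      the nested draws of the imputation chain.\<close>
    have "A x \<bind> ?B = N x \<bind> (\<lambda>w. R x w \<bind> ?B)"
      unfolding A_def using sect[OF x] Nx[OF x] Bs by (intro bind_assoc[where N="W \<Otimes>\<^sub>M Z" and R=X]) auto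
    also have "\<dots> = ?K x"
    proof (rule bind_cong)
      fix w assume "w \<in> space (N x)"
      then have w: "w \<in> space W" using Nx(1)[OF x] by simp
      have "R x w \<bind> ?B = C x w \<bind> (\<lambda>z. return (W \<Otimes>\<^sub>M Z) (w, z) \<bind> ?B)"
        unfolding R_def using ret[OF w] Cx[OF x w] Bs by (intro bind_assoc[where N="W \<Otimes>\<^sub>M Z" and R=X]) auto
      also have "\<dots> = C x w \<bind> (\<lambda>z. ?B (w, z))"
        using Cx(1)[OF x w] w Bs by (intro bind_cong refl bind_return) (auto simp: space_pair_measure)
      finally show "R x w \<bind> ?B = normalize_measure (density Z (f x w)) \<bind>
          (\<lambda>z. normalize_measure (density X (\<lambda>x. f x w z)))" by (simp add: C_def)
    qed simp
    finally show "?K x = A x \<bind> ?B" by simp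
  qed
  show ?thesis
  proof (rule L2_rate_le_of_mixing_refinement[OF 1 2, where q=fst])
    show "fst \<in> normalize_measure (density (W \<Otimes>\<^sub>M Z) (\<lambda>v. \<integral>\<^sup>+x. ?f x v \<partial>X)) \<rightarrow>\<^sub>M
        normalize_measure (density W (\<lambda>w. \<integral>\<^sup>+x. g x w \<partial>X))"
      by (subst measurable_cong_sets[where M'="W \<Otimes>\<^sub>M Z" and N'=W]) (auto simp: normalize_measure_simps)
    fix x assume "x \<in> space \<pi>"
    then have x: "x \<in> space X" by (simp add: \<pi>_def normalize_measure_simps)
    have sA: "sets (A x) = sets (W \<Otimes>\<^sub>M Z)" using prob_kernel_simps(2)[OF Ak x] .
    show "N x = distr (A x) (normalize_measure (density W (\<lambda>w. \<integral>\<^sup>+x. g x w \<partial>X))) fst"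
    proof (rule measure_eqI)
      fix E assume "E \<in> sets (N x)"
      then have E[measurable]: "E \<in> sets W" using Nx(2)[OF x] by simp
      have E': "E \<in> sets (normalize_measure (density W (\<lambda>w. \<integral>\<^sup>+x. g x w \<partial>X)))"
        by (simp add: normalize_measure_simps)
      have fA: "fst \<in> A x \<rightarrow>\<^sub>M normalize_measure (density W (\<lambda>w. \<integral>\<^sup>+x. g x w \<partial>X))"
        by (subst measurable_cong_sets[where M'="W \<Otimes>\<^sub>M Z" and N'=W]) (auto simp: normalize_measure_simps sA)
      have "emeasure (distr (A x) (normalize_measure (density W (\<lambda>w. \<integral>\<^sup>+x. g x w \<partial>X))) fst) E =
          (\<integral>\<^sup>+v. indicator E (fst v) \<partial>A x)"
        using E' by (subst nn_integral_distr[OF fA, symmetric, of "indicator E"]) auto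
      \<comment> \<open>The inner integrand is constant in z and \<open>C x w\<close> has mass 1, so
        the weight marginal of the two-stage draw is \<open>N x\<close>.\<close>
      also have "\<dots> = (\<integral>\<^sup>+w. (\<integral>\<^sup>+z. indicator E w \<partial>C x w) \<partial>N x)"
        using int_A[OF x, of "\<lambda>v. indicator E (fst v)"] by simp
      also have "\<dots> = (\<integral>\<^sup>+w. indicator E w \<partial>N x)"
        using Cx(3)[OF x] Nx(1)[OF x]
        by (intro nn_integral_cong) (simp add: prob_space.emeasure_space_1)
      also have "\<dots> = emeasure (N x) E" using E Nx(2)[OF x] by simp
      finally show "emeasure (N x) E = emeasure (distr (A x) (normalize_measure (density W (\<lambda>w. \<integral>\<^sup>+x. g x w \<partial>X))) fst) E"
        by simp
    qed (simp add: Nx(2)[OF x] normalize_measure_simps)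
  qed
qed

section \<open>Gaussian marginalization\<close>

lemma inv_mat:
  assumes A: "A \<in> carrier_mat r r" and det: "Determinant.det A \<noteq> 0"
  shows inv_mat_carrier: "inv_mat A \<in> carrier_mat r r"
    and inv_mat_right: "A * inv_mat A = 1\<^sub>m r"
    and inv_mat_left: "inv_mat A * A = 1\<^sub>m r"
proof -
  have "A \<in> Units (ring_mat TYPE(real) r ())"
    by (rule det_non_zero_imp_unit[OF A det])
  then obtain B where B: "mat_inverse A = Some B"
    using mat_inverse(1)[OF A, of "()"] by (cases "mat_inverse A") auto
  show "inv_mat A \<in> carrier_mat r r" "A * inv_mat A = 1\<^sub>m r" "inv_mat A * A = 1\<^sub>m r"
    using mat_inverse(2)[OF A B] B by (auto simp: inv_mat_def)
qed

text \<open>Cramer's rule: multiplying \<open>A * adj_mat A = det A * 1\<close> by the inverse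
  identifies the adjugate. The formula serves twice, for the diagonal entry of the inverse and for
  measurability of inversion.\<close>

lemma inv_mat_index:
  assumes A: "A \<in> carrier_mat r r" and det: "Determinant.det A \<noteq> 0" and ij: "i < r" "j < r"
  shows "inv_mat A $$ (i, j) = cofactor A j i / Determinant.det A"
proof -
  note I = inv_mat[OF A det] and adj = adj_mat[OF A]
  have "adj_mat A = (inv_mat A * A) * adj_mat A"
    using I adj by simp
  also have "\<dots> = inv_mat A * (A * adj_mat A)"
    using A I adj by (intro assoc_mult_mat) auto
  also have "\<dots> = Determinant.det A \<cdot>\<^sub>m inv_mat A"
    using I adj by (subst adj(2), subst mult_smult_distrib) auto
  finally have eq: "adj_mat A = Determinant.det A \<cdot>\<^sub>m inv_mat A" .
  have "cofactor A j i = adj_mat A $$ (i, j)" using A ij by (simp add: adj_mat_def)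
  also have "\<dots> = Determinant.det A * inv_mat A $$ (i, j)" unfolding eq using I ij by simp
  finally show ?thesis using det by simp
qed

lemma pd_mats_carrier: "A \<in> pd_mats r \<Longrightarrow> A \<in> carrier_mat r r"
  by (simp add: pd_mats_def)

lemma pd_mats_sym: "A \<in> pd_mats r \<Longrightarrow> i < r \<Longrightarrow> j < r \<Longrightarrow> A $$ (i, j) = A $$ (j, i)"
  unfolding pd_mats_def by (metis (mono_tags, lifting) carrier_matD index_transpose_mat(1) mem_Collect_eq)

lemma det_pd_nonzero:
  assumes A: "A \<in> pd_mats r"
  shows "Determinant.det A \<noteq> 0"
proof
  assume "Determinant.det A = 0"
  then obtain v where "v \<in> carrier_vec r" "v \<noteq> 0\<^sub>v r" "A *\<^sub>v v = 0\<^sub>v r"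
    using det_0_iff_vec_prod_zero_field[OF pd_mats_carrier[OF A]] by blast
  with A show False by (force simp: pd_mats_def)
qed

lemma quadratic_form_sum:
  assumes "A \<in> carrier_mat r s" "v \<in> carrier_vec r" "w \<in> carrier_vec s"
  shows "scalar_prod v (A *\<^sub>v w) = (\<Sum>a<r. \<Sum>b<s. v $ a * A $$ (a, b) * w $ b)"
  using assms
  by (auto simp: scalar_prod_def sum_distrib_left mult.assoc lessThan_atLeast0 intro!: sum.cong)

text \<open>For u = A^-1 v the quadratic form of the inverse at v equals that of A at u, and u is
  nonzero because A u = v.\<close>

lemma inv_mat_pd:
  assumes A: "A \<in> pd_mats r"
  shows "inv_mat A \<in> pd_mats r"
proof -
  note C = pd_mats_carrier[OF A] and I = inv_mat[OF pd_mats_carrier[OF A] det_pd_nonzero[OF A]]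
  have T: "A\<^sup>T = A" using A by (simp add: pd_mats_def)
  have "(inv_mat A)\<^sup>T = (inv_mat A)\<^sup>T * (A * inv_mat A)"
    using I by simp
  also have "\<dots> = ((inv_mat A)\<^sup>T * A\<^sup>T) * inv_mat A"
    unfolding T using I C by (intro assoc_mult_mat[symmetric]) auto
  also have "(inv_mat A)\<^sup>T * A\<^sup>T = (A * inv_mat A)\<^sup>T"
    using I C by (intro transpose_mult[symmetric]) auto
  also have "(A * inv_mat A)\<^sup>T * inv_mat A = inv_mat A" using I by simp
  finally have sym: "(inv_mat A)\<^sup>T = inv_mat A" .
  have pos: "0 < scalar_prod v (inv_mat A *\<^sub>v v)" if v: "v \<in> carrier_vec r" "v \<noteq> 0\<^sub>v r" for v
  proof -
    let ?u = "inv_mat A *\<^sub>v v"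
    have u: "?u \<in> carrier_vec r" using I v by auto
    have Au: "A *\<^sub>v ?u = v"
      using I C v by (metis assoc_mult_mat_vec one_mult_mat_vec)
    have "A *\<^sub>v 0\<^sub>v r = 0\<^sub>v r" using C by (intro eq_vecI) auto
    then have "?u \<noteq> 0\<^sub>v r" using Au v by metis
    then have "0 < scalar_prod ?u (A *\<^sub>v ?u)" using A u by (auto simp: pd_mats_def)
    also have "\<dots> = scalar_prod v ?u" unfolding Au by (rule comm_scalar_prod[OF u v(1)])
    finally show ?thesis .
  qed
  show ?thesis using I sym pos by (simp add: pd_mats_def)
qed

text \<open>\<open>insert_index a0\<close> enumerates the indices other than \<open>a0\<close> in
  order, matching the indexing of \<open>mat_delete\<close>.\<close>

lemma sum_insert_index:
  fixes f :: "nat \<Rightarrow> 'a::comm_monoid_add"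
  assumes "a0 < Suc n"
  shows "(\<Sum>a<Suc n. f a) = f a0 + (\<Sum>a<n. f (insert_index a0 a))"
proof -
  have "bij_betw (insert_index a0) {..<n} ({..<Suc n} - {a0})"
    using assms
    by (intro bij_betwI[of _ _ _ "delete_index a0"])
       (auto simp: insert_index_def delete_index_def split: if_splits)
  then have "(\<Sum>a<n. f (insert_index a0 a)) = (\<Sum>a\<in>{..<Suc n} - {a0}. f a)"
    by (rule sum.reindex_bij_betw)
  moreover have "(\<Sum>a<Suc n. f a) = f a0 + (\<Sum>a\<in>{..<Suc n} - {a0}. f a)"
    using assms by (intro sum.remove) auto
  ultimately show ?thesis by simp
qed

text \<open>Padding v with a zero at position \<open>a0\<close> gives a vector at which P has the
  quadratic form of the minor at v.\<close>

lemma mat_delete_pd: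
  assumes P: "P \<in> pd_mats (Suc n)" and a0: "a0 < Suc n"
  shows "mat_delete P a0 a0 \<in> pd_mats n"
proof -
  note C = pd_mats_carrier[OF P]
  let ?P = "mat_delete P a0 a0"
  note ix = mat_delete_index[OF C a0 a0, symmetric]
  have C': "?P \<in> carrier_mat n n" using mat_delete_carrier[OF C] by simp
  have il: "insert_index a0 i < Suc n" if "i < n" for i using that by (simp add: insert_index_def)
  have T: "?P\<^sup>T = ?P"
    using C C' by (intro eq_matI) (auto simp: ix il pd_mats_sym[OF P])
  have pos: "0 < scalar_prod v (?P *\<^sub>v v)" if v: "v \<in> carrier_vec n" "v \<noteq> 0\<^sub>v n" for v
  proof -
    define u where "u = Matrix.vec (Suc n) (\<lambda>a. if a = a0 then 0 else v $ delete_index a0 a)"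
    have u: "u \<in> carrier_vec (Suc n)" by (simp add: u_def)
    have u0: "u $ a0 = 0" and ui: "u $ insert_index a0 i = v $ i" if "i < n" for i
      using a0 il[OF that] by (auto simp: u_def insert_index_def delete_index_def)
    obtain i where i: "i < n" "v $ i \<noteq> 0"
      using v by (metis carrier_vecD eq_vecI index_zero_vec)
    have "u \<noteq> 0\<^sub>v (Suc n)" using ui[OF i(1)] i il[OF i(1)] by auto
    then have "0 < scalar_prod u (P *\<^sub>v u)" using P u by (simp add: pd_mats_def)
    also have "\<dots> = scalar_prod v (?P *\<^sub>v v)"
      using u0[OF i(1)] ui
      by (simp add: quadratic_form_sum[OF C u u] quadratic_form_sum[OF C' v(1) v(1)]
          sum_insert_index[OF a0] ix del: sum.lessThan_Suc)
    finally show ?thesis .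
  qed
  show ?thesis using C' T pos by (simp add: pd_mats_def)
qed

lemma unit_vec_nonzero: "i < n \<Longrightarrow> unit_vec n i \<noteq> (0\<^sub>v n :: real vec)"
  by (metis index_unit_vec(1) index_zero_vec(1) zero_neq_one)

lemma pd_diag_pos:
  assumes P: "P \<in> pd_mats r" and i: "i < r"
  shows "0 < P $$ (i, i)"
proof -
  have "0 < scalar_prod (unit_vec r i) (P *\<^sub>v unit_vec r i)"
    using P i unit_vec_nonzero[OF i] by (auto simp: pd_mats_def)
  also have "\<dots> = P $$ (i, i)"
    using pd_mats_carrier[OF P] i by simp
  finally show ?thesis .
qed

text \<open>This is the reciprocal of the Schur complement of the deleted block, that is, the
  conditional precision of coordinate \<open>a0\<close>. The cofactor sign has the even exponent 2 *
  a0.\<close>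

lemma inv_mat_diag:
  assumes P: "P \<in> pd_mats (Suc n)" and a0: "a0 < Suc n"
  shows "inv_mat P $$ (a0, a0) = Determinant.det (mat_delete P a0 a0) / Determinant.det P"
  using inv_mat_index[OF pd_mats_carrier[OF P] det_pd_nonzero[OF P] a0 a0]
  by (simp add: cofactor_def power_add[symmetric])

text \<open>Induction on the size, without eigenvalues: a diagonal entry of the inverse is positive
  and is the quotient of a minor, positive by induction, by the determinant.\<close>

lemma det_pd_pos:
  assumes "P \<in> pd_mats r"
  shows "0 < Determinant.det P"
  using assms
proof (induction r arbitrary: P)
  case 0
  then show ?case using det_dim_zero[of P] by (simp add: pd_mats_def)
next
  case (Suc r)
  have "0 < Determinant.det (mat_delete P 0 0)" by (rule Suc.IH[OF mat_delete_pd[OF Suc.prems]]) simp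
  moreover have "0 < Determinant.det (mat_delete P 0 0) / Determinant.det P"
    using pd_diag_pos[OF inv_mat_pd[OF Suc.prems], of 0] inv_mat_diag[OF Suc.prems, of 0] by simp
  ultimately show ?case by (simp add: zero_less_divide_iff)
qed

text \<open>Splits the Gaussian exponent into a marginal part without coordinate \<open>a0\<close>
  and a square. The number \<open>\<tau>\<close> is the deviation of coordinate \<open>a0\<close>
  from its conditional mean given the others.\<close>

lemma quadratic_form_complete_square:
  assumes P: "P \<in> pd_mats (Suc n)" and a0: "a0 < Suc n" and e: "e \<in> carrier_vec (Suc n)"
  defines "Q \<equiv> inv_mat P" and "P' \<equiv> mat_delete P a0 a0"
    and "e' \<equiv> Matrix.vec n (\<lambda>a. e $ insert_index a0 a)"
  defines "\<tau> \<equiv> (\<Sum>b<Suc n. Q $$ (a0, b) * e $ b) / Q $$ (a0, a0)"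
  shows "scalar_prod e (Q *\<^sub>v e) = scalar_prod e' (inv_mat P' *\<^sub>v e') + Q $$ (a0, a0) * \<tau>\<^sup>2"
proof -
  let ?N = "Suc n"
  note C = pd_mats_carrier[OF P] and I = inv_mat[OF pd_mats_carrier[OF P] det_pd_nonzero[OF P], folded Q_def]
  have Qpd: "Q \<in> pd_mats ?N" unfolding Q_def by (rule inv_mat_pd[OF P])
  note Qsym = pd_mats_sym[OF Qpd]
  have P': "P' \<in> pd_mats n" unfolding P'_def by (rule mat_delete_pd[OF P a0])
  note C' = pd_mats_carrier[OF P'] and I' = inv_mat[OF pd_mats_carrier[OF P'] det_pd_nonzero[OF P']]
  note ix = mat_delete_index[OF C a0 a0, folded P'_def, symmetric]
  have q: "Q $$ (a0, a0) > 0" by (rule pd_diag_pos[OF Qpd a0])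
  have il: "insert_index a0 i < ?N" "insert_index a0 i \<noteq> a0" if "i < n" for i
    using that by (auto simp: insert_index_def)
  have e': "e' \<in> carrier_vec n" by (simp add: e'_def)
  define v where "v a = (\<Sum>b<?N. Q $$ (a, b) * e $ b)" for a
  have \<tau>: "\<tau> = v a0 / Q $$ (a0, a0)" by (simp add: \<tau>_def v_def)
  \<comment> \<open>Subtracting this multiple of column \<open>a0\<close> of Q makes Q e vanish at
    \<open>a0\<close>. Since P Q = 1, applying P changes e only at \<open>a0\<close>, so deleting
    \<open>a0\<close> leaves a solution of P' u' = e'.\<close>
  define u where "u a = v a - \<tau> * Q $$ (a, a0)" for a
  have u0: "u a0 = 0" using q by (simp add: u_def \<tau>)
  have PQ: "(\<Sum>a<?N. P $$ (b, a) * Q $$ (a, c)) = (if b = c then 1 else 0)" if "b < ?N" "c < ?N" for b c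
  proof -
    have "(P * Q) $$ (b, c) = (\<Sum>a<?N. P $$ (b, a) * Q $$ (a, c))"
      using that C I(1) by (simp add: scalar_prod_def lessThan_atLeast0)
    then show ?thesis using I(2) that by simp
  qed
  have Pv: "(\<Sum>a<?N. P $$ (b, a) * v a) = e $ b" if b: "b < ?N" for b
  proof -
    have "(\<Sum>a<?N. P $$ (b, a) * v a) = (\<Sum>c<?N. (\<Sum>a<?N. P $$ (b, a) * Q $$ (a, c)) * e $ c)"
      unfolding v_def sum_distrib_left sum_distrib_right by (subst sum.swap) (simp add: mult.assoc)
    also have "\<dots> = (\<Sum>c<?N. if b = c then e $ c else 0)"
      using b PQ by (intro sum.cong) auto
    finally show ?thesis using b by simp
  qed
  have Pu: "(\<Sum>a<?N. P $$ (b, a) * u a) = e $ b" if b: "b < ?N" "b \<noteq> a0" for b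
  proof -
    have "(\<Sum>a<?N. P $$ (b, a) * u a) =
        (\<Sum>a<?N. P $$ (b, a) * v a) - \<tau> * (\<Sum>a<?N. P $$ (b, a) * Q $$ (a, a0))"
      unfolding u_def sum_distrib_left sum_subtractf[symmetric] by (intro sum.cong) (auto simp: algebra_simps)
    then show ?thesis using Pv[OF b(1)] PQ[OF b(1) a0] b by simp
  qed
  define u' where "u' = Matrix.vec n (\<lambda>a. u (insert_index a0 a))"
  have u': "u' \<in> carrier_vec n" by (simp add: u'_def)
  have "P' *\<^sub>v u' = e'"
  proof (rule eq_vecI)
    fix b assume "b < dim_vec e'"
    then have b: "b < n" by (simp add: e'_def)
    have "(P' *\<^sub>v u') $ b = (\<Sum>a<n. P $$ (insert_index a0 b, insert_index a0 a) * u (insert_index a0 a))"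
      using C' b by (simp add: scalar_prod_def u'_def lessThan_atLeast0 ix)
    also have "\<dots> = (\<Sum>a<?N. P $$ (insert_index a0 b, a) * u a)"
      by (simp add: sum_insert_index[OF a0] u0 del: sum.lessThan_Suc)
    also have "\<dots> = e' $ b" using Pu[OF il[OF b]] b by (simp add: e'_def)
    finally show "(P' *\<^sub>v u') $ b = e' $ b" .
  qed (use C' in \<open>simp add: e'_def\<close>)
  then have "inv_mat P' *\<^sub>v e' = u'"
    using I' C' u' by (metis assoc_mult_mat_vec one_mult_mat_vec)
  then have "scalar_prod e' (inv_mat P' *\<^sub>v e') = (\<Sum>a<n. e $ insert_index a0 a * u (insert_index a0 a))"
    by (simp add: scalar_prod_def e'_def u'_def lessThan_atLeast0)
  also have "\<dots> = (\<Sum>a<?N. e $ a * u a)"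
    by (simp add: sum_insert_index[OF a0] u0 del: sum.lessThan_Suc)
  also have "\<dots> = (\<Sum>a<?N. e $ a * v a) - \<tau> * (\<Sum>a<?N. Q $$ (a0, a) * e $ a)"
    unfolding u_def sum_distrib_left sum_subtractf[symmetric]
    using Qsym a0 by (intro sum.cong) (auto simp: algebra_simps)
  also have "(\<Sum>a<?N. Q $$ (a0, a) * e $ a) = Q $$ (a0, a0) * \<tau>"
    using q by (simp add: \<tau> v_def)
  also have "(\<Sum>a<?N. e $ a * v a) = scalar_prod e (Q *\<^sub>v e)"
    unfolding quadratic_form_sum[OF I(1) e e] by (simp add: v_def sum_distrib_left mult.assoc del: sum.lessThan_Suc)
  finally show ?thesis by (simp add: power2_eq_square)
qed

section \<open>Integrating out one Gaussian coordinate\<close>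

lemma nn_integral_gaussian_shift:
  assumes q: "q > 0"
  shows "(\<integral>\<^sup>+t. ennreal (exp (- (q / 2 * (t - \<mu>)\<^sup>2))) \<partial>lborel) = ennreal (sqrt (2 * pi / q))"
proof -
  let ?s = "1 / sqrt q"
  have s: "?s > 0" using q by simp
  interpret prob_space "density lborel (\<lambda>t. ennreal (normal_density \<mu> ?s t))"
    by (rule prob_space_normal_density[OF s])
  have 1: "(\<integral>\<^sup>+t. ennreal (normal_density \<mu> ?s t) \<partial>lborel) = 1"
    using emeasure_space_1 by (simp add: emeasure_density)
  have "exp (- (q / 2 * (t - \<mu>)\<^sup>2)) = sqrt (2 * pi / q) * normal_density \<mu> ?s t" for t
    using q by (simp add: normal_density_def real_sqrt_divide real_sqrt_mult power_divide field_simps)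
  then have "(\<integral>\<^sup>+t. ennreal (exp (- (q / 2 * (t - \<mu>)\<^sup>2))) \<partial>lborel) =
      (\<integral>\<^sup>+t. ennreal (sqrt (2 * pi / q)) * ennreal (normal_density \<mu> ?s t) \<partial>lborel)"
    using q by (simp add: ennreal_mult)
  also have "\<dots> = ennreal (sqrt (2 * pi / q))" by (subst nn_integral_cmult) (auto simp: 1)
  finally show ?thesis .
qed

text \<open>The centered normal density with covariance P / w, without its power of 2 * pi. The
  dimension is read off the residual vector.\<close>

definition gauss_factor :: "real \<Rightarrow> real mat \<Rightarrow> real vec \<Rightarrow> real" where
  "gauss_factor w P e = w powr (real (dim_vec e) / 2) / sqrt (Determinant.det P) *
     exp (- (scalar_prod e (inv_mat P *\<^sub>v e) * w / 2))"

text \<open>After completing the square, only a one-dimensional Gaussian with precision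
  \<open>?q * w\<close> depends on t. \<open>C\<close> carries the factors of the other observations
  and \<open>\<mu>\<close> is the mean of the integrated coordinate.\<close>

lemma nn_integral_gauss_factor:
  fixes e :: "real \<Rightarrow> real vec" and e' :: "real vec"
  assumes P: "P \<in> pd_mats (Suc n)" and a0: "a0 < Suc n" and w: "w > 0" and C: "0 \<le> C"
    and e: "\<And>t. e t \<in> carrier_vec (Suc n)" and e_a0: "\<And>t. e t $ a0 = t - \<mu>"
    and e_other: "\<And>t i. i < n \<Longrightarrow> e t $ insert_index a0 i = e' $ i" and e': "e' \<in> carrier_vec n"
  shows "(\<integral>\<^sup>+t. ennreal (C * gauss_factor w P (e t)) \<partial>lborel) =
    ennreal (sqrt (2 * pi) * (C * gauss_factor w (mat_delete P a0 a0) e'))"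
proof -
  let ?Q = "inv_mat P" and ?P' = "mat_delete P a0 a0"
  let ?q = "?Q $$ (a0, a0)" and ?N = "Suc n"
  let ?dP = "Determinant.det P" and ?dP' = "Determinant.det ?P'"
  have q: "?q > 0" by (rule pd_diag_pos[OF inv_mat_pd[OF P] a0])
  have dP: "?dP > 0" by (rule det_pd_pos[OF P])
  have dP': "?dP' > 0" by (rule det_pd_pos[OF mat_delete_pd[OF P a0]])
  have qdet: "?q = ?dP' / ?dP" by (rule inv_mat_diag[OF P a0])
  \<comment> \<open>The conditional mean of the coordinate given the others, so that the square in
    the exponent is centered there.\<close>
  define \<mu>' where "\<mu>' = \<mu> - (\<Sum>i<n. ?Q $$ (a0, insert_index a0 i) * e' $ i) / ?q"
  have vec: "Matrix.vec n (\<lambda>a. e t $ insert_index a0 a) = e'" for t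
    using e' e_other by (intro eq_vecI) auto
  have \<tau>: "(\<Sum>b<?N. ?Q $$ (a0, b) * e t $ b) / ?q = t - \<mu>'" for t
    using q by (simp add: sum_insert_index[OF a0] e_a0 e_other \<mu>'_def field_simps del: sum.lessThan_Suc)
  have quad: "scalar_prod (e t) (?Q *\<^sub>v e t) =
      scalar_prod e' (inv_mat ?P' *\<^sub>v e') + ?q * (t - \<mu>')\<^sup>2" for t
    using quadratic_form_complete_square[OF P a0 e[of t]] unfolding vec \<tau> .
  define c where "c = C * w powr (real ?N / 2) / sqrt ?dP * exp (- (scalar_prod e' (inv_mat ?P' *\<^sub>v e') * w / 2))"
  have c0: "c \<ge> 0" using dP C by (simp add: c_def)
  have "C * gauss_factor w P (e t) = c * exp (- (?q * w / 2 * (t - \<mu>')\<^sup>2))" for t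
  proof -
    have "exp (- (scalar_prod (e t) (?Q *\<^sub>v e t) * w / 2)) =
        exp (- (scalar_prod e' (inv_mat ?P' *\<^sub>v e') * w / 2)) * exp (- (?q * w / 2 * (t - \<mu>')\<^sup>2))"
      unfolding quad exp_add[symmetric] by (simp add: field_simps)
    moreover have "dim_vec (e t) = ?N" using e[of t] by simp
    ultimately show ?thesis unfolding gauss_factor_def c_def by simp
  qed
  then have "(\<integral>\<^sup>+t. ennreal (C * gauss_factor w P (e t)) \<partial>lborel) =
      (\<integral>\<^sup>+t. ennreal c * ennreal (exp (- (?q * w / 2 * (t - \<mu>')\<^sup>2))) \<partial>lborel)"
    using c0 by (simp add: ennreal_mult)
  also have "\<dots> = ennreal c * ennreal (sqrt (2 * pi / (?q * w)))"
    using q w nn_integral_gaussian_shift[of "?q * w" \<mu>'] by (subst nn_integral_cmult) auto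
  also have "\<dots> = ennreal (c * sqrt (2 * pi / (?q * w)))"
    using c0 by (simp add: ennreal_mult')
  \<comment> \<open>Since \<open>?q = ?dP' / ?dP\<close>, the factor \<open>sqrt ?dP\<close> turns
    into \<open>sqrt ?dP'\<close>, and the width of the Gaussian cancels one \<open>sqrt w\<close>,
    lowering the power of w from (n + 1) / 2 to n / 2.\<close>
  also have "c * sqrt (2 * pi / (?q * w)) = sqrt (2 * pi) * (C * gauss_factor w ?P' e')"
  proof -
    have "w powr (real ?N / 2) = w powr (real n / 2) * sqrt w"
      using w by (simp add: powr_add[symmetric] powr_half_sqrt[symmetric] add_divide_distrib add.commute)
    moreover have "dim_vec e' = n" using e' by simp
    ultimately show ?thesis
      unfolding gauss_factor_def c_def qdet using dP dP' w
      by (simp add: real_sqrt_divide real_sqrt_mult field_simps)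
  qed
  finally show ?thesis .
qed

section \<open>Selection matrices as re-indexings\<close>

lemma sel_mat_carrier: "sel_mat d k i \<in> carrier_mat (card (observed_cols k i)) d"
  by (simp add: sel_mat_def)

lemma
  assumes "k \<subseteq> {..<n} \<times> {..<d}"
  shows finite_observed_cols: "finite (observed_cols k i)"
    and observed_cols_subset: "observed_cols k i \<subseteq> {..<d}"
proof -
  show "observed_cols k i \<subseteq> {..<d}" using assms by (auto simp: observed_cols_def)
  then show "finite (observed_cols k i)" by (rule finite_subset) simp
qed

text \<open>Names the column picked by row l of the selection matrix, so that products with
  \<open>sel_mat\<close> become index substitutions.\<close>

definition obs_col :: "(nat \<times> nat) set \<Rightarrow> nat \<Rightarrow> nat \<Rightarrow> nat" where
  "obs_col k i l = sorted_list_of_set (observed_cols k i) ! l"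

lemma obs_col_less:
  assumes k: "k \<subseteq> {..<n} \<times> {..<d}" and l: "l < card (observed_cols k i)"
  shows "obs_col k i l < d"
proof -
  have "obs_col k i l \<in> set (sorted_list_of_set (observed_cols k i))"
    unfolding obs_col_def using l by (intro nth_mem) simp
  then have "obs_col k i l \<in> observed_cols k i" using finite_observed_cols[OF k] by simp
  then show ?thesis using observed_cols_subset[OF k] by blast
qed

lemma obs_col_inj:
  assumes "l < card (observed_cols k i)" "l' < card (observed_cols k i)"
  shows "obs_col k i l = obs_col k i l' \<longleftrightarrow> l = l'"
  unfolding obs_col_def using assms by (intro nth_eq_iff_index_eq) auto

lemma sel_mat_index:
  assumes "l < card (observed_cols k i)" "j < d"
  shows "sel_mat d k i $$ (l, j) = (if j = obs_col k i l then 1 else 0)"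
  using assms by (simp add: sel_mat_def obs_col_def)

lemma sel_mat_mult_vec:
  assumes k: "k \<subseteq> {..<n} \<times> {..<d}" and v: "v \<in> carrier_vec d"
  shows "sel_mat d k i *\<^sub>v v = Matrix.vec (card (observed_cols k i)) (\<lambda>l. v $ obs_col k i l)"
proof (rule eq_vecI)
  fix l assume "l < dim_vec (Matrix.vec (card (observed_cols k i)) (\<lambda>l. v $ obs_col k i l))"
  then have l: "l < card (observed_cols k i)" by simp
  have "(sel_mat d k i *\<^sub>v v) $ l = (\<Sum>j<d. sel_mat d k i $$ (l, j) * v $ j)"
    using l v sel_mat_carrier[of d k i] by (simp add: scalar_prod_def lessThan_atLeast0)
  also have "\<dots> = (\<Sum>j<d. if j = obs_col k i l then v $ j else 0)"
    using l by (intro sum.cong) (auto simp: sel_mat_index)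
  also have "\<dots> = v $ obs_col k i l" using obs_col_less[OF k l] by simp
  finally show "(sel_mat d k i *\<^sub>v v) $ l = Matrix.vec (card (observed_cols k i)) (\<lambda>l. v $ obs_col k i l) $ l"
    using l by simp
qed (use sel_mat_carrier[of d k i] in simp)

lemma sel_mat_submatrix:
  assumes k: "k \<subseteq> {..<n} \<times> {..<d}" and s: "\<sigma> \<in> carrier_mat d d"
  shows "sel_mat d k i * \<sigma> * (sel_mat d k i)\<^sup>T =
    Matrix.mat (card (observed_cols k i)) (card (observed_cols k i)) (\<lambda>(a, b). \<sigma> $$ (obs_col k i a, obs_col k i b))"
    (is "?L = ?R")
proof (rule eq_matI)
  let ?c = "card (observed_cols k i)"
  note S = sel_mat_carrier[of d k i]
  fix a b assume "a < dim_row ?R" "b < dim_col ?R"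
  then have a: "a < ?c" and b: "b < ?c" by auto
  have c: "(sel_mat d k i * \<sigma>) $$ (a, j) = \<sigma> $$ (obs_col k i a, j)" if j: "j < d" for j
  proof -
    have "(sel_mat d k i * \<sigma>) $$ (a, j) = (\<Sum>j'<d. sel_mat d k i $$ (a, j') * \<sigma> $$ (j', j))"
      using a j s S by (simp add: scalar_prod_def lessThan_atLeast0)
    also have "\<dots> = (\<Sum>j'<d. if j' = obs_col k i a then \<sigma> $$ (j', j) else 0)"
      using a by (intro sum.cong) (auto simp: sel_mat_index)
    finally show ?thesis using obs_col_less[OF k a] by simp
  qed
  have "?L $$ (a, b) = (\<Sum>j<d. (sel_mat d k i * \<sigma>) $$ (a, j) * sel_mat d k i $$ (b, j))"
    using a b s S by (simp add: scalar_prod_def lessThan_atLeast0 del: assoc_mult_mat)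
  also have "\<dots> = (\<Sum>j<d. if j = obs_col k i b then \<sigma> $$ (obs_col k i a, j) else 0)"
    using b c by (intro sum.cong) (auto simp: sel_mat_index)
  finally show "?L $$ (a, b) = ?R $$ (a, b)" using obs_col_less[OF k b] a b by simp
qed (use sel_mat_carrier[of d k i] in auto)

text \<open>The transposed selection matrix places the entries of v at distinct columns, so a
  nonzero v yields a nonzero u, and the quadratic form moves from the submatrix at v to \<sigma> at
  u.\<close>

lemma sel_mat_submatrix_pd:
  assumes k: "k \<subseteq> {..<n} \<times> {..<d}" and s: "\<sigma> \<in> pd_mats d"
  shows "sel_mat d k i * \<sigma> * (sel_mat d k i)\<^sup>T \<in> pd_mats (card (observed_cols k i))"
proof -
  let ?c = "card (observed_cols k i)" and ?S = "sel_mat d k i"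
  let ?P = "?S * \<sigma> * ?S\<^sup>T"
  note S = sel_mat_carrier[of d k i] and C = pd_mats_carrier[OF s]
  have P: "?P \<in> carrier_mat ?c ?c" using S C by auto
  have T: "?P\<^sup>T = ?P"
    unfolding sel_mat_submatrix[OF k C]
    by (rule eq_matI) (auto simp: pd_mats_sym[OF s] obs_col_less[OF k])
  have pos: "0 < scalar_prod v (?P *\<^sub>v v)" if v: "v \<in> carrier_vec ?c" "v \<noteq> 0\<^sub>v ?c" for v
  proof -
    define u where "u = ?S\<^sup>T *\<^sub>v v"
    have u: "u \<in> carrier_vec d" using S v by (auto simp: u_def)
    have "u $ obs_col k i l = v $ l" if l: "l < ?c" for l
    proof -
      have "u $ obs_col k i l = (\<Sum>a<?c. ?S $$ (a, obs_col k i l) * v $ a)"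
        using l v S obs_col_less[OF k l] by (simp add: u_def scalar_prod_def lessThan_atLeast0)
      also have "\<dots> = (\<Sum>a<?c. if a = l then v $ a else 0)"
        using l obs_col_less[OF k l] by (intro sum.cong) (auto simp: sel_mat_index obs_col_inj)
      finally show ?thesis using l by simp
    qed
    moreover obtain l where "l < ?c" "v $ l \<noteq> 0"
      using v by (metis carrier_vecD eq_vecI index_zero_vec)
    ultimately have "u \<noteq> 0\<^sub>v d" using obs_col_less[OF k] by (metis index_zero_vec(1))
    then have "0 < scalar_prod u (\<sigma> *\<^sub>v u)" using s u by (simp add: pd_mats_def)
    also have "\<dots> = scalar_prod v (?S *\<^sub>v (\<sigma> *\<^sub>v u))"
      unfolding u_def using S C v by (intro transpose_vec_mult_scalar) auto
    also have "?S *\<^sub>v (\<sigma> *\<^sub>v u) = ?P *\<^sub>v v"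
    proof -
      have "?P *\<^sub>v v = (?S * \<sigma>) *\<^sub>v u"
        unfolding u_def using S C v by (intro assoc_mult_mat_vec) auto
      then show ?thesis using S C u by (simp add: assoc_mult_mat_vec)
    qed
    finally show ?thesis .
  qed
  show ?thesis using P T pos by (simp add: pd_mats_def)
qed

lemma observed_cols_remove:
  "observed_cols (k - {(i, j)}) i = observed_cols k i - {j}"
  "i' \<noteq> i \<Longrightarrow> observed_cols (k - {(i, j)}) i' = observed_cols k i'"
  by (auto simp: observed_cols_def)

text \<open>Unobserving the column in position \<open>a0\<close> shifts the later ones down by one,
  which is the effect of \<open>insert_index a0\<close>. This matches removal of an entry with
  \<open>mat_delete\<close> on the covariance.\<close>

lemma obs_col_remove:
  assumes k: "k \<subseteq> {..<n} \<times> {..<d}" and a0: "a0 < card (observed_cols k i)"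
    and l: "l < card (observed_cols k i) - 1"
  shows "obs_col (k - {(i, obs_col k i a0)}) i l = obs_col k i (insert_index a0 l)"
proof -
  let ?xs = "sorted_list_of_set (observed_cols k i)"
  note F = finite_observed_cols[OF k, of i]
  have len: "length ?xs = card (observed_cols k i)" by simp
  have split: "?xs = take a0 ?xs @ obs_col k i a0 # drop (Suc a0) ?xs"
    unfolding obs_col_def using a0 by (simp add: id_take_nth_drop)
  \<comment> \<open>Distinctness keeps this column out of the initial segment, so
    \<open>remove1\<close> deletes exactly the occurrence at position \<open>a0\<close>.\<close>
  have "obs_col k i a0 \<notin> set (take a0 ?xs)"
    using split distinct_sorted_list_of_set[of "observed_cols k i"]
    by (metis distinct_append distinct.simps(2) disjoint_iff list.set_intros(1))
  then have "remove1 (obs_col k i a0) ?xs = take a0 ?xs @ drop (Suc a0) ?xs"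
    by (subst split) (simp add: remove1_append)
  then have "sorted_list_of_set (observed_cols k i - {obs_col k i a0}) = take a0 ?xs @ drop (Suc a0) ?xs"
    using F by (simp add: sorted_list_of_set_remove)
  then show ?thesis
    using a0 l by (auto simp: obs_col_def[of "k - _"] observed_cols_remove nth_append insert_index_def)
      (auto simp: obs_col_def)
qed

section \<open>Measurability of matrix functions\<close>

text \<open>Injectivity is asked only on the space: building a matrix ignores function values
  outside the index set, so it is injective only on extensional functions. The images of a countable
  finite-measure cover form such a cover.\<close>

lemma sigma_finite_embed_measure_inj_on:
  assumes "sigma_finite_measure M" and inj: "inj_on f (space M)"
  shows "sigma_finite_measure (embed_measure M f)"
proof -
  interpret sigma_finite_measure M by fact
  obtain A where A: "countable A" "A \<subseteq> sets M" "\<Union>A = space M" "\<forall>a\<in>A. emeasure M a \<noteq> \<infinity>"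
    using sigma_finite_countable by blast
  have vi: "f -` f ` a \<inter> space M = a" if "a \<in> A" for a
    using that A(2) inj by (auto dest: inj_onD sets.sets_into_space)
  show ?thesis
  proof
    show "\<exists>B. countable B \<and> B \<subseteq> sets (embed_measure M f) \<and> \<Union>B = space (embed_measure M f) \<and>
        (\<forall>b\<in>B. emeasure (embed_measure M f) b \<noteq> \<infinity>)"
    proof (intro exI[of _ "(\<lambda>a. f ` a) ` A"] conjI ballI)
      show "\<Union> ((\<lambda>a. f ` a) ` A) = space (embed_measure M f)"
        by (simp add: space_embed_measure A(3)[symmetric] image_Union)
      fix b assume "b \<in> (\<lambda>a. f ` a) ` A"
      then obtain a where a: "a \<in> A" "b = f ` a" by blast
      then have "b \<in> sets (embed_measure M f)" using A(2) by (auto intro: in_sets_embed_measure)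
      then have "emeasure (embed_measure M f) b = emeasure M a"
        using emeasure_embed_measure'[OF inj] vi[OF a(1)] a(2) by simp
      then show "emeasure (embed_measure M f) b \<noteq> \<infinity>" using A(4) a(1) by auto
    qed (use A(1,2) in \<open>auto intro: in_sets_embed_measure\<close>)
  qed
qed

lemma sigma_finite_PiM_lborel:
  "finite I \<Longrightarrow> sigma_finite_measure (Pi\<^sub>M I (\<lambda>_. lborel :: real measure))"
  by (rule product_sigma_finite.sigma_finite)
     (auto intro: product_sigma_finite.intro lborel.sigma_finite_measure_axioms)

text \<open>Points of a product space are extensional, so reading off their coordinates in I
  determines them.\<close>

lemma inj_on_PiM_if_recover:
  assumes "\<And>f i. f \<in> space (Pi\<^sub>M I N) \<Longrightarrow> i \<in> I \<Longrightarrow> r i (F f) = f i"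
  shows "inj_on F (space (Pi\<^sub>M I N))"
proof (rule inj_onI)
  fix f g assume fg: "f \<in> space (Pi\<^sub>M I N)" "g \<in> space (Pi\<^sub>M I N)" "F f = F g"
  show "f = g"
  proof (rule extensionalityI[of _ I])
    show "f \<in> extensional I" "g \<in> extensional I" using fg by (auto simp: space_PiM PiE_def)
    show "f i = g i" if "i \<in> I" for i
      using assms[OF fg(1) that] assms[OF fg(2) that] fg(3) by simp
  qed
qed

lemma sigma_finite_lborel_mat: "sigma_finite_measure (lborel_mat p d)"
  unfolding lborel_mat_def
  by (intro sigma_finite_embed_measure_inj_on sigma_finite_PiM_lborel
      inj_on_PiM_if_recover[where r="\<lambda>i A. A $$ i"]) auto

lemma space_lborel_mat: "A \<in> space (lborel_mat p d) \<Longrightarrow> A \<in> carrier_mat p d"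
  by (auto simp: lborel_mat_def space_embed_measure)

lemma space_lborel_mat_nonempty: "space (lborel_mat p d) \<noteq> {}"
  by (simp add: lborel_mat_def space_embed_measure space_PiM PiE_eq_empty_iff)

lemma lborel_mat_index:
  assumes "i < p" "j < d"
  shows "(\<lambda>A. A $$ (i, j)) \<in> borel_measurable (lborel_mat p d)"
  unfolding lborel_mat_def using assms
  by (intro measurable_embed_measure1) (simp, measurable)

abbreviation upper_tri :: "nat \<Rightarrow> (nat \<times> nat) set" where
  "upper_tri d \<equiv> {(i, j). i \<le> j \<and> j < d}"

lemma finite_upper_tri: "finite (upper_tri d)"
  by (rule finite_subset[of _ "{..<d} \<times> {..<d}"]) auto

lemma sigma_finite_lborel_sym: "sigma_finite_measure (lborel_sym d)"
  unfolding lborel_sym_def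
  by (intro sigma_finite_embed_measure_inj_on sigma_finite_PiM_lborel finite_upper_tri
      inj_on_PiM_if_recover[where r="\<lambda>i A. A $$ i"]) (auto simp: min_def max_def)

text \<open>For the inclusion from the right, the entries on and above the diagonal form the
  coordinate function, and symmetry restores the rest.\<close>

lemma space_lborel_sym:
  "space (lborel_sym d) = {A \<in> carrier_mat d d. A\<^sup>T = A}"
proof (intro equalityI subsetI)
  fix A assume "A \<in> space (lborel_sym d)"
  then obtain f where A: "A = Matrix.mat d d (\<lambda>(i, j). f (min i j, max i j))"
    by (auto simp: lborel_sym_def space_embed_measure)
  have "A\<^sup>T = A" unfolding A by (rule eq_matI) (auto simp: min.commute max.commute)
  then show "A \<in> {A \<in> carrier_mat d d. A\<^sup>T = A}" by (simp add: A)
next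
  fix A :: "real mat" assume "A \<in> {A \<in> carrier_mat d d. A\<^sup>T = A}"
  then have A: "A \<in> carrier_mat d d" "A\<^sup>T = A" by auto
  have sym: "A $$ (i, j) = A $$ (j, i)" if "i < d" "j < d" for i j
    using A that by (metis carrier_matD index_transpose_mat(1))
  define f where "f = restrict (\<lambda>ij. A $$ ij) (upper_tri d)"
  have "f \<in> space (Pi\<^sub>M (upper_tri d) (\<lambda>_. lborel))"
    by (simp add: f_def space_PiM)
  moreover have "A = Matrix.mat d d (\<lambda>(i, j). f (min i j, max i j))"
    using A sym by (intro eq_matI) (auto simp: f_def min_def max_def)
  ultimately show "A \<in> space (lborel_sym d)"
    unfolding lborel_sym_def space_embed_measure by blast
qed

lemma lborel_sym_index:
  assumes "i < d" "j < d"
  shows "(\<lambda>A. A $$ (i, j)) \<in> borel_measurable (lborel_sym d)"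
proof -
  have "(min i j, max i j) \<in> upper_tri d" using assms by auto
  then have "(\<lambda>f. f (min i j, max i j)) \<in> borel_measurable (Pi\<^sub>M (upper_tri d) (\<lambda>_. lborel :: real measure))"
    by (rule measurable_component_singleton[THEN measurable_compose]) simp
  then show ?thesis
    unfolding lborel_sym_def using assms by (intro measurable_embed_measure1) simp
qed

text \<open>Measurability by entries is what the formulas for products, determinants and inverses
  consume, and it is independent of a choice of sigma-algebra on matrices.\<close>

definition mat_measurable :: "'a measure \<Rightarrow> nat \<Rightarrow> nat \<Rightarrow> ('a \<Rightarrow> real mat) \<Rightarrow> bool" where
  "mat_measurable M r c F \<longleftrightarrow> (\<forall>x\<in>space M. F x \<in> carrier_mat r c) \<and>
     (\<forall>i<r. \<forall>j<c. (\<lambda>x. F x $$ (i, j)) \<in> borel_measurable M)"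

definition vec_measurable :: "'a measure \<Rightarrow> nat \<Rightarrow> ('a \<Rightarrow> real vec) \<Rightarrow> bool" where
  "vec_measurable M r F \<longleftrightarrow> (\<forall>x\<in>space M. F x \<in> carrier_vec r) \<and>
     (\<forall>i<r. (\<lambda>x. Matrix.vec_index (F x) i) \<in> borel_measurable M)"

section \<open>Closure of entrywise measurability under matrix operations\<close>

lemma mat_measurable_const: "A \<in> carrier_mat r c \<Longrightarrow> mat_measurable M r c (\<lambda>_. A)"
  by (simp add: mat_measurable_def)

lemma vec_measurable_const: "v \<in> carrier_vec r \<Longrightarrow> vec_measurable M r (\<lambda>_. v)"
  by (simp add: vec_measurable_def)

lemma mat_measurable_mult:
  assumes "mat_measurable M r s F" "mat_measurable M s c G"
  shows "mat_measurable M r c (\<lambda>x. F x * G x)"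
  unfolding mat_measurable_def
proof (intro conjI ballI allI impI)
  fix i j assume ij: "i < r" "j < c"
  have "(\<lambda>x. \<Sum>l<s. F x $$ (i, l) * G x $$ (l, j)) \<in> borel_measurable M"
    using assms ij by (intro borel_measurable_sum borel_measurable_times) (auto simp: mat_measurable_def)
  moreover have "(F x * G x) $$ (i, j) = (\<Sum>l<s. F x $$ (i, l) * G x $$ (l, j))" if "x \<in> space M" for x
  proof -
    have "F x \<in> carrier_mat r s" "G x \<in> carrier_mat s c" using assms that by (auto simp: mat_measurable_def)
    then show ?thesis using ij by (simp add: scalar_prod_def lessThan_atLeast0)
  qed
  ultimately show "(\<lambda>x. (F x * G x) $$ (i, j)) \<in> borel_measurable M"
    by (subst measurable_cong) auto
qed (use assms in \<open>auto simp: mat_measurable_def\<close>)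

lemma mat_measurable_transpose:
  assumes "mat_measurable M r c F"
  shows "mat_measurable M c r (\<lambda>x. (F x)\<^sup>T)"
  unfolding mat_measurable_def
proof (intro conjI ballI allI impI)
  fix i j assume ij: "i < c" "j < r"
  have "(F x)\<^sup>T $$ (i, j) = F x $$ (j, i)" if "x \<in> space M" for x
    using assms that ij by (auto simp: mat_measurable_def)
  then show "(\<lambda>x. (F x)\<^sup>T $$ (i, j)) \<in> borel_measurable M"
    using assms ij by (subst measurable_cong) (auto simp: mat_measurable_def)
qed (use assms in \<open>auto simp: mat_measurable_def\<close>)

text \<open>By the Leibniz formula the determinant is a polynomial in the entries.\<close>

lemma det_measurable:
  assumes "mat_measurable M r r F"
  shows "(\<lambda>x. Determinant.det (F x)) \<in> borel_measurable M"
proof -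
  have "(\<lambda>x. \<Sum>p\<in>{p. p permutes {0..<r}}. signof p * (\<Prod>i = 0..<r. F x $$ (i, p i))) \<in> borel_measurable M"
  proof (intro borel_measurable_sum borel_measurable_times borel_measurable_const borel_measurable_prod)
    fix p i assume "p \<in> {p. p permutes {0..<r}}" "i \<in> {0..<r}"
    then have "i < r" "p i < r" using permutes_in_image[of p "{0..<r}" i] by auto
    then show "(\<lambda>x. F x $$ (i, p i)) \<in> borel_measurable M" using assms by (simp add: mat_measurable_def)
  qed
  then show ?thesis
    using assms by (subst measurable_cong) (auto simp: mat_measurable_def det_def')
qed

lemma mat_measurable_delete:
  assumes "mat_measurable M (Suc r) (Suc c) F" "i < Suc r" "j < Suc c"
  shows "mat_measurable M r c (\<lambda>x. mat_delete (F x) i j)"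
  unfolding mat_measurable_def
proof (intro conjI ballI allI impI)
  show "mat_delete (F x) i j \<in> carrier_mat r c" if "x \<in> space M" for x
    using assms that mat_delete_carrier[of "F x" "Suc r" "Suc c" i j] by (auto simp: mat_measurable_def)
  fix i' j' assume ij: "i' < r" "j' < c"
  let ?i = "if i' < i then i' else Suc i'" and ?j = "if j' < j then j' else Suc j'"
  have "mat_delete (F x) i j $$ (i', j') = F x $$ (?i, ?j)" if "x \<in> space M" for x
    using assms that ij by (auto simp: mat_measurable_def mat_delete_def)
  moreover have "?i < Suc r" "?j < Suc c" using ij by auto
  ultimately show "(\<lambda>x. mat_delete (F x) i j $$ (i', j')) \<in> borel_measurable M"
    using assms by (subst measurable_cong) (auto simp: mat_measurable_def)
qed

text \<open>By Cramer's rule each entry is a signed minor divided by the determinant.\<close>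

lemma mat_measurable_inv:
  assumes F: "mat_measurable M r r F" and det: "\<And>x. x \<in> space M \<Longrightarrow> Determinant.det (F x) \<noteq> 0"
  shows "mat_measurable M r r (\<lambda>x. inv_mat (F x))"
  unfolding mat_measurable_def
proof (intro conjI ballI allI impI)
  show "inv_mat (F x) \<in> carrier_mat r r" if "x \<in> space M" for x
    using F det that by (intro inv_mat_carrier) (auto simp: mat_measurable_def)
  fix i j assume ij: "i < r" "j < r"
  then obtain s where s: "r = Suc s" by (cases r) auto
  have "(\<lambda>x. (-1) ^ (j + i) * Determinant.det (mat_delete (F x) j i) / Determinant.det (F x)) \<in> borel_measurable M"
    using F ij unfolding s
    by (intro borel_measurable_divide borel_measurable_times borel_measurable_const det_measurable[of M s]
        det_measurable[of M "Suc s"] mat_measurable_delete)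
  moreover have "inv_mat (F x) $$ (i, j) = (-1) ^ (j + i) * Determinant.det (mat_delete (F x) j i) / Determinant.det (F x)"
    if "x \<in> space M" for x
    using F det that ij by (subst inv_mat_index[of _ r]) (auto simp: mat_measurable_def cofactor_def)
  ultimately show "(\<lambda>x. inv_mat (F x) $$ (i, j)) \<in> borel_measurable M"
    by (subst measurable_cong) auto
qed

lemma vec_measurable_mult_mat_vec:
  assumes "mat_measurable M r s F" "vec_measurable M s v"
  shows "vec_measurable M r (\<lambda>x. F x *\<^sub>v v x)"
  unfolding vec_measurable_def
proof (intro conjI ballI allI impI)
  show "F x *\<^sub>v v x \<in> carrier_vec r" if "x \<in> space M" for x
    using assms that by (auto simp: mat_measurable_def vec_measurable_def)
  fix i assume i: "i < r"
  have "(\<lambda>x. \<Sum>l<s. F x $$ (i, l) * Matrix.vec_index (v x) l) \<in> borel_measurable M"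
    using assms i by (intro borel_measurable_sum borel_measurable_times)
      (auto simp: mat_measurable_def vec_measurable_def)
  moreover have "Matrix.vec_index (F x *\<^sub>v v x) i = (\<Sum>l<s. F x $$ (i, l) * Matrix.vec_index (v x) l)"
    if "x \<in> space M" for x
  proof -
    have "F x \<in> carrier_mat r s" "v x \<in> carrier_vec s"
      using assms that by (auto simp: mat_measurable_def vec_measurable_def)
    then show ?thesis using i by (simp add: scalar_prod_def lessThan_atLeast0)
  qed
  ultimately show "(\<lambda>x. Matrix.vec_index (F x *\<^sub>v v x) i) \<in> borel_measurable M"
    by (subst measurable_cong) auto
qed

lemma vec_measurable_minus:
  assumes "vec_measurable M r v" "vec_measurable M r w"
  shows "vec_measurable M r (\<lambda>x. v x - w x)"
  unfolding vec_measurable_def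
proof (intro conjI ballI allI impI)
  show "v x - w x \<in> carrier_vec r" if "x \<in> space M" for x
    using assms that by (auto simp: vec_measurable_def)
  fix i assume i: "i < r"
  have "(\<lambda>x. Matrix.vec_index (v x) i - Matrix.vec_index (w x) i) \<in> borel_measurable M"
    using assms i by (intro borel_measurable_diff) (auto simp: vec_measurable_def)
  moreover have "Matrix.vec_index (v x - w x) i = Matrix.vec_index (v x) i - Matrix.vec_index (w x) i"
    if "x \<in> space M" for x
    using assms that i by (auto simp: vec_measurable_def)
  ultimately show "(\<lambda>x. Matrix.vec_index (v x - w x) i) \<in> borel_measurable M"
    by (subst measurable_cong) auto
qed

lemma scalar_prod_measurable:
  assumes "vec_measurable M r v" "vec_measurable M r w"
  shows "(\<lambda>x. scalar_prod (v x) (w x)) \<in> borel_measurable M"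
proof -
  have "(\<lambda>x. \<Sum>l<r. Matrix.vec_index (v x) l * Matrix.vec_index (w x) l) \<in> borel_measurable M"
    using assms by (intro borel_measurable_sum borel_measurable_times) (auto simp: vec_measurable_def)
  moreover have "scalar_prod (v x) (w x) = (\<Sum>l<r. Matrix.vec_index (v x) l * Matrix.vec_index (w x) l)"
    if "x \<in> space M" for x
  proof -
    have "w x \<in> carrier_vec r" using assms that by (auto simp: vec_measurable_def)
    then show ?thesis by (simp add: scalar_prod_def lessThan_atLeast0)
  qed
  ultimately show ?thesis by (subst measurable_cong) auto
qed

section \<open>Positive definiteness as a measurable condition\<close>

definition bilin :: "nat \<Rightarrow> real mat \<Rightarrow> (nat \<Rightarrow> real) \<Rightarrow> (nat \<Rightarrow> real) \<Rightarrow> real" where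
  "bilin d A v w = (\<Sum>a<d. \<Sum>b<d. v a * A $$ (a, b) * w b)"

lemma bilin_vec:
  assumes "A \<in> carrier_mat d d" "v \<in> carrier_vec d" "w \<in> carrier_vec d"
  shows "scalar_prod v (A *\<^sub>v w) = bilin d A (Matrix.vec_index v) (Matrix.vec_index w)"
  unfolding bilin_def by (rule quadratic_form_sum[OF assms])

lemma bilin_add_scaled:
  assumes "\<And>a b. a < d \<Longrightarrow> b < d \<Longrightarrow> A $$ (a, b) = A $$ (b, a)"
  shows "bilin d A (\<lambda>a. v a + t * w a) (\<lambda>a. v a + t * w a) =
    bilin d A v v + 2 * t * bilin d A w v + t\<^sup>2 * bilin d A w w"
proof -
  have sw: "bilin d A v w = bilin d A w v"
    unfolding bilin_def using assms by (subst sum.swap) (auto intro!: sum.cong simp: mult_ac)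
  have "bilin d A (\<lambda>a. v a + t * w a) (\<lambda>a. v a + t * w a) =
      (\<Sum>a<d. \<Sum>b<d. v a * A $$ (a, b) * v b + t * (v a * A $$ (a, b) * w b) +
        t * (w a * A $$ (a, b) * v b) + t\<^sup>2 * (w a * A $$ (a, b) * w b))"
    unfolding bilin_def by (intro sum.cong) (auto simp: algebra_simps power2_eq_square)
  also have "\<dots> = bilin d A v v + t * bilin d A v w + t * bilin d A w v + t\<^sup>2 * bilin d A w w"
    unfolding bilin_def by (simp add: sum.distrib sum_distrib_left)
  finally show ?thesis by (simp add: sw)
qed

lemma scalar_prod_self_pos:
  fixes v :: "real vec"
  assumes v: "v \<in> carrier_vec d" "v \<noteq> 0\<^sub>v d"
  shows "0 < scalar_prod v v"
proof -
  obtain i where i: "i < d" "Matrix.vec_index v i \<noteq> 0"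
    using v by (metis carrier_vecD eq_vecI index_zero_vec)
  have "0 < Matrix.vec_index v i * Matrix.vec_index v i" using i by (metis not_real_square_gt_zero)
  then have "0 < (\<Sum>l<d. Matrix.vec_index v l * Matrix.vec_index v l)"
    using i by (intro sum_pos2[where i=i]) auto
  then show ?thesis using v by (simp add: scalar_prod_def lessThan_atLeast0)
qed

text \<open>If the form vanished at v <> 0, then w = A v would be nonzero, and moving from v against
  w changes the form to first order by a multiple of |w|^2, making it negative.\<close>

lemma psd_nonsingular_imp_pd:
  assumes A: "A \<in> carrier_mat d d" "A\<^sup>T = A"
    and psd: "\<And>v. 0 \<le> bilin d A v v" and det: "Determinant.det A \<noteq> 0"
  shows "A \<in> pd_mats d"
proof -
  have sym: "A $$ (i, j) = A $$ (j, i)" if "i < d" "j < d" for i j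
    using A that by (metis carrier_matD index_transpose_mat(1))
  have "0 < scalar_prod v (A *\<^sub>v v)" if v: "v \<in> carrier_vec d" "v \<noteq> 0\<^sub>v d" for v
  proof (rule ccontr)
    assume "\<not> 0 < scalar_prod v (A *\<^sub>v v)"
    then have v0: "bilin d A (Matrix.vec_index v) (Matrix.vec_index v) = 0"
      using psd[of "Matrix.vec_index v"] bilin_vec[OF A(1) v(1) v(1)] by simp
    define w where "w = A *\<^sub>v v"
    have w: "w \<in> carrier_vec d" using A v by (simp add: w_def)
    have "w \<noteq> 0\<^sub>v d"
      using det v det_0_iff_vec_prod_zero_field[OF A(1)] by (auto simp: w_def)
    define c where "c = bilin d A (Matrix.vec_index w) (Matrix.vec_index v)"
    define q where "q = bilin d A (Matrix.vec_index w) (Matrix.vec_index w)"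
    have "c = scalar_prod w w" unfolding c_def bilin_vec[OF A(1) w v(1), symmetric] by (simp add: w_def)
    also have "\<dots> > 0" by (rule scalar_prod_self_pos[OF w \<open>w \<noteq> 0\<^sub>v d\<close>])
    finally have c: "c > 0" .
    have q: "q \<ge> 0" unfolding q_def by (rule psd)
    \<comment> \<open>Using q + 1 avoids dividing by q = 0. For t = - c / s the form is c^2 / s^2 *
      (q - 2 s), which is negative.\<close>
    define s where "s = q + 1"
    have s: "s > 0" using q by (simp add: s_def)
    define t where "t = - c / s"
    have "0 \<le> 2 * t * c + t\<^sup>2 * q"
      using psd[of "\<lambda>a. Matrix.vec_index v a + t * Matrix.vec_index w a"]
        bilin_add_scaled[of d A "Matrix.vec_index v" t "Matrix.vec_index w", OF sym] v0
      by (simp add: c_def q_def)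
    moreover have "2 * t * c + t\<^sup>2 * q = c\<^sup>2 / s\<^sup>2 * (q - 2 * s)"
      using s by (simp add: t_def power2_eq_square field_simps)
    moreover have "c\<^sup>2 / s\<^sup>2 * (q - 2 * s) < 0"
      using c q s by (intro mult_pos_neg) (auto simp: s_def)
    ultimately show False by simp
  qed
  then show ?thesis using A by (simp add: pd_mats_def)
qed

text \<open>The form is continuous in the coordinates and each coordinate is a limit of
  rationals.\<close>

lemma bilin_nonneg_of_rational:
  assumes rat: "\<And>q. length q = d \<Longrightarrow> 0 \<le> bilin d A (\<lambda>a. real_of_rat (q ! a)) (\<lambda>a. real_of_rat (q ! a))"
  shows "0 \<le> bilin d A v v"
proof -
  have "\<exists>q. \<forall>n. \<bar>real_of_rat (q n) - v a\<bar> < 1 / real (Suc n)" for a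
  proof -
    have "\<exists>q. \<bar>real_of_rat q - v a\<bar> < 1 / real (Suc n)" for n
    proof -
      have "v a - 1 / real (Suc n) < v a + 1 / real (Suc n)"
      proof -
        have "0 < 1 / real (Suc n)" by simp
        then show ?thesis by linarith
      qed
      from of_rat_dense[OF this] show ?thesis by (auto simp: abs_less_iff) (smt (verit))
    qed
    then show ?thesis by metis
  qed
  then obtain q where q: "\<And>a n. \<bar>real_of_rat (q a n) - v a\<bar> < 1 / real (Suc n)" by metis
  have lim: "(\<lambda>n. real_of_rat (q a n)) \<longlonglongrightarrow> v a" for a
  proof (rule LIMSEQ_I)
    fix e :: real assume "0 < e"
    then obtain N where N: "1 / real (Suc N) < e" using nat_approx_posE by blast
    have "norm (real_of_rat (q a n) - v a) < e" if "n \<ge> N" for n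
    proof -
      have "1 / real (Suc n) \<le> 1 / real (Suc N)" using that by (intro divide_left_mono) auto
      then show ?thesis using q[of a n] N by (simp del: of_nat_Suc)
    qed
    then show "\<exists>N. \<forall>n\<ge>N. norm (real_of_rat (q a n) - v a) < e" by blast
  qed
  have "(\<lambda>n. bilin d A (\<lambda>a. real_of_rat (q a n)) (\<lambda>a. real_of_rat (q a n))) \<longlonglongrightarrow> bilin d A v v"
    unfolding bilin_def by (intro tendsto_intros lim)
  moreover have "0 \<le> bilin d A (\<lambda>a. real_of_rat (q a n)) (\<lambda>a. real_of_rat (q a n))" for n
  proof -
    \<comment> \<open>Only coordinates below d enter the form, so each approximant is represented by
      a list of length d, keeping the family of conditions countable.\<close>
    have "bilin d A (\<lambda>a. real_of_rat (q a n)) (\<lambda>a. real_of_rat (q a n)) =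
      bilin d A (\<lambda>a. real_of_rat (map (\<lambda>a. q a n) [0..<d] ! a)) (\<lambda>a. real_of_rat (map (\<lambda>a. q a n) [0..<d] ! a))"
      unfolding bilin_def by (intro sum.cong) auto
    then show ?thesis using rat[of "map (\<lambda>a. q a n) [0..<d]"] by simp
  qed
  ultimately show ?thesis using LIMSEQ_le_const by blast
qed

text \<open>Positive definiteness is a countable condition: a symmetric matrix is positive definite iff
  it is nonsingular and its quadratic form is nonnegative at all rational vectors.\<close>

lemma pd_mats_sets: "pd_mats d \<in> sets (lborel_sym d)"
proof -
  have "pd_mats d = {A \<in> space (lborel_sym d). Determinant.det A \<noteq> 0 \<and>
      (\<forall>q :: rat list. length q = d \<longrightarrow> 0 \<le> bilin d A (\<lambda>a. real_of_rat (q ! a)) (\<lambda>a. real_of_rat (q ! a)))}"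
    (is "_ = ?R")
  proof (intro equalityI subsetI)
    fix A assume A: "A \<in> pd_mats d"
    have "0 \<le> bilin d A v v" for v
    proof -
      let ?v = "Matrix.vec d v"
      have "bilin d A v v = bilin d A (Matrix.vec_index ?v) (Matrix.vec_index ?v)"
        unfolding bilin_def by (intro sum.cong) auto
      also have "\<dots> = scalar_prod ?v (A *\<^sub>v ?v)"
        by (rule bilin_vec[symmetric]) (use pd_mats_carrier[OF A] in auto)
      also have "\<dots> \<ge> 0"
      proof (cases "?v = 0\<^sub>v d")
        case True
        then show ?thesis using pd_mats_carrier[OF A] by (simp add: scalar_prod_def)
      next
        case False
        have "?v \<in> carrier_vec d" by simp
        with False A show ?thesis unfolding pd_mats_def by (blast intro: less_imp_le)
      qed
      finally show ?thesis .
    qed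
    then show "A \<in> ?R" using A det_pd_nonzero[OF A] by (auto simp: space_lborel_sym pd_mats_def)
  next
    fix A assume "A \<in> ?R"
    then have A: "A \<in> carrier_mat d d" "A\<^sup>T = A" "Determinant.det A \<noteq> 0"
      and rat: "\<And>q. length q = d \<Longrightarrow> 0 \<le> bilin d A (\<lambda>a. real_of_rat (q ! a)) (\<lambda>a. real_of_rat (q ! a))"
      by (simp_all add: space_lborel_sym)
    show "A \<in> pd_mats d"
      by (rule psd_nonsingular_imp_pd[OF A(1,2) bilin_nonneg_of_rational[OF rat] A(3)])
  qed
  moreover have "mat_measurable (lborel_sym d) d d (\<lambda>A. A)"
    by (auto simp: mat_measurable_def space_lborel_sym lborel_sym_index)
  then have [measurable]: "(\<lambda>A. Determinant.det A) \<in> borel_measurable (lborel_sym d)"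
    by (rule det_measurable)
  have [measurable]: "(\<lambda>A. bilin d A v v) \<in> borel_measurable (lborel_sym d)" for v
    unfolding bilin_def
    by (intro borel_measurable_sum borel_measurable_times borel_measurable_const lborel_sym_index) auto
  have "?R \<in> sets (lborel_sym d)" by measurable
  ultimately show ?thesis by simp
qed

lemma space_lborel_pd: "space (lborel_pd d) = pd_mats d"
  using sets.sets_into_space[OF pd_mats_sets] by (auto simp: lborel_pd_def space_restrict_space)

lemma sigma_finite_lborel_pd: "sigma_finite_measure (lborel_pd d)"
proof -
  interpret sigma_finite_measure "lborel_sym d" by (rule sigma_finite_lborel_sym)
  show ?thesis unfolding lborel_pd_def
    by (rule sigma_finite_measure_restrict_space[OF sigma_finite_measure_axioms pd_mats_sets])
qed

lemma lborel_pd_index: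
  "i < d \<Longrightarrow> j < d \<Longrightarrow> (\<lambda>A. A $$ (i, j)) \<in> borel_measurable (lborel_pd d)"
  unfolding lborel_pd_def by (intro measurable_restrict_space1 lborel_sym_index)

lemma one_mat_pd: "1\<^sub>m d \<in> pd_mats d"
  using scalar_prod_self_pos by (simp add: pd_mats_def)

section \<open>The robust regression model\<close>

text \<open>On a null base measure every density has total mass 0, so the fallback applies.\<close>

lemma normalize_measure_null:
  assumes "emeasure M (space M) = 0" and [measurable]: "f \<in> borel_measurable M"
  shows "normalize_measure (density M f) = return M (SOME v. v \<in> space M)"
proof (rule normalize_measure_degenerate)
  have "AE v in M. False" using assms(1) by (intro AE_I[of _ _ "space M"]) auto
  then have "(\<integral>\<^sup>+v. f v * indicator (space M) v \<partial>M) = (\<integral>\<^sup>+v. 0 \<partial>M)"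
    by (intro nn_integral_cong_AE) auto
  then show "\<not> (proper (density M f) \<and> emeasure (density M f) (space (density M f)) \<noteq> 0)"
    by (simp add: emeasure_density)
qed simp

lemma gauss_factor_pos:
  assumes "P \<in> pd_mats r" "w > 0"
  shows "0 < gauss_factor w P e"
  using det_pd_pos[OF assms(1)] assms(2) by (simp add: gauss_factor_def)

lemma fill_carrier: "y \<in> carrier_mat n d \<Longrightarrow> fill y s u \<in> carrier_mat n d"
  by (simp add: fill_def)

lemma fill_index:
  "y \<in> carrier_mat n d \<Longrightarrow> i < n \<Longrightarrow> j < d \<Longrightarrow> fill y s u $$ (i, j) = (if (i, j) \<in> s then u (i, j) else y $$ (i, j))"
  by (simp add: fill_def)

text \<open>Filling one more entry on top of the others matches the iterated integral that peels one
  coordinate off a product measure.\<close>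

lemma fill_insert:
  "ij \<notin> s \<Longrightarrow> fill y (insert ij s) (u(ij := t)) = fill (fill y s u) {ij} (\<lambda>_. t)"
  unfolding fill_def by (rule eq_matI) auto

lemma fill_empty: "fill y {} u = y"
  unfolding fill_def by (rule eq_matI) auto

lemma product_sigma_finite_lborel: "product_sigma_finite (\<lambda>_. lborel :: real measure)"
  by (auto intro: product_sigma_finite.intro lborel.sigma_finite_measure_axioms)

lemma space_lborel_entries_nonempty: "space (lborel_entries s) \<noteq> {}"
  by (simp add: lborel_entries_def space_PiM PiE_eq_empty_iff)

lemma lborel_entries_component:
  "ij \<in> s \<Longrightarrow> (\<lambda>u. u ij) \<in> borel_measurable (lborel_entries s)"
  unfolding lborel_entries_def
  by (rule measurable_component_singleton[THEN measurable_compose]) auto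

context robust_regression
begin

definition resid_vec :: "(nat \<times> nat) set \<Rightarrow> real mat \<Rightarrow> real mat \<times> real mat \<Rightarrow> nat \<Rightarrow> real vec" where
  "resid_vec k y \<theta> i = sel_mat d k i *\<^sub>v Matrix.row y i - sel_mat d k i *\<^sub>v ((fst \<theta>)\<^sup>T *\<^sub>v Matrix.row x i)"

definition obs_cov :: "(nat \<times> nat) set \<Rightarrow> real mat \<times> real mat \<Rightarrow> nat \<Rightarrow> real mat" where
  "obs_cov k \<theta> i = sel_mat d k i * snd \<theta> * (sel_mat d k i)\<^sup>T"

text \<open>The closed form of \<open>obs_density\<close> up to a power of
  \<open>sqrt (2 * pi)\<close>. Being real and explicit, it carries the induction over missing
  entries, the positivity and the measurability.\<close>

definition obs_factor ::
    "(nat \<times> nat) set \<Rightarrow> real mat \<Rightarrow> (nat \<Rightarrow> real) \<Rightarrow> real mat \<times> real mat \<Rightarrow> real" where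
  "obs_factor k y w \<theta> = prior_density \<theta> * (\<Prod>i<n. gauss_factor (w i) (obs_cov k \<theta> i) (resid_vec k y \<theta> i))"

abbreviation all_entries :: "(nat \<times> nat) set" where
  "all_entries \<equiv> {..<n} \<times> {..<d}"

section \<open>The parameter and weight spaces\<close>

lemma space_param:
  assumes "\<theta> \<in> space param_space"
  shows fst_param: "fst \<theta> \<in> carrier_mat p d" and snd_param: "snd \<theta> \<in> pd_mats d"
  using assms space_lborel_mat by (auto simp: param_space_def space_pair_measure space_lborel_pd)

lemma space_param_nonempty: "space param_space \<noteq> {}"
  using space_lborel_mat_nonempty[of p d] one_mat_pd[of d]
  by (auto simp: param_space_def space_pair_measure space_lborel_pd)

lemma sigma_finite_param: "sigma_finite_measure param_space"
proof -
  interpret pair_sigma_finite "lborel_mat p d" "lborel_pd d"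
    by (intro pair_sigma_finite.intro sigma_finite_lborel_mat sigma_finite_lborel_pd)
  show ?thesis unfolding param_space_def by (rule sigma_finite_measure_axioms)
qed

lemma product_prob_P_mix: "product_prob_space (\<lambda>_. P_mix)"
  by (intro product_prob_spaceI P_mix_prob)

lemma prob_space_weight: "prob_space weight_space"
  unfolding weight_space_def by (intro prob_space_PiM P_mix_prob)

lemma space_P_mix: "space P_mix = {0<..}"
  using sets_eq_imp_space_eq[OF P_mix_sets] by (simp add: space_restrict_space)

lemma space_weight_pos: "w \<in> space weight_space \<Longrightarrow> i < n \<Longrightarrow> 0 < w i"
  by (auto simp: weight_space_def space_PiM space_P_mix PiE_iff)

lemma P_mix_ident: "(\<lambda>w. w) \<in> borel_measurable P_mix"
  unfolding measurable_cong_sets[OF P_mix_sets refl] by (intro measurable_restrict_space1) simp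

lemma weight_component: "i < n \<Longrightarrow> (\<lambda>w. w i) \<in> borel_measurable weight_space"
  unfolding weight_space_def
  using measurable_compose[OF measurable_component_singleton[of i "{..<n}" "\<lambda>_. P_mix"] P_mix_ident] by simp

lemma row_x: "i < n \<Longrightarrow> Matrix.row x i \<in> carrier_vec p"
  using x_carrier by (intro row_carrier_vec) auto

lemma obs_cov_pd:
  "k \<subseteq> all_entries \<Longrightarrow> \<theta> \<in> space param_space \<Longrightarrow> obs_cov k \<theta> i \<in> pd_mats (card (observed_cols k i))"
  unfolding obs_cov_def by (rule sel_mat_submatrix_pd) (auto simp: snd_param)

lemma resid_vec_eq:
  assumes k: "k \<subseteq> all_entries" and y: "y \<in> carrier_mat n d" and \<theta>: "\<theta> \<in> space param_space" and i: "i < n"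
  shows "resid_vec k y \<theta> i = Matrix.vec (card (observed_cols k i)) (\<lambda>l.
    y $$ (i, obs_col k i l) - Matrix.vec_index ((fst \<theta>)\<^sup>T *\<^sub>v Matrix.row x i) (obs_col k i l))"
proof -
  have "Matrix.row y i \<in> carrier_vec d" using y i by (intro row_carrier_vec) auto
  moreover have "(fst \<theta>)\<^sup>T *\<^sub>v Matrix.row x i \<in> carrier_vec d"
    using fst_param[OF \<theta>] row_x[OF i] by (intro mult_mat_vec_carrier) auto
  ultimately show ?thesis
    unfolding resid_vec_def using y i
    by (intro eq_vecI) (auto simp: sel_mat_mult_vec[OF k] obs_col_less[OF k] simp del: index_mult_mat_vec)
qed

lemma prior_density_pos: "\<theta> \<in> space param_space \<Longrightarrow> 0 < prior_density \<theta>"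
  using det_pd_pos[OF snd_param, of \<theta>] by (simp add: prior_density_def split_beta)

lemma obs_factor_pos:
  assumes "k \<subseteq> all_entries" "\<theta> \<in> space param_space" "\<And>i. i < n \<Longrightarrow> 0 < w i"
  shows "0 < obs_factor k y w \<theta>"
  unfolding obs_factor_def using assms
  by (intro mult_pos_pos prior_density_pos prod_pos gauss_factor_pos[OF obs_cov_pd]) auto

lemma sel_mat_all_entries:
  assumes "i < n"
  shows "sel_mat d all_entries i = 1\<^sub>m d"
proof -
  have "observed_cols all_entries i = {0..<d}" using assms by (auto simp: observed_cols_def)
  then show ?thesis by (intro eq_matI) (auto simp: sel_mat_def)
qed

text \<open>With everything observed the selection matrices are identities. This is the starting
  point from which missing entries are integrated out.\<close>

lemma joint_density_eq_obs_factor: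
  assumes y: "y \<in> carrier_mat n d" and \<theta>: "\<theta> \<in> space param_space"
  shows "joint_density y w \<theta> = obs_factor all_entries y w \<theta>"
proof -
  note C = pd_mats_carrier[OF snd_param[OF \<theta>]]
  have "gauss_factor (w i) (obs_cov all_entries \<theta> i) (resid_vec all_entries y \<theta> i) =
      (let e = Matrix.row y i - (fst \<theta>)\<^sup>T *\<^sub>v Matrix.row x i in
        w i powr (real d / 2) / sqrt (Determinant.det (snd \<theta>)) *
        exp (- (w i / 2) * scalar_prod e (inv_mat (snd \<theta>) *\<^sub>v e)))" if i: "i < n" for i
  proof -
    have "Matrix.row y i \<in> carrier_vec d" using y i by (intro row_carrier_vec) auto
    moreover have "(fst \<theta>)\<^sup>T *\<^sub>v Matrix.row x i \<in> carrier_vec d"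
      using fst_param[OF \<theta>] row_x[OF i] by (intro mult_mat_vec_carrier) auto
    ultimately have "resid_vec all_entries y \<theta> i = Matrix.row y i - (fst \<theta>)\<^sup>T *\<^sub>v Matrix.row x i"
      by (simp only: resid_vec_def sel_mat_all_entries[OF i] one_mult_mat_vec)
    moreover have "obs_cov all_entries \<theta> i = snd \<theta>"
      using C by (simp add: obs_cov_def sel_mat_all_entries[OF i])
    moreover have "dim_vec (Matrix.row y i - (fst \<theta>)\<^sup>T *\<^sub>v Matrix.row x i) = d"
      using fst_param[OF \<theta>] by simp
    ultimately show ?thesis by (simp add: gauss_factor_def Let_def mult.commute)
  qed
  then have "obs_factor all_entries y w \<theta> = prior_density \<theta> * (\<Prod>i<n.
      let e = Matrix.row y i - (fst \<theta>)\<^sup>T *\<^sub>v Matrix.row x i in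
        w i powr (real d / 2) / sqrt (Determinant.det (snd \<theta>)) *
        exp (- (w i / 2) * scalar_prod e (inv_mat (snd \<theta>) *\<^sub>v e)))"
    unfolding obs_factor_def by (intro arg_cong2[where f="(*)"] prod.cong) auto
  then show ?thesis by (simp add: joint_density_def split_beta)
qed

text \<open>Entry (i, j) enters only the factor of row i. Integrating it out deletes one coordinate
  of that residual and the matching row and column of the covariance.\<close>

lemma nn_integral_obs_factor_entry:
  assumes k: "k \<subseteq> all_entries" and ij: "(i, j) \<in> k" and y: "y \<in> carrier_mat n d"
    and \<theta>: "\<theta> \<in> space param_space" and w: "\<And>i. i < n \<Longrightarrow> 0 < w i"
  shows "(\<integral>\<^sup>+t. ennreal (obs_factor k (fill y {(i, j)} (\<lambda>_. t)) w \<theta>) \<partial>lborel) =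
    ennreal (sqrt (2 * pi) * obs_factor (k - {(i, j)}) y w \<theta>)"
proof -
  let ?k = "k - {(i, j)}" and ?y = "\<lambda>t. fill y {(i, j)} (\<lambda>_. t)"
  have i: "i < n" and j: "j < d" using k ij by auto
  have k': "?k \<subseteq> all_entries" using k by auto
  have yt: "?y t \<in> carrier_mat n d" for t by (rule fill_carrier[OF y])
  have mem: "j \<in> observed_cols k i" using ij by (simp add: observed_cols_def)
  note F = finite_observed_cols[OF k, of i]
  define c where "c = card (observed_cols k i) - 1"
  have c: "card (observed_cols k i) = Suc c"
    using mem F by (auto simp: c_def card_gt_0_iff intro!: Suc_pred[symmetric])
  have c': "card (observed_cols ?k i) = c"
    using mem F by (simp add: observed_cols_remove c_def)
  \<comment> \<open>The position of column j among the observed columns of row i, which is its index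
    in the reduced residual and covariance.\<close>
  obtain l0 where l0: "l0 < Suc c" "obs_col k i l0 = j"
    using mem F c unfolding obs_col_def
    by (metis in_set_conv_nth set_sorted_list_of_set length_sorted_list_of_set)
  have col: "obs_col ?k i l = obs_col k i (insert_index l0 l)" if "l < c" for l
    using obs_col_remove[OF k, of l0 i l] l0 that c by simp
  have il: "insert_index l0 l < Suc c" "insert_index l0 l \<noteq> l0" if "l < c" for l
    using that by (auto simp: insert_index_def)
  have col_ne: "obs_col k i (insert_index l0 l) \<noteq> j" if "l < c" for l
    using obs_col_inj[of "insert_index l0 l" k i l0] il[OF that] l0 c by simp
  note S = pd_mats_carrier[OF snd_param[OF \<theta>]]
  have cov: "mat_delete (obs_cov k \<theta> i) l0 l0 = obs_cov ?k \<theta> i"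
  proof (rule eq_matI)
    note C = pd_mats_carrier[OF obs_cov_pd[OF k \<theta>, of i], unfolded c]
    note C' = pd_mats_carrier[OF obs_cov_pd[OF k' \<theta>, of i], unfolded c']
    show "dim_row (mat_delete (obs_cov k \<theta> i) l0 l0) = dim_row (obs_cov ?k \<theta> i)"
      "dim_col (mat_delete (obs_cov k \<theta> i) l0 l0) = dim_col (obs_cov ?k \<theta> i)"
      using C C' by auto
    fix l l' assume "l < dim_row (obs_cov ?k \<theta> i)" "l' < dim_col (obs_cov ?k \<theta> i)"
    then have l: "l < c" "l' < c" using C' by auto
    show "mat_delete (obs_cov k \<theta> i) l0 l0 $$ (l, l') = obs_cov ?k \<theta> i $$ (l, l')"
      unfolding mat_delete_index[OF C l0(1) l0(1) l, symmetric]
      unfolding obs_cov_def sel_mat_submatrix[OF k S] sel_mat_submatrix[OF k' S]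
      using l il c c' by (simp add: col)
  qed
  let ?\<mu> = "Matrix.vec_index ((fst \<theta>)\<^sup>T *\<^sub>v Matrix.row x i)"
  have e: "resid_vec k (?y t) \<theta> i = Matrix.vec (Suc c) (\<lambda>l. ?y t $$ (i, obs_col k i l) - ?\<mu> (obs_col k i l))" for t
    using resid_vec_eq[OF k yt \<theta> i] by (simp add: c)
  have e': "resid_vec ?k y \<theta> i = Matrix.vec c (\<lambda>l. y $$ (i, obs_col ?k i l) - ?\<mu> (obs_col ?k i l))"
    using resid_vec_eq[OF k' y \<theta> i] by (simp add: c')
  \<comment> \<open>The prior and the factors of the other rows, which are constant in the
    integrated entry.\<close>
  define R where "R = prior_density \<theta> * (\<Prod>i'\<in>{..<n} - {i}. gauss_factor (w i') (obs_cov ?k \<theta> i') (resid_vec ?k y \<theta> i'))"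
  have R: "R \<ge> 0"
    unfolding R_def using prior_density_pos[OF \<theta>] w
    by (intro mult_nonneg_nonneg prod_nonneg less_imp_le[OF gauss_factor_pos[OF obs_cov_pd[OF k' \<theta>]]]) auto
  have other: "gauss_factor (w i') (obs_cov k \<theta> i') (resid_vec k (?y t) \<theta> i') =
      gauss_factor (w i') (obs_cov ?k \<theta> i') (resid_vec ?k y \<theta> i')" if i': "i' < n" "i' \<noteq> i" for t i'
  proof -
    have "sel_mat d k i' = sel_mat d ?k i'"
      using i' by (simp add: sel_mat_def observed_cols_remove)
    moreover have "Matrix.row (?y t) i' = Matrix.row y i'"
      using y i' by (intro eq_vecI) (auto simp: fill_def)
    ultimately show ?thesis by (simp add: obs_cov_def resid_vec_def)
  qed
  have split: "obs_factor k (?y t) w \<theta> = R * gauss_factor (w i) (obs_cov k \<theta> i) (resid_vec k (?y t) \<theta> i)" for t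
    unfolding obs_factor_def R_def
    by (subst prod.remove[of _ i]) (use i other in \<open>auto simp: mult_ac\<close>)
  have split': "obs_factor ?k y w \<theta> = R * gauss_factor (w i) (obs_cov ?k \<theta> i) (resid_vec ?k y \<theta> i)"
    unfolding obs_factor_def R_def
    by (subst prod.remove[of _ i]) (use i in \<open>auto simp: mult_ac\<close>)
  show ?thesis
    unfolding split split' cov[symmetric]
  proof (rule nn_integral_gauss_factor[where \<mu>="?\<mu> j"])
    show "obs_cov k \<theta> i \<in> pd_mats (Suc c)" using obs_cov_pd[OF k \<theta>, of i] by (simp add: c)
    show "Matrix.vec_index (resid_vec k (?y t) \<theta> i) l0 = t - ?\<mu> j" for t
      unfolding e using l0 i j by (simp add: fill_index[OF y])
    show "Matrix.vec_index (resid_vec k (?y t) \<theta> i) (insert_index l0 l) = Matrix.vec_index (resid_vec ?k y \<theta> i) l"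
      if l: "l < c" for t l
    proof -
      have "insert_index l0 l < card (observed_cols k i)" using il[OF l] c by simp
      from obs_col_less[OF k this] show ?thesis
        unfolding e e' using l il[OF l] col_ne[OF l] i by (simp add: col fill_index[OF y])
    qed
  qed (use l0 R w[OF i] e e' in auto)
qed

section \<open>Measurability of the model densities\<close>

lemma param_mat_measurable:
  assumes "\<Theta> \<in> M \<rightarrow>\<^sub>M param_space"
  shows "mat_measurable M p d (\<lambda>v. fst (\<Theta> v))" and "mat_measurable M d d (\<lambda>v. snd (\<Theta> v))"
proof -
  have *: "(\<lambda>v. fst (\<Theta> v)) \<in> M \<rightarrow>\<^sub>M lborel_mat p d" "(\<lambda>v. snd (\<Theta> v)) \<in> M \<rightarrow>\<^sub>M lborel_pd d"
    using assms unfolding param_space_def by (auto intro: measurable_compose[OF _ measurable_fst] measurable_compose[OF _ measurable_snd])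
  have sp: "\<Theta> v \<in> space param_space" if "v \<in> space M" for v
    using measurable_space[OF assms that] .
  show "mat_measurable M p d (\<lambda>v. fst (\<Theta> v))"
    unfolding mat_measurable_def
    using fst_param[OF sp] measurable_compose[OF *(1) lborel_mat_index] by auto
  show "mat_measurable M d d (\<lambda>v. snd (\<Theta> v))"
    unfolding mat_measurable_def
    using pd_mats_carrier[OF snd_param[OF sp]] measurable_compose[OF *(2) lborel_pd_index] by auto
qed

lemma prior_density_measurable:
  assumes "\<Theta> \<in> M \<rightarrow>\<^sub>M param_space"
  shows "(\<lambda>v. prior_density (\<Theta> v)) \<in> borel_measurable M"
proof -
  note S = param_mat_measurable(2)[OF assms]
  have sp: "\<Theta> v \<in> space param_space" if "v \<in> space M" for v
    using measurable_space[OF assms that] .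
  have A: "a \<in> carrier_mat d d" using a_psd by (simp add: psd_mats_def)
  have I: "mat_measurable M d d (\<lambda>v. inv_mat (snd (\<Theta> v)) * a)"
    using det_pd_nonzero[OF snd_param[OF sp]]
    by (intro mat_measurable_mult[OF mat_measurable_inv[OF S]] mat_measurable_const A)
  have "(\<lambda>v. \<Sum>i<d. (inv_mat (snd (\<Theta> v)) * a) $$ (i, i)) \<in> borel_measurable M"
    using I by (intro borel_measurable_sum) (auto simp: mat_measurable_def)
  moreover have "sum_list (diag_mat (inv_mat (snd (\<Theta> v)) * a)) = (\<Sum>i<d. (inv_mat (snd (\<Theta> v)) * a) $$ (i, i))"
    if "v \<in> space M" for v
  proof -
    have "inv_mat (snd (\<Theta> v)) * a \<in> carrier_mat d d" using I that by (auto simp: mat_measurable_def)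
    then show ?thesis unfolding diag_mat_def
      by (simp only: carrier_matD interv_sum_list_conv_sum_set_nat lessThan_atLeast0 atLeast_upt set_upt)
  qed
  ultimately have tr: "(\<lambda>v. sum_list (diag_mat (inv_mat (snd (\<Theta> v)) * a))) \<in> borel_measurable M"
    by (subst measurable_cong) auto
  note [measurable] = det_measurable[OF S] tr
  show ?thesis unfolding prior_density_def split_beta by measurable
qed

text \<open>Weights, filled entries and parameters are given as measurable functions on an arbitrary
  space, so one statement covers every product space and every section with some arguments
  fixed.\<close>

lemma obs_factor_measurable:
  assumes k: "k \<subseteq> all_entries" and y: "y \<in> carrier_mat n d"
    and W: "\<And>i. i < n \<Longrightarrow> (\<lambda>v. W v i) \<in> borel_measurable M"
    and U: "\<And>ij. ij \<in> s \<Longrightarrow> (\<lambda>v. U v ij) \<in> borel_measurable M"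
    and \<Theta>: "\<Theta> \<in> M \<rightarrow>\<^sub>M param_space"
  shows "(\<lambda>v. obs_factor k (fill y s (U v)) (W v) (\<Theta> v)) \<in> borel_measurable M"
proof -
  have sp: "\<Theta> v \<in> space param_space" if "v \<in> space M" for v
    using measurable_space[OF \<Theta> that] .
  have "(\<lambda>v. gauss_factor (W v i) (obs_cov k (\<Theta> v) i) (resid_vec k (fill y s (U v)) (\<Theta> v) i)) \<in> borel_measurable M"
    if i: "i < n" for i
  proof -
    let ?c = "card (observed_cols k i)"
    have row: "vec_measurable M d (\<lambda>v. Matrix.row (fill y s (U v)) i)"
      unfolding vec_measurable_def
    proof (intro conjI ballI allI impI)
      show "Matrix.row (fill y s (U v)) i \<in> carrier_vec d" for v
        using fill_carrier[OF y, of s "U v"] i by (intro row_carrier_vec) auto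
      fix j assume j: "j < d"
      have "Matrix.vec_index (Matrix.row (fill y s (U v)) i) j = (if (i, j) \<in> s then U v (i, j) else y $$ (i, j))" for v
        using y i j by (simp add: fill_def)
      then show "(\<lambda>v. Matrix.vec_index (Matrix.row (fill y s (U v)) i) j) \<in> borel_measurable M"
        using U by (cases "(i, j) \<in> s") simp_all
    qed
    note sel = mat_measurable_const[OF sel_mat_carrier]
    have P: "mat_measurable M ?c ?c (\<lambda>v. obs_cov k (\<Theta> v) i)"
      unfolding obs_cov_def
      by (intro mat_measurable_mult[OF mat_measurable_mult[OF sel param_mat_measurable(2)[OF \<Theta>]]]
          mat_measurable_transpose sel)
    have e: "vec_measurable M ?c (\<lambda>v. resid_vec k (fill y s (U v)) (\<Theta> v) i)"
      unfolding resid_vec_def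
      by (intro vec_measurable_minus vec_measurable_mult_mat_vec[OF sel] row
          vec_measurable_mult_mat_vec[OF mat_measurable_transpose[OF param_mat_measurable(1)[OF \<Theta>]]]
          vec_measurable_const row_x i)
    have dim: "dim_vec (resid_vec k (fill y s (U v)) (\<Theta> v) i) = ?c" for v
      by (simp add: resid_vec_def sel_mat_def)
    have q: "(\<lambda>v. scalar_prod (resid_vec k (fill y s (U v)) (\<Theta> v) i)
        (inv_mat (obs_cov k (\<Theta> v) i) *\<^sub>v resid_vec k (fill y s (U v)) (\<Theta> v) i)) \<in> borel_measurable M"
      using det_pd_nonzero[OF obs_cov_pd[OF k sp]]
      by (intro scalar_prod_measurable[OF e] vec_measurable_mult_mat_vec[OF mat_measurable_inv[OF P] e])
    note [measurable] = q det_measurable[OF P] W[OF i]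
    show ?thesis unfolding gauss_factor_def dim by measurable
  qed
  then show ?thesis
    unfolding obs_factor_def
    by (intro borel_measurable_times prior_density_measurable[OF \<Theta>] borel_measurable_prod) auto
qed

text \<open>Induction over the integrated entries with \<open>k\<close> generalized: the inner
  integral removes one entry from \<open>k\<close>, and the hypothesis is then applied to the
  smaller structure. Each entry contributes one factor \<open>sqrt (2 * pi)\<close>.\<close>

lemma nn_integral_obs_factor_entries:
  assumes "finite s" and "s \<subseteq> k" and k: "k \<subseteq> all_entries" and y: "y \<in> carrier_mat n d"
    and \<theta>: "\<theta> \<in> space param_space" and w: "\<And>i. i < n \<Longrightarrow> 0 < w i"
  shows "(\<integral>\<^sup>+u. ennreal (obs_factor k (fill y s u) w \<theta>) \<partial>lborel_entries s) =
    ennreal (sqrt (2 * pi) ^ card s * obs_factor (k - s) y w \<theta>)"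
  using assms(1,2,3)
proof (induction s arbitrary: k rule: finite_induct)
  case empty
  then show ?case
    by (simp add: lborel_entries_def fill_empty nn_integral_const emeasure_count_space PiM_empty)
next
  case (insert ij s)
  interpret product_sigma_finite "\<lambda>_ :: nat \<times> nat. lborel :: real measure" by (rule product_sigma_finite_lborel)
  obtain i j where ij: "ij = (i, j)" by (cases ij)
  have meas: "(\<lambda>u. obs_factor k (fill y s' u) w \<theta>) \<in> borel_measurable (lborel_entries s')" for s'
    using insert.prems \<theta> by (intro obs_factor_measurable y lborel_entries_component) auto
  have meas': "(\<lambda>u. obs_factor (k - {ij}) (fill y s u) w \<theta>) \<in> borel_measurable (lborel_entries s)"
    using insert.prems \<theta> by (intro obs_factor_measurable y lborel_entries_component) auto
  have "(\<integral>\<^sup>+u. ennreal (obs_factor k (fill y (insert ij s) u) w \<theta>) \<partial>lborel_entries (insert ij s)) =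
      (\<integral>\<^sup>+u. (\<integral>\<^sup>+t. ennreal (obs_factor k (fill y (insert ij s) (u(ij := t))) w \<theta>) \<partial>lborel) \<partial>lborel_entries s)"
    unfolding lborel_entries_def using insert.hyps meas[of "insert ij s", unfolded lborel_entries_def]
    by (intro product_nn_integral_insert) auto
  also have "\<dots> = (\<integral>\<^sup>+u. (\<integral>\<^sup>+t. ennreal (obs_factor k (fill (fill y s u) {(i, j)} (\<lambda>_. t)) w \<theta>) \<partial>lborel) \<partial>lborel_entries s)"
    using insert.hyps by (simp add: fill_insert ij[symmetric])
  also have "\<dots> = (\<integral>\<^sup>+u. ennreal (sqrt (2 * pi) * obs_factor (k - {ij}) (fill y s u) w \<theta>) \<partial>lborel_entries s)"
    using insert.prems w unfolding ij
    by (intro nn_integral_cong nn_integral_obs_factor_entry fill_carrier y \<theta>) auto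
  also have "\<dots> = ennreal (sqrt (2 * pi)) * (\<integral>\<^sup>+u. ennreal (obs_factor (k - {ij}) (fill y s u) w \<theta>) \<partial>lborel_entries s)"
    using meas' by (subst nn_integral_cmult[symmetric]) (auto simp: ennreal_mult')
  also have "\<dots> = ennreal (sqrt (2 * pi)) * ennreal (sqrt (2 * pi) ^ card s * obs_factor (k - {ij} - s) y w \<theta>)"
    using insert.prems insert.hyps by (subst insert.IH) auto
  also have "k - {ij} - s = k - insert ij s" by auto
  finally show ?case
    using insert.hyps by (simp add: ennreal_mult'[symmetric] mult.assoc)
qed

lemma obs_density_eq:
  assumes k: "k \<subseteq> all_entries" and y: "y \<in> carrier_mat n d"
    and w: "w \<in> space weight_space" and \<theta>: "\<theta> \<in> space param_space"
  shows "obs_density k y w \<theta> = ennreal (sqrt (2 * pi) ^ card (all_entries - k) * obs_factor k y w \<theta>)"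
proof -
  have "obs_density k y w \<theta> =
      (\<integral>\<^sup>+u. ennreal (obs_factor all_entries (fill y (all_entries - k) u) w \<theta>) \<partial>lborel_entries (all_entries - k))"
    unfolding obs_density_def
    by (intro nn_integral_cong) (simp add: joint_density_eq_obs_factor[OF fill_carrier[OF y] \<theta>])
  also have "\<dots> = ennreal (sqrt (2 * pi) ^ card (all_entries - k) * obs_factor (all_entries - (all_entries - k)) y w \<theta>)"
    by (rule nn_integral_obs_factor_entries[OF _ _ _ y \<theta> space_weight_pos[OF w]]) auto
  also have "all_entries - (all_entries - k) = k" using k by auto
  finally show ?thesis .
qed

text \<open>The consistency behind the comparison: the DA joint density is the marginal of the DAI
  joint density over the imputed entries. The powers of \<open>sqrt (2 * pi)\<close> match exactly
  because the entries outside \<open>k'\<close> and those in \<open>k' - k\<close> together form the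
  entries outside \<open>k\<close>.\<close>

lemma nn_integral_obs_density:
  assumes kk: "k \<subseteq> k'" and k': "k' \<subseteq> all_entries" and y: "y \<in> carrier_mat n d"
    and w: "w \<in> space weight_space" and \<theta>: "\<theta> \<in> space param_space"
  shows "(\<integral>\<^sup>+z. obs_density k' (fill y (k' - k) z) w \<theta> \<partial>lborel_entries (k' - k)) = obs_density k y w \<theta>"
proof -
  let ?c = "sqrt (2 * pi)"
  have fin: "finite k'" using k' by (rule finite_subset) simp
  have meas: "(\<lambda>u. obs_factor k' (fill y (k' - k) u) w \<theta>) \<in> borel_measurable (lborel_entries (k' - k))"
    using k' \<theta> by (intro obs_factor_measurable y lborel_entries_component) auto
  have "(\<integral>\<^sup>+z. obs_density k' (fill y (k' - k) z) w \<theta> \<partial>lborel_entries (k' - k)) =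
      (\<integral>\<^sup>+z. ennreal (?c ^ card (all_entries - k')) * ennreal (obs_factor k' (fill y (k' - k) z) w \<theta>) \<partial>lborel_entries (k' - k))"
    by (intro nn_integral_cong) (simp add: obs_density_eq[OF k' fill_carrier[OF y] w \<theta>] ennreal_mult')
  also have "\<dots> = ennreal (?c ^ card (all_entries - k')) * ennreal (?c ^ card (k' - k) * obs_factor (k' - (k' - k)) y w \<theta>)"
    using meas fin
    by (subst nn_integral_cmult) (auto simp: nn_integral_obs_factor_entries[OF _ _ k' y \<theta> space_weight_pos[OF w]])
  also have "k' - (k' - k) = k" using kk by auto
  also have "ennreal (?c ^ card (all_entries - k')) * ennreal (?c ^ card (k' - k) * obs_factor k y w \<theta>) =
      ennreal (?c ^ (card (all_entries - k') + card (k' - k)) * obs_factor k y w \<theta>)"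
    by (simp add: ennreal_mult'[symmetric] power_add mult.assoc)
  also have "card (all_entries - k') + card (k' - k) = card ((all_entries - k') \<union> (k' - k))"
    using fin by (intro card_Un_disjoint[symmetric]) auto
  also have "(all_entries - k') \<union> (k' - k) = all_entries - k" using kk k' by auto
  finally show ?thesis
    using obs_density_eq[OF _ y w \<theta>, of k] kk k' by auto
qed

lemma obs_density_measurable:
  assumes k: "k \<subseteq> all_entries" and y: "y \<in> carrier_mat n d"
    and W: "W \<in> M \<rightarrow>\<^sub>M weight_space" and U: "U \<in> M \<rightarrow>\<^sub>M lborel_entries s" and \<Theta>: "\<Theta> \<in> M \<rightarrow>\<^sub>M param_space"
  shows "(\<lambda>v. obs_density k (fill y s (U v)) (W v) (\<Theta> v)) \<in> borel_measurable M"
proof -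
  have "(\<lambda>v. ennreal (sqrt (2 * pi) ^ card (all_entries - k) * obs_factor k (fill y s (U v)) (W v) (\<Theta> v))) \<in> borel_measurable M"
    using measurable_compose[OF W weight_component] measurable_compose[OF U lborel_entries_component]
    by (intro measurable_compose[OF _ measurable_ennreal] borel_measurable_times borel_measurable_const
        obs_factor_measurable[OF k y _ _ \<Theta>]) auto
  then show ?thesis
    using measurable_space[OF W] measurable_space[OF \<Theta>]
    by (subst measurable_cong) (auto simp: obs_density_eq[OF k fill_carrier[OF y]])
qed

lemma obs_density_measurable_param_weight:
  assumes k: "k \<subseteq> all_entries" and y: "y \<in> carrier_mat n d"
  shows "(\<lambda>(\<theta>, w). obs_density k y w \<theta>) \<in> borel_measurable (param_space \<Otimes>\<^sub>M weight_space)"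
proof -
  \<comment> \<open>Filling no entries is expressed through the one-point product over the empty
    index set, whose only element is the undefined function.\<close>
  have "(\<lambda>_. \<lambda>_. undefined) \<in> param_space \<Otimes>\<^sub>M weight_space \<rightarrow>\<^sub>M lborel_entries {}"
    by (rule measurable_const) (simp add: lborel_entries_def space_PiM)
  from obs_density_measurable[OF k y measurable_snd this measurable_fst]
  show ?thesis by (simp add: fill_empty split_beta')
qed

section \<open>The posterior as a marginal of the joint law\<close>

definition post_density :: "(nat \<times> nat) set \<Rightarrow> real mat \<Rightarrow> real mat \<times> real mat \<Rightarrow> ennreal" where
  "post_density k y \<theta> = (\<integral>\<^sup>+w. ennreal (obs_factor k y w \<theta>) \<partial>weight_space)"

lemma post_density_measurable:
  assumes k: "k \<subseteq> all_entries" and y: "y \<in> carrier_mat n d"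
  shows "post_density k y \<in> borel_measurable param_space"
proof -
  interpret W: prob_space weight_space by (rule prob_space_weight)
  have "(\<lambda>v. obs_factor k (fill y {} (\<lambda>_. 0)) (snd v) (fst v)) \<in> borel_measurable (param_space \<Otimes>\<^sub>M weight_space)"
    by (intro obs_factor_measurable k y measurable_compose[OF measurable_snd weight_component]) auto
  then have "(\<lambda>(\<theta>, w). ennreal (obs_factor k y w \<theta>)) \<in> borel_measurable (param_space \<Otimes>\<^sub>M weight_space)"
    by (simp add: fill_empty split_beta')
  then show ?thesis
    unfolding post_density_def by (rule W.borel_measurable_nn_integral)
qed

text \<open>The product of the n one-dimensional mixing integrals is a single integral over the
  product measure of the weights.\<close>

lemma post_unnorm_eq:
  assumes k: "k \<subseteq> all_entries" and y: "y \<in> carrier_mat n d"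
  shows "post_unnorm k y = density param_space (post_density k y)"
proof -
  interpret product_prob_space "\<lambda>_ :: nat. P_mix" by (rule product_prob_P_mix)
  let ?f = "\<lambda>\<theta> i w. w powr (real (card (observed_cols k i)) / 2) /
           sqrt (Determinant.det (sel_mat d k i * snd \<theta> * (sel_mat d k i)\<^sup>T)) *
         exp (- (resid k y i \<theta> * w / 2))"
  have eq: "ennreal (prior_density \<theta>) * (\<Prod>i<n. \<integral>\<^sup>+w. ennreal (?f \<theta> i w) \<partial>P_mix) = post_density k y \<theta>"
    if \<theta>: "\<theta> \<in> space param_space" for \<theta>
  proof -
    note [measurable] = P_mix_ident
    have f: "?f \<theta> i v = gauss_factor v (obs_cov k \<theta> i) (resid_vec k y \<theta> i)" for i v
    proof -
      have "resid k y i \<theta> = scalar_prod (resid_vec k y \<theta> i) (inv_mat (obs_cov k \<theta> i) *\<^sub>v resid_vec k y \<theta> i)"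
        by (simp add: resid_def resid_vec_def obs_cov_def Let_def split_beta)
      moreover have "dim_vec (resid_vec k y \<theta> i) = card (observed_cols k i)"
        by (simp add: resid_vec_def sel_mat_def)
      ultimately show ?thesis by (simp add: gauss_factor_def obs_cov_def)
    qed
    have "(\<Prod>i<n. \<integral>\<^sup>+w. ennreal (?f \<theta> i w) \<partial>P_mix) = (\<integral>\<^sup>+w. (\<Prod>i<n. ennreal (?f \<theta> i (w i))) \<partial>weight_space)"
      unfolding weight_space_def by (rule product_nn_integral_prod[symmetric]) (simp, measurable)
    also have "ennreal (prior_density \<theta>) * \<dots> =
        (\<integral>\<^sup>+w. ennreal (prior_density \<theta>) * (\<Prod>i<n. ennreal (?f \<theta> i (w i))) \<partial>weight_space)"
    proof (rule nn_integral_cmult[symmetric])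
      show "(\<lambda>w. \<Prod>i<n. ennreal (?f \<theta> i (w i))) \<in> borel_measurable weight_space"
      proof (rule borel_measurable_prod_ennreal)
        fix i assume "i \<in> {..<n}"
        then have [measurable]: "(\<lambda>w. w i) \<in> borel_measurable weight_space" by (simp add: weight_component)
        show "(\<lambda>w. ennreal (?f \<theta> i (w i))) \<in> borel_measurable weight_space" by measurable
      qed
    qed
    also have "\<dots> = post_density k y \<theta>"
      unfolding post_density_def
    proof (rule nn_integral_cong)
      fix w assume w: "w \<in> space weight_space"
      have "0 \<le> gauss_factor (w i) (obs_cov k \<theta> i) (resid_vec k y \<theta> i)" if "i < n" for i
        using gauss_factor_pos[OF obs_cov_pd[OF k \<theta>] space_weight_pos[OF w that]] by (rule less_imp_le)
      then show "ennreal (prior_density \<theta>) * (\<Prod>i<n. ennreal (?f \<theta> i (w i))) = ennreal (obs_factor k y w \<theta>)"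
        unfolding f obs_factor_def using prior_density_pos[OF \<theta>]
        by (subst prod_ennreal) (auto simp: ennreal_mult' prod_nonneg)
    qed
    finally show ?thesis .
  qed
  have "(\<lambda>\<theta>. ennreal (prior_density \<theta>) * (\<Prod>i<n. \<integral>\<^sup>+w. ennreal (?f \<theta> i w) \<partial>P_mix)) \<in> borel_measurable param_space"
    using post_density_measurable[OF k y] by (subst measurable_cong[OF eq])
  then show ?thesis
    unfolding post_unnorm_def
    by (rule density_cong[OF _ post_density_measurable[OF k y]]) (intro AE_I2 eq)
qed

text \<open>A positive integrand over a probability space. It serves the degenerate case, where an
  integral 0 over the parameters must mean a null parameter space.\<close>

lemma post_density_pos:
  assumes k: "k \<subseteq> all_entries" and y: "y \<in> carrier_mat n d" and \<theta>: "\<theta> \<in> space param_space"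
  shows "post_density k y \<theta> \<noteq> 0"
proof
  interpret W: prob_space weight_space by (rule prob_space_weight)
  assume "post_density k y \<theta> = 0"
  moreover have "(\<lambda>w. obs_factor k (fill y {} (\<lambda>_. 0)) w \<theta>) \<in> borel_measurable weight_space"
    using \<theta> by (intro obs_factor_measurable k y weight_component) auto
  ultimately have "AE w in weight_space. ennreal (obs_factor k y w \<theta>) = 0"
    unfolding post_density_def by (subst (asm) nn_integral_0_iff_AE) (auto simp: fill_empty)
  then have "AE w in weight_space. False"
    using AE_space
  proof eventually_elim
    case (elim w)
    have "0 < obs_factor k y w \<theta>"
      by (rule obs_factor_pos[OF k \<theta>]) (rule space_weight_pos[OF elim(2)])
    with elim(1) show False by (simp add: ennreal_eq_0_iff)
  qed
  then show False by (simp add: W.AE_False)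
qed

lemma nn_integral_obs_density_weight:
  assumes k: "k \<subseteq> all_entries" and y: "y \<in> carrier_mat n d" and \<theta>: "\<theta> \<in> space param_space"
  shows "(\<integral>\<^sup>+w. obs_density k y w \<theta> \<partial>weight_space) =
    ennreal (sqrt (2 * pi) ^ card (all_entries - k)) * post_density k y \<theta>"
proof -
  have [measurable]: "(\<lambda>w. obs_factor k y w \<theta>) \<in> borel_measurable weight_space"
    using obs_factor_measurable[OF k y, where W="\<lambda>w. w" and M=weight_space and s="{}" and U="\<lambda>_ _. 0" and \<Theta>="\<lambda>_. \<theta>"] \<theta>
    by (simp add: fill_empty weight_component)
  have "(\<integral>\<^sup>+w. obs_density k y w \<theta> \<partial>weight_space) =
      (\<integral>\<^sup>+w. ennreal (sqrt (2 * pi) ^ card (all_entries - k)) * ennreal (obs_factor k y w \<theta>) \<partial>weight_space)"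
    by (intro nn_integral_cong) (simp add: obs_density_eq[OF k y _ \<theta>] ennreal_mult')
  then show ?thesis unfolding post_density_def by (simp add: nn_integral_cmult)
qed

text \<open>Rewrites the posterior as the parameter marginal of \<open>obs_density\<close>, the form
  in which the abstract comparison produces its stationary law. The two differ by a constant, which
  normalization removes.\<close>

lemma posterior_eq:
  assumes k: "k \<subseteq> all_entries" and y: "y \<in> carrier_mat n d"
  shows "posterior k y = normalize_measure (density param_space (\<lambda>\<theta>. \<integral>\<^sup>+w. obs_density k y w \<theta> \<partial>weight_space))"
proof -
  let ?c = "ennreal (sqrt (2 * pi) ^ card (all_entries - k))"
  note [measurable] = post_density_measurable[OF k y]
  have "(\<lambda>\<theta>. \<integral>\<^sup>+w. obs_density k y w \<theta> \<partial>weight_space) \<in> borel_measurable param_space"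
    by (subst measurable_cong[OF nn_integral_obs_density_weight[OF k y]]) auto
  then have "density param_space (\<lambda>\<theta>. \<integral>\<^sup>+w. obs_density k y w \<theta> \<partial>weight_space) =
      density param_space (\<lambda>\<theta>. ?c * post_density k y \<theta>)"
    by (rule density_cong) (auto simp: nn_integral_obs_density_weight[OF k y])
  then show ?thesis
    unfolding posterior_def post_unnorm_eq[OF k y]
    by (simp add: normalize_measure_density_cmult)
qed

text \<open>Instance of \<open>L2_rate_data_augmentation_le\<close> with the entries of
  \<open>k' - k\<close> as the extra latent variable. That lemma asks for a nonzero finite total
  mass; finiteness is propriety of the posterior, and zero mass is treated apart.\<close>

lemma L2_rate_DA_le_DAI:
  assumes y: "y \<in> carrier_mat n d" and kk: "k \<subseteq> k'" and k': "k' \<subseteq> all_entries"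
    and proper: "proper (post_unnorm k y)"
  shows "L2_rate (posterior k y) (DA_kernel k y) \<le> L2_rate (posterior k y) (DAI_kernel k k' y)"
proof -
  have k: "k \<subseteq> all_entries" using kk k' by auto
  interpret W: prob_space weight_space by (rule prob_space_weight)
  let ?Z = "lborel_entries (k' - k)" and ?f = "\<lambda>\<theta> w z. obs_density k' (fill y (k' - k) z) w \<theta>"
    and ?g = "\<lambda>\<theta> w. obs_density k y w \<theta>" and ?c = "ennreal (sqrt (2 * pi) ^ card (all_entries - k))"
  have finZ: "finite (k' - k)" using finite_subset[OF k'] by simp
  note [measurable] = post_density_measurable[OF k y]
  have T: "(\<integral>\<^sup>+\<theta>. (\<integral>\<^sup>+w. ?g \<theta> w \<partial>weight_space) \<partial>param_space) = ?c * (\<integral>\<^sup>+\<theta>. post_density k y \<theta> \<partial>param_space)"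
    by (simp add: nn_integral_obs_density_weight[OF k y] nn_integral_cmult cong: nn_integral_cong_simp)
  have "emeasure (post_unnorm k y) (space (post_unnorm k y)) = (\<integral>\<^sup>+\<theta>. post_density k y \<theta> \<partial>param_space)"
    unfolding post_unnorm_eq[OF k y] by (auto simp: emeasure_density intro!: nn_integral_cong)
  then have fin: "(\<integral>\<^sup>+\<theta>. post_density k y \<theta> \<partial>param_space) < \<infinity>"
    using proper by (simp add: proper_def)
  show ?thesis
  proof (cases "(\<integral>\<^sup>+\<theta>. post_density k y \<theta> \<partial>param_space) = 0")
    case True
    \<comment> \<open>The posterior density is positive, so the parameter space is null and both kernels
      are the point mass that replaces an unnormalizable measure.\<close>
    then have "AE \<theta> in param_space. post_density k y \<theta> = 0" by (simp add: nn_integral_0_iff_AE)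
    then have "AE \<theta> in param_space. False"
      using AE_space by eventually_elim (auto simp: post_density_pos[OF k y])
    then have null: "emeasure param_space (space param_space) = 0"
      by (simp add: AE_iff_measurable[OF sets.top])
    define \<theta>0 where "\<theta>0 = (SOME \<theta>. \<theta> \<in> space param_space)"
    have \<theta>0: "\<theta>0 \<in> space param_space" unfolding \<theta>0_def using space_param_nonempty by (simp add: some_in_eq)
    \<comment> \<open>Both kernels end with a draw of this kind, from \<open>k\<close> and
      \<open>y\<close> or from \<open>k'\<close> and a completed response, so the preceding draws
      only integrate a constant.\<close>
    have cp: "normalize_measure (cond_param l y' w) = return param_space \<theta>0"
      if "l \<subseteq> all_entries" "y' \<in> carrier_mat n d" "w \<in> space weight_space" for l y' w
      unfolding cond_param_def \<theta>0_def
      using measurable_Pair1[OF obs_density_measurable_param_weight[OF that(1,2)] that(3)]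
      by (intro normalize_measure_null null) auto
    have ret: "subprob_space (return param_space \<theta>0)"
      using \<theta>0 by (rule subprob_space_return)
    have W: "prob_space (normalize_measure (cond_W k y \<theta>))" "space (normalize_measure (cond_W k y \<theta>)) = space weight_space" for \<theta>
      using W.not_empty by (auto simp: cond_W_def normalize_measure_simps intro!: prob_space_normalize_measure)
    have Z: "prob_space (normalize_measure (cond_Z k k' y w \<theta>))" for w \<theta>
      using space_lborel_entries_nonempty by (auto simp: cond_Z_def intro!: prob_space_normalize_measure)
    have "DA_kernel k y \<theta> = return param_space \<theta>0" for \<theta>
    proof -
      have "DA_kernel k y \<theta> = normalize_measure (cond_W k y \<theta>) \<bind> (\<lambda>w. return param_space \<theta>0)"
        unfolding DA_kernel_def by (rule bind_cong) (auto simp: W cp[OF k y])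
      then show ?thesis using bind_const'[OF W(1) ret] by simp
    qed
    moreover have "DAI_kernel k k' y \<theta> = return param_space \<theta>0" for \<theta>
    proof -
      have "DAI_kernel k k' y \<theta> = normalize_measure (cond_W k y \<theta>) \<bind> (\<lambda>w.
          normalize_measure (cond_Z k k' y w \<theta>) \<bind> (\<lambda>z. return param_space \<theta>0))"
        unfolding DAI_kernel_def by (intro bind_cong refl) (auto simp: W cp[OF k' fill_carrier[OF y]])
      then show ?thesis using bind_const'[OF W(1) ret] bind_const'[OF Z ret] by simp
    qed
    ultimately have "DA_kernel k y = DAI_kernel k k' y" by auto
    then show ?thesis by simp
  next
    case False
    have f: "(\<lambda>(\<theta>, w, z). ?f \<theta> w z) \<in> borel_measurable (param_space \<Otimes>\<^sub>M (weight_space \<Otimes>\<^sub>M ?Z))"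
    proof -
      have "(\<lambda>v. ?f (fst v) (fst (snd v)) (snd (snd v))) \<in> borel_measurable (param_space \<Otimes>\<^sub>M (weight_space \<Otimes>\<^sub>M ?Z))"
        by (intro obs_density_measurable[OF k' y]) measurable
      then show ?thesis by (simp add: split_beta')
    qed
    have "L2_rate (posterior k y) (\<lambda>\<theta>. normalize_measure (density weight_space (?g \<theta>)) \<bind>
          (\<lambda>w. normalize_measure (density param_space (\<lambda>\<theta>. ?g \<theta> w)))) \<le>
      L2_rate (posterior k y) (\<lambda>\<theta>. normalize_measure (density weight_space (?g \<theta>)) \<bind>
          (\<lambda>w. normalize_measure (density ?Z (?f \<theta> w)) \<bind>
            (\<lambda>z. normalize_measure (density param_space (\<lambda>\<theta>. ?f \<theta> w z)))))"
      unfolding posterior_eq[OF k y]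
    proof (rule L2_rate_data_augmentation_le[OF sigma_finite_param W.sigma_finite_measure_axioms _
          space_param_nonempty W.not_empty space_lborel_entries_nonempty f])
      show "sigma_finite_measure ?Z"
        unfolding lborel_entries_def by (rule sigma_finite_PiM_lborel[OF finZ])
      show "?g \<theta> w = (\<integral>\<^sup>+z. ?f \<theta> w z \<partial>?Z)" if "\<theta> \<in> space param_space" "w \<in> space weight_space" for \<theta> w
        using nn_integral_obs_density[OF kk k' y that(2,1)] by simp
      show "(\<integral>\<^sup>+\<theta>. (\<integral>\<^sup>+w. ?g \<theta> w \<partial>weight_space) \<partial>param_space) \<noteq> 0"
        "(\<integral>\<^sup>+\<theta>. (\<integral>\<^sup>+w. ?g \<theta> w \<partial>weight_space) \<partial>param_space) < \<infinity>"
        unfolding T using False fin by (auto simp: ennreal_mult_less_top)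
    qed
    then show ?thesis
      by (simp add: DA_kernel_def[abs_def] DAI_kernel_def[abs_def] cond_W_def cond_param_def cond_Z_def)
  qed
qed

end

theorem theorem8:
  fixes n p d :: nat
    and x a y :: "real mat"
    and m :: real
    and P_mix :: "real measure"
    and k k' :: "(nat \<times> nat) set"
  assumes "robust_regression n p d x a P_mix"
    and "y \<in> carrier_mat n d"
    and "missing_structure n d k"
    and "k \<noteq> {..<n} \<times> {..<d}"
    and "proper (robust_regression.post_unnorm n p d x m a P_mix k y)"
    and "robust_regression.DA_well_defined n p d x m a P_mix k y"
    and "monotone_structure n d k'"
    and "k \<subset> k'"
    and "robust_regression.DAI_well_defined n p d x m a P_mix k k' y"
  shows "L2_rate (robust_regression.posterior n p d x m a P_mix k y)
           (robust_regression.DA_kernel n p d x m a P_mix k y)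
       \<le> L2_rate (robust_regression.posterior n p d x m a P_mix k y)
           (robust_regression.DAI_kernel n p d x m a P_mix k k' y)"
proof -
  interpret robust_regression n p d x m a P_mix by fact
  have "k' \<subseteq> {..<n} \<times> {..<d}"
    using assms(7) by (simp add: monotone_structure_def missing_structure_def)
  then show ?thesis
    using L2_rate_DA_le_DAI assms(2,5,8) by blast
qed

end
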